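(* Suppose there exists an algorithm StrEdit which, on inputs of length $n$, runs in time $\alpha(n)$ and achieves approximation factor $\beta(n)$ for string edit distance. Then for any $s\ge 2$ there exists an algorithm that, given a string $\sigma$ of length $n$ over $T\cup\bar{T}$ ($|T|=s$), obtains an $O(\beta(n)\sqrt{\log d}\,(\log z)^2)$-approximation for the edit distance from $\sigma$ to $\mathrm{Dyck}(s)$ in $O(n\log n + \alpha(n))$ time with probability at least $1-\frac{1}{n}-\frac{1}{d}$, where $d$ is the optimal edit distance from $\sigma$ to $\mathrm{Dyck}(s)$ and $z$ is the number of blocks of $\sigma$.
   Context: $T$ is a finite set of open parentheses, each $x\in T$ with a unique congruent close parenthesis $\bar{x}$; $\mathrm{Dyck}(s)$ is the set of well-balanced strings over $T\cup\bar{T}$, generated by $S\to SS\mid\varepsilon\mid aS\bar{a}$ ($a\in T$). Edit distance allows insertions, deletions and substitutions. Number of blocks $z$: after removing from $\sigma$ any prefix of close parentheses, any suffix of open parentheses and (repeatedly) contiguous well-balanced substrings (operations that do not change the edit distance), the string can be written $Y_1X_1Y_2X_2\cdots Y_zX_z$ with each $Y_a$ a nonempty string of open parentheses and each $X_a$ a nonempty string of close parentheses. StrEdit between a string $Z$ of open parentheses and a string $X$ of close parentheses is the string edit distance between $Z$ and the reverse of $X$ with each $\bar{t}$ replaced by $t$.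
   Formalization: The factor (log z)^2 is read as (max(1, log z))^2, since for z = 1 the stated factor is 0 and for z = 0 it is undefined; n is at least 1, and for d = 0 the undefined term 1/d is taken as 0. *)

theory Defs
  imports "HOL-Probability.Probability"
begin

section \<open>Edit distance\<close>

inductive edit_step :: "'a list \<Rightarrow> 'a list \<Rightarrow> bool" where
  insertion: "edit_step (u @ v) (u @ [a] @ v)"
| deletion: "edit_step (u @ [a] @ v) (u @ v)"
| substitution: "edit_step (u @ [a] @ v) (u @ [b] @ v)"

definition edit_distance :: "'a list \<Rightarrow> 'a list \<Rightarrow> nat" where
  "edit_distance x y = (LEAST k. (edit_step ^^ k) x y)"


section \<open>Dyck languages\<close>

datatype 'a paren = Open 'a | Close 'a

inductive_set Dyck :: "'a set \<Rightarrow> 'a paren list set" for T :: "'a set" where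
  empty: "[] \<in> Dyck T"
| append: "u \<in> Dyck T \<Longrightarrow> v \<in> Dyck T \<Longrightarrow> u @ v \<in> Dyck T"
| wrap: "a \<in> T \<Longrightarrow> u \<in> Dyck T \<Longrightarrow> [Open a] @ u @ [Close a] \<in> Dyck T"

definition dyck_strings :: "'a set \<Rightarrow> 'a paren list set" where
  "dyck_strings T = lists (Open ` T \<union> Close ` T)"

definition dyck_distance :: "'a set \<Rightarrow> 'a paren list \<Rightarrow> nat" where
  "dyck_distance T \<sigma> = (INF \<tau>\<in>Dyck T. edit_distance \<sigma> \<tau>)"


section \<open>Number of blocks\<close>

inductive trim_step :: "'a set \<Rightarrow> 'a paren list \<Rightarrow> 'a paren list \<Rightarrow> bool" for T :: "'a set" where
  close_prefix: "p \<noteq> [] \<Longrightarrow> set p \<subseteq> range Close \<Longrightarrow> trim_step T (p @ u) u"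
| open_suffix: "q \<noteq> [] \<Longrightarrow> set q \<subseteq> range Open \<Longrightarrow> trim_step T (u @ q) u"
| balanced: "w \<noteq> [] \<Longrightarrow> w \<in> Dyck T \<Longrightarrow> trim_step T (u @ w @ v) (u @ v)"

definition trimmed :: "'a set \<Rightarrow> 'a paren list \<Rightarrow> bool" where
  "trimmed T \<tau> \<longleftrightarrow> (\<nexists>\<tau>'. trim_step T \<tau> \<tau>')"

text \<open>The pairs in the list are the blocks \<open>(Y\<^sub>a, X\<^sub>a)\<close>.\<close>

definition is_block_decomposition :: "('a paren list \<times> 'a paren list) list \<Rightarrow> 'a paren list \<Rightarrow> bool" where
  "is_block_decomposition bs \<tau> \<longleftrightarrow>
     \<tau> = concat (map (\<lambda>(Y, X). Y @ X) bs) \<and>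
     (\<forall>(Y, X) \<in> set bs. Y \<noteq> [] \<and> set Y \<subseteq> range Open \<and> X \<noteq> [] \<and> set X \<subseteq> range Close)"

definition has_blocks :: "'a set \<Rightarrow> 'a paren list \<Rightarrow> nat \<Rightarrow> bool" where
  "has_blocks T \<sigma> z \<longleftrightarrow>
     (\<exists>\<tau> bs. (trim_step T)\<^sup>*\<^sup>* \<sigma> \<tau> \<and> trimmed T \<tau> \<and> is_block_decomposition bs \<tau> \<and> z = length bs)"

definition num_blocks :: "'a set \<Rightarrow> 'a paren list \<Rightarrow> nat" where
  "num_blocks T \<sigma> = (THE z. has_blocks T \<sigma> z)"

text \<open>Every string over the alphabet has exactly one number of blocks
  (lemma \<open>ex1_has_blocks\<close> below).\<close>

fun cancel :: "'a paren list \<Rightarrow> 'a paren list \<Rightarrow> 'a paren list" where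
  "cancel st [] = rev st"
| "cancel st (Open a # xs) = cancel (Open a # st) xs"
| "cancel (Open b # st) (Close a # xs) =
     (if a = b then cancel st xs else cancel (Close a # Open b # st) xs)"
| "cancel (Close b # st) (Close a # xs) = cancel (Close a # Close b # st) xs"
| "cancel [] (Close a # xs) = cancel [Close a] xs"

fun is_open :: "'a paren \<Rightarrow> bool" where
  "is_open (Open a) = True"
| "is_open (Close a) = False"

lemma is_open_iff: "is_open x \<longleftrightarrow> x \<in> range Open" "\<not> is_open x \<longleftrightarrow> x \<in> range Close"
  by (cases x; auto)+

lemma cancel_Dyck: "w \<in> Dyck T \<Longrightarrow> cancel st (w @ v) = cancel st v"
  by (induction arbitrary: st v rule: Dyck.induct) auto

lemma cancel_append: "cancel st (u @ v) = cancel (rev (cancel st u)) v"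
  by (induction st u rule: cancel.induct) auto

lemma cancel_closes:
  assumes "set cl \<subseteq> range Close"
  shows "cancel (st @ cl) u = rev cl @ cancel st u"
proof (induction u arbitrary: st)
  case (Cons x u)
  show ?case
  proof (cases st)
    case Nil
    have "cancel cl (x # u) = cancel ([x] @ cl) u"
      using assms by (cases x; cases cl) auto
    also have "\<dots> = rev cl @ cancel [x] u" by (rule Cons.IH)
    also have "cancel [x] u = cancel [] (x # u)" by (cases x) auto
    finally show ?thesis by (simp add: Nil)
  next
    case st: (Cons y st')
    show ?thesis
      using Cons.IH[of st'] Cons.IH[of "x # y # st'"] unfolding st
      by (cases x; cases y) simp_all
  qed
qed simp

lemma cancel_opens: "set q \<subseteq> range Open \<Longrightarrow> cancel st q = rev st @ q"
  by (induction q arbitrary: st) auto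

definition trim :: "'a paren list \<Rightarrow> 'a paren list" where
  "trim \<sigma> = rev (dropWhile is_open (rev (dropWhile (Not \<circ> is_open) (cancel [] \<sigma>))))"

lemma cancel_only_closes:
  "set p \<subseteq> range Close \<Longrightarrow> set st \<subseteq> range Close \<Longrightarrow> cancel st p = rev st @ p"
proof (induction p arbitrary: st)
  case (Cons x xs)
  have "cancel st (x # xs) = cancel (x # st) xs"
    using Cons.prems by (cases st) auto
  with Cons show ?case by simp
qed simp

lemma dropWhile_all: "\<forall>x\<in>set p. P x \<Longrightarrow> dropWhile P (p @ u) = dropWhile P u"
  by (induction p) auto

lemma dropWhile_ends:
  assumes "\<forall>x\<in>set q. is_open x"
  shows "dropWhile is_open (rev (dropWhile (Not \<circ> is_open) (u @ q)))
       = dropWhile is_open (rev (dropWhile (Not \<circ> is_open) u))"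
proof (induction u)
  case Nil
  have "dropWhile (Not \<circ> is_open) q = q" using assms by (cases q) auto
  moreover have "dropWhile is_open (rev q) = []" using assms by auto
  ultimately show ?case by simp
next
  case (Cons x u)
  have "dropWhile is_open (rev q @ r) = dropWhile is_open r" for r
    using assms by (intro dropWhile_all) auto
  from this[of "rev u @ [x]"] Cons show ?case by auto
qed

lemma trim_step_trim: "trim_step T \<sigma> \<tau> \<Longrightarrow> trim \<sigma> = trim \<tau>"
proof (induction rule: trim_step.induct)
  case (close_prefix p u)
  have "cancel [] (p @ u) = cancel ([] @ rev p) u"
    using close_prefix by (simp add: cancel_append cancel_only_closes)
  also have "\<dots> = p @ cancel [] u"
    using close_prefix by (subst cancel_closes) auto
  finally have "cancel [] (p @ u) = p @ cancel [] u" .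
  moreover have "\<forall>x\<in>set p. (Not \<circ> is_open) x"
    using close_prefix by (auto simp: is_open_iff)
  ultimately show ?case unfolding trim_def by (simp only: dropWhile_all)
next
  case (open_suffix q u)
  have "cancel [] (u @ q) = cancel [] u @ q"
    using open_suffix by (simp add: cancel_append[of _ u] cancel_opens)
  moreover have "\<forall>x\<in>set q. is_open x"
    using open_suffix by (auto simp: is_open_iff)
  ultimately show ?case unfolding trim_def by (simp only: dropWhile_ends)
next
  case (balanced w u v)
  then show ?case unfolding trim_def by (simp add: cancel_append[of _ u] cancel_Dyck)
qed

lemma cancel_irreducible:
  assumes "\<And>a u v. rev st @ xs \<noteq> u @ [Open a, Close a] @ v"
  shows "cancel st xs = rev st @ xs"
  using assms
proof (induction xs arbitrary: st)
  case (Cons x xs)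
  have IH: "cancel (x # st) xs = rev st @ x # xs"
    using Cons.IH[of "x # st"] Cons.prems by simp
  have "cancel st (x # xs) = cancel (x # st) xs"
  proof (cases x)
    case (Close a)
    have "st = [] \<or> hd st \<noteq> Open a"
      using Cons.prems[of "rev (tl st)" a xs] Close by (cases st) auto
    with Close show ?thesis by (cases st; cases "hd st") auto
  qed simp
  with IH show ?case by simp
qed simp

lemma trimmed_trim:
  assumes \<tau>: "\<tau> \<in> dyck_strings T" and "trimmed T \<tau>"
  shows "trim \<tau> = \<tau>"
    and "\<tau> = [] \<or> is_open (hd \<tau>) \<and> \<not> is_open (last \<tau>)"
proof -
  have no: "\<not> trim_step T \<tau> \<tau>'" for \<tau>' using assms by (simp add: trimmed_def)
  have "\<tau> \<noteq> u @ [Open a, Close a] @ v" for a u v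
  proof
    assume eq: "\<tau> = u @ [Open a, Close a] @ v"
    with \<tau> have "a \<in> T" by (auto simp: dyck_strings_def)
    from Dyck.wrap[OF this Dyck.empty] have "[Open a, Close a] \<in> Dyck T" by simp
    with no eq show False using trim_step.balanced[of "[Open a, Close a]" T u v] by auto
  qed
  then have c: "cancel [] \<tau> = \<tau>" using cancel_irreducible[of "[]" \<tau>] by simp
  show e: "\<tau> = [] \<or> is_open (hd \<tau>) \<and> \<not> is_open (last \<tau>)"
  proof (rule disjCI)
    assume "\<not> (is_open (hd \<tau>) \<and> \<not> is_open (last \<tau>))"
    then consider "\<not> is_open (hd \<tau>)" | "is_open (last \<tau>)" by blast
    then show "\<tau> = []"
    proof cases
      case 1
      show ?thesis
      proof (rule ccontr)
        assume "\<tau> \<noteq> []"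
        then have "[hd \<tau>] @ tl \<tau> = \<tau>" by simp
        with 1[unfolded is_open_iff(2)] no[of "tl \<tau>"] trim_step.close_prefix[of "[hd \<tau>]" T "tl \<tau>"] show False
          by simp
      qed
    next
      case 2
      show ?thesis
      proof (rule ccontr)
        assume "\<tau> \<noteq> []"
        then have "butlast \<tau> @ [last \<tau>] = \<tau>" by simp
        with 2[unfolded is_open_iff(1)] no[of "butlast \<tau>"] trim_step.open_suffix[of "[last \<tau>]" T "butlast \<tau>"] show False
          by simp
      qed
    qed
  qed
  show "trim \<tau> = \<tau>"
  proof (cases "\<tau> = []")
    case True then show ?thesis by (simp add: trim_def)
  next
    case False
    with e have "is_open (hd \<tau>)" "\<not> is_open (last \<tau>)" by auto
    have "dropWhile (Not \<circ> is_open) \<tau> = \<tau>"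
      using False \<open>is_open (hd \<tau>)\<close> by (simp add: dropWhile_eq_self_iff)
    moreover have "dropWhile is_open (rev \<tau>) = rev \<tau>"
      using False \<open>\<not> is_open (last \<tau>)\<close> by (simp add: dropWhile_eq_self_iff hd_rev)
    ultimately show ?thesis by (simp add: trim_def c)
  qed
qed

lemma trim_step_strings: "trim_step T \<sigma> \<tau> \<Longrightarrow> \<sigma> \<in> dyck_strings T \<Longrightarrow> \<tau> \<in> dyck_strings T"
  by (induction rule: trim_step.induct) (auto simp: dyck_strings_def)

lemma trim_steps:
  assumes "(trim_step T)\<^sup>*\<^sup>* \<sigma> \<tau>" "\<sigma> \<in> dyck_strings T"
  shows "trim \<sigma> = trim \<tau>" "\<tau> \<in> dyck_strings T"
  using assms by (induction rule: rtranclp_induct) (auto simp: trim_step_trim trim_step_strings)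

lemma ex_trimmed: "\<exists>\<tau>. (trim_step T)\<^sup>*\<^sup>* \<sigma> \<tau> \<and> trimmed T \<tau>"
proof (induction \<sigma> rule: length_induct)
  case (1 \<sigma>)
  show ?case
  proof (cases "trimmed T \<sigma>")
    case False
    then obtain \<tau> where t: "trim_step T \<sigma> \<tau>" by (auto simp: trimmed_def)
    then have "length \<tau> < length \<sigma>" by (induction rule: trim_step.induct) auto
    with 1 t show ?thesis by (meson converse_rtranclp_into_rtranclp)
  qed auto
qed

lemma ex_block_decomposition:
  "\<tau> = [] \<or> is_open (hd \<tau>) \<and> \<not> is_open (last \<tau>) \<Longrightarrow> \<exists>bs. is_block_decomposition bs \<tau>"
proof (induction \<tau> rule: length_induct)
  case (1 \<tau>)
  show ?case
  proof (cases "\<tau> = []")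
    case True
    then show ?thesis by (intro exI[of _ "[]"]) (simp add: is_block_decomposition_def)
  next
    case False
    with 1 have hl: "is_open (hd \<tau>)" "\<not> is_open (last \<tau>)" by auto
    define Y where "Y = takeWhile is_open \<tau>"
    define r where "r = dropWhile is_open \<tau>"
    define X where "X = takeWhile (Not \<circ> is_open) r"
    define \<rho> where "\<rho> = dropWhile (Not \<circ> is_open) r"
    have \<tau>: "\<tau> = Y @ X @ \<rho>" by (simp add: Y_def X_def \<rho>_def r_def)
    have Y: "Y \<noteq> []" "set Y \<subseteq> range Open"
      using False hl by (cases \<tau>) (auto simp: Y_def is_open_iff[symmetric] dest: set_takeWhileD)
    have "r \<noteq> []" using False hl by (auto simp: r_def dropWhile_eq_Nil_conv)
    then have "\<not> is_open (hd r)" unfolding r_def by (rule hd_dropWhile)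
    with \<open>r \<noteq> []\<close> have X: "X \<noteq> []" "set X \<subseteq> range Close"
      by (cases r; auto simp: X_def is_open_iff[symmetric] dest: set_takeWhileD)+
    have "\<rho> = [] \<or> is_open (hd \<rho>) \<and> \<not> is_open (last \<rho>)"
    proof (cases "\<rho> = []")
      case False
      then have "(is_open (hd \<rho>))" unfolding \<rho>_def using hd_dropWhile[of "Not \<circ> is_open" r] by auto
      with hl False \<tau> show ?thesis by simp
    qed simp
    moreover have "length \<rho> < length \<tau>" using \<tau> Y by simp
    ultimately obtain bs where "is_block_decomposition bs \<rho>" using 1 by blast
    with \<tau> X Y have "is_block_decomposition ((Y, X) # bs) \<tau>"
      by (auto simp: is_block_decomposition_def)
    then show ?thesis by blast
  qed
qed

fun count_blocks :: "'a paren list \<Rightarrow> nat" where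
  "count_blocks (Open a # Close b # xs) = Suc (count_blocks (Close b # xs))"
| "count_blocks (x # xs) = count_blocks xs"
| "count_blocks [] = 0"

lemma count_blocks_Close: "set X \<subseteq> range Close \<Longrightarrow> count_blocks (X @ r) = count_blocks r"
  by (induction X) auto

lemma count_blocks_block:
  assumes "Y \<noteq> []" "set Y \<subseteq> range Open" "X \<noteq> []" "set X \<subseteq> range Close"
  shows "count_blocks (Y @ X @ r) = Suc (count_blocks r)"
  using assms
proof (induction Y)
  case (Cons y Y)
  obtain a where y: "y = Open a" using Cons by auto
  show ?case
  proof (cases Y)
    case Nil
    obtain b X' where X: "X = Close b # X'" using Cons by (cases X) auto
    have "count_blocks (Close b # X' @ r) = count_blocks r"
      using count_blocks_Close[of X r] Cons X by simp
    then show ?thesis by (simp add: y Nil X)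
  next
    case (Cons y' Y')
    with Cons.prems obtain a' where "y' = Open a'" by auto
    with Cons Cons.IH Cons.prems show ?thesis by (simp add: y)
  qed
qed simp

lemma length_block_decomposition:
  "is_block_decomposition bs \<tau> \<Longrightarrow> length bs = count_blocks \<tau>"
proof (induction bs arbitrary: \<tau>)
  case (Cons b bs)
  obtain Y X where "b = (Y, X)" by force
  with Cons show ?case
    by (simp add: is_block_decomposition_def count_blocks_block)
qed (simp add: is_block_decomposition_def)

lemma ex1_has_blocks:
  assumes "\<sigma> \<in> dyck_strings T"
  shows "\<exists>!z. has_blocks T \<sigma> z"
proof -
  obtain \<tau> where \<tau>: "(trim_step T)\<^sup>*\<^sup>* \<sigma> \<tau>" "trimmed T \<tau>" using ex_trimmed by blast
  have "\<tau> \<in> dyck_strings T" using trim_steps(2)[OF \<tau>(1) assms] .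
  from ex_block_decomposition[OF trimmed_trim(2)[OF this \<tau>(2)]]
  obtain bs where "is_block_decomposition bs \<tau>" by blast
  then have "has_blocks T \<sigma> (length bs)" using \<tau> by (auto simp: has_blocks_def)
  moreover have "z = count_blocks (trim \<sigma>)" if "has_blocks T \<sigma> z" for z
    using that assms trim_steps trimmed_trim(1)
    by (metis has_blocks_def length_block_decomposition)
  ultimately show ?thesis by metis
qed


section \<open>Randomized word RAM\<close>

text \<open>
  Operands are register numbers, except for the constant in \<open>Const\<close> and the jump target in
  \<open>JumpLess\<close>. \<open>Rand r a\<close> puts into \<open>r\<close> a uniformly distributed number between \<open>0\<close> and the
  content of \<open>a\<close>. Each instruction takes one time unit, \<open>Halt\<close> included.
\<close>

datatype instr =
    Const nat nat
  | Add nat nat nat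
  | Sub nat nat nat
  | Mul nat nat nat
  | Div nat nat nat
  | Load nat nat
  | Store nat nat
  | JumpLess nat nat nat
  | Rand nat nat
  | Halt

datatype state =
    Running (pc: nat) (regs: "nat \<Rightarrow> nat") (memory: "nat \<Rightarrow> nat")
  | Halted nat
  | Fault

text \<open>
  A machine word holds a number below \<open>W\<close>; producing a larger number is a fault, from which the
  machine does not recover. Since addresses are words too, unit cost per instruction is adequate
  as long as \<open>W\<close> is polynomial in the size of the input.
\<close>

definition set_reg :: "nat \<Rightarrow> nat \<Rightarrow> (nat \<Rightarrow> nat) \<Rightarrow> (nat \<Rightarrow> nat) \<Rightarrow> nat \<Rightarrow> nat \<Rightarrow> state" where
  "set_reg W p R M r v = (if v < W then Running (Suc p) (R(r := v)) M else Fault)"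

fun exec_instr :: "nat \<Rightarrow> nat \<Rightarrow> (nat \<Rightarrow> nat) \<Rightarrow> (nat \<Rightarrow> nat) \<Rightarrow> instr \<Rightarrow> state pmf" where
  "exec_instr W p R M (Const r k) = return_pmf (set_reg W p R M r k)"
| "exec_instr W p R M (Add r a b) = return_pmf (set_reg W p R M r (R a + R b))"
| "exec_instr W p R M (Sub r a b) = return_pmf (set_reg W p R M r (R a - R b))"
| "exec_instr W p R M (Mul r a b) = return_pmf (set_reg W p R M r (R a * R b))"
| "exec_instr W p R M (Div r a b) = return_pmf (set_reg W p R M r (R a div R b))"
| "exec_instr W p R M (Load r a) = return_pmf (set_reg W p R M r (M (R a)))"
| "exec_instr W p R M (Store a b) = return_pmf (Running (Suc p) R (M(R a := R b)))"
| "exec_instr W p R M (JumpLess a b l) =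
     return_pmf (Running (if R a < R b then l else Suc p) R M)"
| "exec_instr W p R M (Rand r a) = map_pmf (set_reg W p R M r) (pmf_of_set {..R a})"
| "exec_instr W p R M Halt = return_pmf (Halted (R 0))"

fun step :: "nat \<Rightarrow> instr list \<Rightarrow> state \<Rightarrow> state pmf" where
  "step W P (Running p R M) =
     (if p < length P then exec_instr W p R M (P ! p) else return_pmf Fault)"
| "step W P (Halted v) = return_pmf (Halted v)"
| "step W P Fault = return_pmf Fault"

fun run :: "nat \<Rightarrow> instr list \<Rightarrow> nat \<Rightarrow> state \<Rightarrow> state pmf" where
  "run W P 0 S = return_pmf S"
| "run W P (Suc t) S = bind_pmf (step W P S) (run W P t)"

text \<open>The input \<open>xs\<close> is in memory from address \<open>0\<close>, its parameters are in the first registers,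
  and everything else is \<open>0\<close>.\<close>

definition start :: "nat list \<Rightarrow> nat list \<Rightarrow> state" where
  "start ps xs = Running 0 (\<lambda>i. if i < length ps then ps ! i else 0)
                           (\<lambda>i. if i < length xs then xs ! i else 0)"

text \<open>Words of \<open>O(log (n + s))\<close> bits, for an input of length \<open>n\<close> over an alphabet of size \<open>s\<close>.\<close>

definition word_bound :: "nat \<Rightarrow> nat \<Rightarrow> nat \<Rightarrow> nat" where
  "word_bound c s n = (n + s + 2) ^ c"

fun paren_code :: "nat paren \<Rightarrow> nat" where
  "paren_code (Open a) = 2 * a"
| "paren_code (Close a) = 2 * a + 1"

text \<open>Distribution of the state after \<open>t\<close> time units.\<close>

definition run_on_pair :: "nat \<Rightarrow> nat \<Rightarrow> instr list \<Rightarrow> nat \<Rightarrow> nat list \<Rightarrow> nat list \<Rightarrow> state pmf" where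
  "run_on_pair c s P t x y =
     run (word_bound c s (length x + length y)) P t (start [length x, length y] (x @ y))"

definition run_on_parens :: "nat \<Rightarrow> nat \<Rightarrow> instr list \<Rightarrow> nat \<Rightarrow> nat paren list \<Rightarrow> state pmf" where
  "run_on_parens c s P t \<sigma> =
     run (word_bound c s (length \<sigma>)) P t (start [length \<sigma>] (map paren_code \<sigma>))"

definition approximations :: "nat \<Rightarrow> real \<Rightarrow> state set" where
  "approximations d f = {Halted e | e. real d \<le> real e \<and> real e \<le> f * real d}"

text \<open>The input length of string edit distance is the total length of the two strings.
  The program is the same for all alphabets.\<close>

definition str_edit_algorithm :: "nat \<Rightarrow> instr list \<Rightarrow> (nat \<Rightarrow> nat) \<Rightarrow> (nat \<Rightarrow> real) \<Rightarrow> bool" where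
  "str_edit_algorithm c P \<alpha> \<beta> \<longleftrightarrow>
     (\<forall>s n x y. x \<in> lists {..<s} \<longrightarrow> y \<in> lists {..<s} \<longrightarrow> length x + length y = n \<longrightarrow>
        measure_pmf.prob (run_on_pair c s P (\<alpha> n) x y)
          (approximations (edit_distance x y) (\<beta> n)) = 1)"

end

theory Submission
  imports Defs "HOL-Library.Sublist"
begin

text \<open>
  Match the parentheses with a stack, ignoring types. This yields a forest, which is decomposed into
  heavy paths with respect to the number of blocks below a node. The open and the close parentheses
  on a path are two strings, and the sum of their indel distances over all paths, plus the number of
  unmatched parentheses, is the estimate.

  It is at least the edit distance, since deleting the parentheses that are not aligned leaves a
  balanced string. For the converse, let \<open>K(f)\<close> be the least number of deletions that turn \<open>f\<close> into a
  factor of a Dyck word. It does not increase when a balanced factor is removed, as an adjacent open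
  and close parenthesis that are both kept must match each other. So a path inside \<open>f\<close> costs at most
  \<open>2 K(f)\<close>. As \<open>K\<close> is superadditive and every parenthesis is in at most \<open>log z\<close> subtrees that hang off
  a heavy path, the estimate is within a factor \<open>O(max 1 (log z))\<close> of the optimum.

  Giving the paths disjoint alphabets turns the sum into the indel distance of a single pair of
  strings of total length exactly \<open>n\<close>, and one call of the given algorithm suffices.
\<close>

section \<open>Deletion distances\<close>

text \<open>\<open>\<alpha>\<close> and \<open>\<beta>\<close> are arbitrary functions, so neither
  the times nor the factors of several calls on shorter strings could be combined; hence the single
  call on total length exactly \<open>n\<close>. This asks for a distance that is additive over
  disjoint alphabets. The indel distance is, as letters of different parts never align. The edit
  distance is not, as it may substitute across parts: with \<open>x = ab\<close>,
  \<open>y = []\<close> in one part and \<open>x' = []\<close>, \<open>y' = cd\<close> in the other,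
  the parts cost 4, but \<open>ab\<close> becomes \<open>cd\<close> in 2 substitutions. As the indel
  distance can be twice the edit distance, the output of the subroutine is doubled to remain an
  upper bound of the optimum. Disjoint alphabets enlarge the alphabet from \<open>s\<close> to
  \<open>2 * s * n\<close> letters; words polynomial in \<open>n + 2 * s * n\<close> are still
  polynomial in \<open>n + s\<close>, with the exponent doubled. All code around the call is
  deterministic. The claimed probability is at most 0 for \<open>n = 1\<close> and for
  \<open>d = 1\<close>, which is where the logarithms in the bounds vanish; in all other cases the
  program succeeds with probability 1, and its answer is exact for \<open>d = 0\<close>.\<close>

lemma subseq_set: "subseq xs ys \<Longrightarrow> set xs \<subseteq> set ys"
  by (induction rule: list_emb.induct) auto

section \<open>Dyck words under insertion and deletion\<close>

text \<open>Induction on the derivation of the outer word with the cut universally quantified: the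
  cut falls into one factor of an \<open>append\<close>, and to the inside or an end of a
  \<open>wrap\<close>. It allows a finished Dyck word to be put back next to a path.\<close>

lemma Dyck_insert:
  assumes "u @ v \<in> Dyck T" "w \<in> Dyck T"
  shows "u @ w @ v \<in> Dyck T"
proof -
  have "\<forall>u v. x = u @ v \<longrightarrow> u @ w @ v \<in> Dyck T" if "x \<in> Dyck T" for x
    using that
  proof (induction rule: Dyck.induct)
    case empty
    then show ?case using assms(2) by simp
  next
    case (append p q)
    show ?case
    proof (intro allI impI)
      fix u v assume "p @ q = u @ v"
      then consider r where "p = u @ r" "v = r @ q" | r where "u = p @ r" "q = r @ v"
        by (auto simp: append_eq_append_conv2)
      then show "u @ w @ v \<in> Dyck T"
      proof cases
        case 1
        with append have "u @ w @ r \<in> Dyck T" by blast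
        from Dyck.append[OF this append(2)] 1 show ?thesis by simp
      next
        case 2
        with append have "r @ w @ v \<in> Dyck T" by blast
        from Dyck.append[OF append(1) this] 2 show ?thesis by simp
      qed
    qed
  next
    case (wrap a x)
    show ?case
    proof (intro allI impI)
      fix u v assume e: "[Open a] @ x @ [Close a] = u @ v"
      have wr: "[Open a] @ x @ [Close a] \<in> Dyck T" using wrap by (intro Dyck.wrap)
      show "u @ w @ v \<in> Dyck T"
      proof (cases "u = [] \<or> v = []")
        case True
        then show ?thesis using Dyck.append[OF assms(2) wr] Dyck.append[OF wr assms(2)] e by auto
      next
        case False
        then obtain u' v' where uv: "u = Open a # u'" "v = v' @ [Close a]" "x = u' @ v'"
          using e by (cases u; cases v rule: rev_cases) auto
        have "[Open a] @ (u' @ w @ v') @ [Close a] \<in> Dyck T"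
          using wrap uv by (intro Dyck.wrap) auto
        with uv show ?thesis by simp
      qed
    qed
  qed
  with assms show ?thesis by blast
qed

lemma Dyck_ends: "w \<in> Dyck T \<Longrightarrow> w \<noteq> [] \<Longrightarrow> is_open (hd w) \<and> \<not> is_open (last w)"
proof (induction rule: Dyck.induct)
  case (append u v)
  then show ?case by (cases "u = []"; cases "v = []") simp_all
qed simp_all

text \<open>An open parenthesis directly followed by a close one is matched with it, as nothing lies
  between them.\<close>

lemma Dyck_adjacent_pair:
  assumes "u @ [Open a, Close b] @ v \<in> Dyck T"
  shows "a = b \<and> u @ v \<in> Dyck T"
proof -
  have "\<forall>u v. x = u @ [Open a, Close b] @ v \<longrightarrow> a = b \<and> u @ v \<in> Dyck T" if "x \<in> Dyck T" for x
    using that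
  proof (induction rule: Dyck.induct)
    case empty
    then show ?case by simp
  next
    case (append p q)
    show ?case
    proof (intro allI impI)
      fix u v assume e: "p @ q = u @ [Open a, Close b] @ v"
      then consider r where "p = u @ r" "[Open a, Close b] @ v = r @ q"
        | r where "u = p @ r" "q = r @ [Open a, Close b] @ v"
        by (auto simp: append_eq_append_conv2)
      then show "a = b \<and> u @ v \<in> Dyck T"
      proof cases
        case 1
        \<comment> \<open>The border of \<open>p\<close> and \<open>q\<close> lies before, inside or
          behind the pair; inside it, \<open>q\<close> would begin with a close parenthesis.\<close>
        then consider "r = []" "q = [Open a, Close b] @ v" | "r = [Open a]" "q = Close b # v"
          | r' where "r = [Open a, Close b] @ r'" "v = r' @ q"
          by (cases r; cases "tl r") auto
        then show ?thesis
        proof cases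
          case 1
          with \<open>p = u @ r\<close> append show ?thesis by (metis Dyck.append append_Nil append_Nil2)
        next
          case 2
          with append Dyck_ends[of q T] show ?thesis by simp
        next
          case (3 r')
          with append 1 have "a = b \<and> u @ r' \<in> Dyck T" by auto
          with append Dyck.append[of "u @ r'" T q] 3 show ?thesis by simp
        qed
      next
        case (2 r)
        with append have "a = b \<and> r @ v \<in> Dyck T" by auto
        with append Dyck.append[of p T "r @ v"] 2 show ?thesis by simp
      qed
    qed
  next
    case (wrap c x)
    show ?case
    proof (intro allI impI)
      fix u v assume e: "[Open c] @ x @ [Close c] = u @ [Open a, Close b] @ v"
      show "a = b \<and> u @ v \<in> Dyck T"
      proof (cases u)
        case Nil
        with e Dyck_ends[OF wrap(2)] have "x = []" by (cases x) auto
        with e Nil show ?thesis by (auto intro: Dyck.empty)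
      next
        case (Cons y u')
        show ?thesis
        proof (cases v rule: rev_cases)
          case Nil
          with e Cons have "x = u' @ [Open a]" "x \<noteq> []" by auto
          with Dyck_ends[OF wrap(2)] show ?thesis by simp
        next
          case (snoc v' l)
          with e Cons have "x = u' @ [Open a, Close b] @ v'" "y = Open c" "l = Close c" by auto
          with wrap have "a = b" "u' @ v' \<in> Dyck T" by auto
          with Dyck.wrap[OF wrap(1), of "u' @ v'"] Cons snoc \<open>y = _\<close> \<open>l = _\<close> show ?thesis by simp
        qed
      qed
    qed
  qed
  with assms show ?thesis by blast
qed

text \<open>The witness arises by also dropping the partner of the parenthesis \<open>y\<close>.\<close>

lemma Dyck_drop_one:
  assumes "u @ [y] @ v \<in> Dyck T"
  shows "\<exists>r\<in>Dyck T. subseq r (u @ v) \<and> length (u @ v) \<le> length r + 1"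
proof -
  have "\<forall>u v. x = u @ [y] @ v \<longrightarrow> (\<exists>r\<in>Dyck T. subseq r (u @ v) \<and> length (u @ v) \<le> length r + 1)"
    if "x \<in> Dyck T" for x
    using that
  proof (induction rule: Dyck.induct)
    case empty
    then show ?case by simp
  next
    case (append p q)
    show ?case
    proof (intro allI impI)
      fix u v assume e: "p @ q = u @ [y] @ v"
      \<comment> \<open>The condition \<open>r \<noteq> []\<close> makes \<open>y\<close> the first
        letter of \<open>r\<close>, hence a letter of \<open>p\<close>; otherwise \<open>y\<close>
        belongs to \<open>q\<close>.\<close>
      then consider r where "p = u @ r" "[y] @ v = r @ q" "r \<noteq> []"
        | r where "u = p @ r" "q = r @ [y] @ v"
      proof -
        from e obtain us where "p = u @ us \<and> us @ q = [y] @ v \<or> p @ us = u \<and> q = us @ [y] @ v"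
          unfolding append_eq_append_conv2 by blast
        then show thesis using that(1)[of us] that(2)[of us] that(2)[of "[]"] by (cases "us = []") auto
      qed
      then show "\<exists>r\<in>Dyck T. subseq r (u @ v) \<and> length (u @ v) \<le> length r + 1"
      proof cases
        case (1 r')
        then obtain r where 1: "p = u @ [y] @ r" "v = r @ q" by (cases r') auto
        with append obtain d where "d \<in> Dyck T" "subseq d (u @ r)" "length (u @ r) \<le> length d + 1"
          by blast
        with append 1 show ?thesis
          by (intro bexI[of _ "d @ q"])
            (auto intro: Dyck.append simp flip: append_assoc simp: list_emb_append_mono)
      next
        case (2 r)
        with append obtain d where "d \<in> Dyck T" "subseq d (r @ v)" "length (r @ v) \<le> length d + 1"
          by blast
        with append 2 show ?thesis
          by (intro bexI[of _ "p @ d"]) (auto intro: Dyck.append list_emb_append_mono)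
      qed
    qed
  next
    case (wrap c x)
    show ?case
    proof (intro allI impI)
      fix u v assume e: "[Open c] @ x @ [Close c] = u @ [y] @ v"
      show "\<exists>r\<in>Dyck T. subseq r (u @ v) \<and> length (u @ v) \<le> length r + 1"
      proof (cases "u = [] \<or> v = []")
        \<comment> \<open>Here \<open>y\<close> is one of the outer parentheses, and
          \<open>x\<close> is what remains after dropping its partner too.\<close>
        case True
        with e have uv: "u @ v = x @ [Close c] \<or> u @ v = Open c # x"
          by (cases u) auto
        then have "length (u @ v) = length x + 1" using arg_cong[of "u @ v" _ length] by fastforce
        with uv wrap show ?thesis by (intro bexI[of _ x]) auto
      next
        case False
        with e obtain u' v' where uv: "u = Open c # u'" "v = v' @ [Close c]" "x = u' @ [y] @ v'"
          by (cases u; cases v rule: rev_cases) auto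
        with wrap obtain d where d: "d \<in> Dyck T" "subseq d (u' @ v')" "length (u' @ v') \<le> length d + 1"
          by blast
        have "subseq ([Open c] @ d @ [Close c]) ([Open c] @ (u' @ v') @ [Close c])"
          using d by (intro list_emb_append_mono) auto
        with d uv Dyck.wrap[OF wrap(1) d(1)] show ?thesis
          by (intro bexI[of _ "[Open c] @ d @ [Close c]"]) auto
      qed
    qed
  qed
  with assms show ?thesis by blast
qed

text \<open>Dyck words themselves do not give a superadditive deletion distance: the pieces
  \<open>[Open a]\<close> and \<open>[Close a]\<close> of a Dyck word cost 1 each. Factors are
  closed under taking pieces.\<close>

definition Dyck_factors :: "'a set \<Rightarrow> 'a paren list set" where
  "Dyck_factors T = {w. \<exists>u v. u @ w @ v \<in> Dyck T}"

text \<open>This is what it takes for the deletion distance not to increase when a balanced factor is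
  removed, whether or not the types of its parentheses match.\<close>

definition pair_reducible :: "'a paren list set \<Rightarrow> bool" where
  "pair_reducible L \<longleftrightarrow> [] \<in> L \<and>
     (\<forall>u a b v. u @ [Open a, Close b] @ v \<in> L \<longrightarrow> u @ v \<in> L) \<and>
     (\<forall>u x v. u @ [x] @ v \<in> L \<longrightarrow> (\<exists>r\<in>L. subseq r (u @ v) \<and> length (u @ v) \<le> length r + 1))"

lemma pair_reducible_Dyck: "pair_reducible (Dyck T)"
  unfolding pair_reducible_def
  by (blast intro: Dyck.empty dest: Dyck_drop_one conjunct2[OF Dyck_adjacent_pair])

text \<open>Everything takes place inside a Dyck word \<open>p @ w @ q\<close>. If the partner of
  the dropped letter lies in the context, the repair happens there and costs nothing: the new Dyck
  word splits along \<open>p\<close>, \<open>u @ v\<close> and \<open>q\<close>, and its middle part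
  has lost at most one letter.\<close>

lemma pair_reducible_Dyck_factors: "pair_reducible (Dyck_factors T)"
  unfolding pair_reducible_def
proof (intro conjI allI impI)
  show "[] \<in> Dyck_factors T" unfolding Dyck_factors_def
    by (intro CollectI exI[of _ "[]"]) (simp add: Dyck.empty)
next
  fix u a b v assume "u @ [Open a, Close b] @ v \<in> Dyck_factors T"
  then obtain p q where "(p @ u) @ [Open a, Close b] @ (v @ q) \<in> Dyck T"
    by (auto simp: Dyck_factors_def)
  from conjunct2[OF Dyck_adjacent_pair[OF this]] show "u @ v \<in> Dyck_factors T"
    by (auto simp: Dyck_factors_def)
next
  fix u x v assume "u @ [x] @ v \<in> Dyck_factors T"
  then obtain p q where "(p @ u) @ [x] @ (v @ q) \<in> Dyck T"
    by (auto simp: Dyck_factors_def)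
  from Dyck_drop_one[OF this] obtain r where r: "r \<in> Dyck T" "subseq r (p @ (u @ v) @ q)"
    "length (p @ u @ v @ q) \<le> length r + 1" by auto
  obtain r1 r' where r1: "r = r1 @ r'" "subseq r1 p" "subseq r' ((u @ v) @ q)"
    using r(2) by (rule subseq_appendE)
  obtain r2 r3 where r2: "r' = r2 @ r3" "subseq r2 (u @ v)" "subseq r3 q"
    using r1(3) by (rule subseq_appendE)
  have "length r1 \<le> length p" "length r3 \<le> length q" using r1 r2 by (auto dest: list_emb_length)
  with r r1 r2 show "\<exists>r\<in>Dyck_factors T. subseq r (u @ v) \<and> length (u @ v) \<le> length r + 1"
    by (intro bexI[of _ r2]) (auto simp: Dyck_factors_def)
qed

section \<open>The deletion distance to a language\<close>

text \<open>The inequality avoids truncated subtraction of lengths. The minimum is attained as soon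
  as \<open>[]\<close> is in \<open>L\<close>.\<close>

definition deletions :: "'a list set \<Rightarrow> 'a list \<Rightarrow> nat" where
  "deletions L w = (LEAST k. \<exists>w'\<in>L. subseq w' w \<and> length w \<le> length w' + k)"

lemma deletions_le: "w' \<in> L \<Longrightarrow> subseq w' w \<Longrightarrow> length w \<le> length w' + k \<Longrightarrow> deletions L w \<le> k"
  unfolding deletions_def by (intro Least_le) blast

lemma deletions_witness:
  assumes "[] \<in> L"
  obtains w' where "w' \<in> L" "subseq w' w" "length w \<le> length w' + deletions L w"
proof -
  have "\<exists>k. \<exists>w'\<in>L. subseq w' w \<and> length w \<le> length w' + k"
    using assms by (intro exI[of _ "length w"] bexI[of _ "[]"]) auto
  from LeastI_ex[OF this] that show ?thesis unfolding deletions_def by blast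
qed

lemma deletions_antimono: "L \<subseteq> L' \<Longrightarrow> [] \<in> L \<Longrightarrow> deletions L' w \<le> deletions L w"
  by (metis deletions_le deletions_witness subsetD)

lemma subseq_singletonD: "subseq m [x] \<Longrightarrow> m = [] \<or> m = [x]"
  by (cases m) (auto dest: list_emb_length split: if_splits simp: subseq_Cons2_iff)

text \<open>If the optimal subsequence keeps \<open>x\<close>, then \<open>x\<close> has to be taken
  out of it, and \<open>pair_reducible\<close> bounds the repair by one further letter.\<close>

lemma deletions_drop_letter:
  assumes L: "pair_reducible L"
  shows "deletions L (u @ v) \<le> deletions L (u @ [x] @ v) + 1"
proof -
  have "[] \<in> L" using L by (simp add: pair_reducible_def)
  then obtain w where w: "w \<in> L" "subseq w (u @ [x] @ v)"
    "length (u @ [x] @ v) \<le> length w + deletions L (u @ [x] @ v)" by (rule deletions_witness)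
  obtain w1 w' where w1: "w = w1 @ w'" "subseq w1 u" "subseq w' ([x] @ v)"
    using w(2) by (rule subseq_appendE)
  obtain m w2 where w2: "w' = m @ w2" "subseq m [x]" "subseq w2 v"
    using w1(3) by (rule subseq_appendE)
  have ss: "subseq (w1 @ w2) (u @ v)" using w1 w2 by (intro list_emb_append_mono)
  consider "m = []" | "m = [x]" using subseq_singletonD[OF w2(2)] by blast
  then show ?thesis
  proof cases
    case 1
    with w w1 w2 ss show ?thesis by (intro deletions_le[of "w1 @ w2"]) auto
  next
    case 2
    with w w1 w2 L obtain r where "r \<in> L" "subseq r (w1 @ w2)" "length (w1 @ w2) \<le> length r + 1"
      unfolding pair_reducible_def by (metis append_assoc)
    then show ?thesis using ss w w1 w2 2
      by (intro deletions_le[OF _ subseq_order.order_trans[of r "w1 @ w2"]]) auto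
  qed
qed

lemma deletions_insert_letter:
  assumes "[] \<in> L"
  shows "deletions L (u @ [x] @ v) \<le> deletions L (u @ v) + 1"
proof -
  obtain w where "w \<in> L" "subseq w (u @ v)" "length (u @ v) \<le> length w + deletions L (u @ v)"
    using assms by (rule deletions_witness)
  moreover have "subseq (u @ v) (u @ [x] @ v)" by (intro list_emb_append_mono) auto
  ultimately show ?thesis
    by (intro deletions_le[OF _ subseq_order.order_trans[of w "u @ v"]]) auto
qed

text \<open>Three cases by what the optimal subsequence keeps of the pair. If nothing, it stays
  valid. If one letter, the repair may cost one deletion, but the deletion of the other letter is
  saved. If both, they are adjacent in it and can be removed together.\<close>

lemma deletions_drop_pair:
  assumes L: "pair_reducible L"
  shows "deletions L (u @ v) \<le> deletions L (u @ [Open a, Close b] @ v)"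
proof -
  have "[] \<in> L" using L by (simp add: pair_reducible_def)
  then obtain w where w: "w \<in> L" "subseq w (u @ [Open a, Close b] @ v)"
    "length (u @ [Open a, Close b] @ v) \<le> length w + deletions L (u @ [Open a, Close b] @ v)"
    by (rule deletions_witness)
  obtain w1 w' where w1: "w = w1 @ w'" "subseq w1 u" "subseq w' ([Open a, Close b] @ v)"
    using w(2) by (rule subseq_appendE)
  obtain m w2 where w2: "w' = m @ w2" "subseq m [Open a, Close b]" "subseq w2 v"
    using w1(3) by (rule subseq_appendE)
  obtain m1 m2 where m: "m = m1 @ m2" "subseq m1 [Open a]" "subseq m2 [Close b]"
    using w2(2) subseq_appendE[of m "[Open a]" "[Close b]"] by auto
  have ss: "subseq (w1 @ w2) (u @ v)" using w1 w2 by (intro list_emb_append_mono)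
  consider "m = []" | x where "m = [x]" | "m = [Open a, Close b]"
    using m by (auto dest!: subseq_singletonD)
  then show ?thesis
  proof cases
    case 1
    with w w1 w2 ss show ?thesis by (intro deletions_le[of "w1 @ w2"]) auto
  next
    case 2
    with w w1 w2 L obtain r where "r \<in> L" "subseq r (w1 @ w2)" "length (w1 @ w2) \<le> length r + 1"
      unfolding pair_reducible_def by (metis append_assoc)
    then show ?thesis using ss w w1 w2 2
      by (intro deletions_le[OF _ subseq_order.order_trans[of r "w1 @ w2"]]) auto
  next
    case 3
    with w w1 w2 L have "w1 @ w2 \<in> L" unfolding pair_reducible_def by (metis append_assoc)
    with ss w w1 w2 3 show ?thesis by (intro deletions_le[of "w1 @ w2"]) auto
  qed
qed

inductive balanced :: "'a paren list \<Rightarrow> bool" where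
  empty: "balanced []"
| append: "balanced u \<Longrightarrow> balanced v \<Longrightarrow> balanced (u @ v)"
| wrap: "balanced u \<Longrightarrow> balanced ([Open a] @ u @ [Close b])"

lemma deletions_drop_balanced:
  assumes L: "pair_reducible L" and "balanced f"
  shows "deletions L (u @ v) \<le> deletions L (u @ f @ v)"
  using assms(2)
proof (induction arbitrary: u v)
  case empty
  then show ?case by simp
next
  case (append p q)
  from append.IH(1)[of u v] append.IH(2)[of "u @ p" v] show ?case by simp
next
  case (wrap f a b)
  \<comment> \<open>Once the content is gone, the outer parentheses are adjacent.\<close>
  have "deletions L (u @ v) \<le> deletions L ((u @ [Open a]) @ ([Close b] @ v))"
    using deletions_drop_pair[OF L, of u v a b] by simp
  also have "\<dots> \<le> deletions L ((u @ [Open a]) @ f @ ([Close b] @ v))" by (rule wrap.IH)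
  finally show ?case by simp
qed

text \<open>A subsequence of \<open>u @ v\<close> splits into subsequences of \<open>u\<close> and
  \<open>v\<close>, and both halves of a factor are factors.\<close>

lemma deletions_factors_append:
  "deletions (Dyck_factors T) u + deletions (Dyck_factors T) v \<le> deletions (Dyck_factors T) (u @ v)"
proof -
  have "[] \<in> Dyck_factors T" using pair_reducible_Dyck_factors[of T] by (simp add: pair_reducible_def)
  then obtain w where w: "w \<in> Dyck_factors T" "subseq w (u @ v)"
    "length (u @ v) \<le> length w + deletions (Dyck_factors T) (u @ v)" by (rule deletions_witness)
  obtain w1 w2 where s: "w = w1 @ w2" "subseq w1 u" "subseq w2 v"
    using w(2) by (rule subseq_appendE)
  obtain p q where "p @ (w1 @ w2) @ q \<in> Dyck T" using w s by (auto simp: Dyck_factors_def)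
  then have "p @ w1 @ (w2 @ q) \<in> Dyck T" "(p @ w1) @ w2 @ q \<in> Dyck T" by auto
  then have f: "w1 \<in> Dyck_factors T" "w2 \<in> Dyck_factors T" unfolding Dyck_factors_def by blast+
  have l: "length w1 \<le> length u" "length w2 \<le> length v" using s by (auto dest: list_emb_length)
  have "deletions (Dyck_factors T) u \<le> length u - length w1" "deletions (Dyck_factors T) v \<le> length v - length w2"
    using f s deletions_le[of w1 _ u] deletions_le[of w2 _ v] by simp_all
  with w s l show ?thesis by simp
qed

text \<open>Removing or adding a letter changes the deletion distance by at most 1, and a
  substitution does both.\<close>

lemma deletions_Dyck_le_edits:
  assumes "(edit_step ^^ k) x y" "y \<in> Dyck T"
  shows "deletions (Dyck T) x \<le> 2 * k"
  using assms(1)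
proof (induction k arbitrary: x)
  case 0
  then show ?case using deletions_le[of y "Dyck T" x 0] assms(2) by simp
next
  case (Suc k)
  then obtain x' where x': "edit_step x x'" "(edit_step ^^ k) x' y"
    by (metis relpowp_Suc_D2)
  from x'(1) have "deletions (Dyck T) x \<le> deletions (Dyck T) x' + 2"
  proof cases
    case (insertion u v a)
    with deletions_drop_letter[OF pair_reducible_Dyck, of T u v a] show ?thesis by simp
  next
    case (deletion u a v)
    with deletions_insert_letter[OF Dyck.empty, of T u a v] show ?thesis by simp
  next
    case (substitution u a v b)
    with deletions_insert_letter[OF Dyck.empty, of T u a v]
      deletions_drop_letter[OF pair_reducible_Dyck, of T u v b] show ?thesis by simp
  qed
  with Suc.IH[OF x'(2)] show ?case by simp
qed

text \<open>A nonempty subsequence begins with a close or ends with an open parenthesis, which no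
  Dyck word does. So every unmatched parenthesis must be deleted.\<close>

lemma deletions_closes_opens:
  assumes "set cl \<subseteq> range Close" "set op \<subseteq> range Open"
  shows "length (cl @ op) \<le> deletions (Dyck T) (cl @ op)"
proof -
  obtain w where w: "w \<in> Dyck T" "subseq w (cl @ op)"
    "length (cl @ op) \<le> length w + deletions (Dyck T) (cl @ op)"
    by (rule deletions_witness[OF Dyck.empty])
  obtain w1 w2 where s: "w = w1 @ w2" "subseq w1 cl" "subseq w2 op"
    using w(2) by (rule subseq_appendE)
  have "set w1 \<subseteq> range Close" "set w2 \<subseteq> range Open"
    using assms subseq_set[OF s(2)] subseq_set[OF s(3)] by simp_all
  then have "w1 \<noteq> [] \<Longrightarrow> \<not> is_open (hd w)" "w1 = [] \<Longrightarrow> w2 \<noteq> [] \<Longrightarrow> is_open (last w)"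
    unfolding s(1) by (cases w1; cases w2 rule: rev_cases; auto)+
  then have "w = []" using Dyck_ends[OF w(1)] s(1) by (cases "w1 = []"; cases "w2 = []") simp_all
  with w show ?thesis by simp
qed

section \<open>Edit sequences and the edit distance to the Dyck language\<close>

lemma edit_step_context: "(edit_step ^^ k) x y \<Longrightarrow> (edit_step ^^ k) (u @ x @ v) (u @ y @ v)"
proof (induction k arbitrary: x)
  case (Suc k)
  then obtain x' where x': "edit_step x x'" "(edit_step ^^ k) x' y"
    by (metis relpowp_Suc_D2)
  from x'(1) have "edit_step (u @ x @ v) (u @ x' @ v)"
  proof cases
    case (insertion p q a)
    with edit_step.insertion[of "u @ p" "q @ v" a] show ?thesis by simp
  next
    case (deletion p a q)
    with edit_step.deletion[of "u @ p" a "q @ v"] show ?thesis by simp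
  next
    case (substitution p a q b)
    with edit_step.substitution[of "u @ p" a "q @ v" b] show ?thesis by simp
  qed
  with Suc.IH[OF x'(2)] show ?case by (metis relpowp_Suc_I2)
qed simp

text \<open>Both directions are needed: an edit sequence between two strings descends to a common
  subsequence and ascends again.\<close>

lemma edit_steps_subseq:
  "subseq c x \<Longrightarrow> (edit_step ^^ (length x - length c)) x c \<and> (edit_step ^^ (length x - length c)) c x"
proof (induction rule: list_emb.induct)
  case (list_emb_Nil ys)
  show ?case
  proof (induction ys)
    case (Cons y ys)
    have "edit_step (y # ys) ys" "edit_step ys (y # ys)"
      using edit_step.deletion[of "[]" y ys] edit_step.insertion[of "[]" ys y] by auto
    with Cons show ?case by (metis length_Cons minus_nat.diff_0 list.size(3) relpowp_Suc_I relpowp_Suc_I2)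
  qed simp
next
  case (list_emb_Cons xs ys y)
  have "edit_step (y # ys) ys" "edit_step ys (y # ys)"
    using edit_step.deletion[of "[]" y ys] edit_step.insertion[of "[]" ys y] by auto
  moreover have "length (y # ys) - length xs = Suc (length ys - length xs)"
    using list_emb_Cons by (auto dest: list_emb_length simp: Suc_diff_le)
  ultimately show ?case using list_emb_Cons by (metis relpowp_Suc_I relpowp_Suc_I2)
next
  case (list_emb_Cons2 x y xs ys)
  then show ?case
    using edit_step_context[of _ ys xs "[y]" "[]"] edit_step_context[of _ xs ys "[y]" "[]"] by simp
qed

lemma edit_distance_le: "(edit_step ^^ k) x y \<Longrightarrow> edit_distance x y \<le> k"
  unfolding edit_distance_def by (rule Least_le)

lemma edit_distance_steps: "(edit_step ^^ edit_distance x y) x y"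
proof -
  have "(edit_step ^^ (length x + length y)) x y"
    using edit_steps_subseq[of "[]" x] edit_steps_subseq[of "[]" y]
    by (auto simp: relpowp_add)
  then show ?thesis unfolding edit_distance_def by (rule LeastI)
qed

lemma dyck_distance_le_deletions: "dyck_distance T \<sigma> \<le> deletions (Dyck T) \<sigma>"
proof -
  obtain w where w: "w \<in> Dyck T" "subseq w \<sigma>" "length \<sigma> \<le> length w + deletions (Dyck T) \<sigma>"
    by (rule deletions_witness[OF Dyck.empty])
  have "dyck_distance T \<sigma> \<le> edit_distance \<sigma> w"
    unfolding dyck_distance_def using w(1) by (intro cINF_lower) auto
  also have "\<dots> \<le> length \<sigma> - length w" using edit_steps_subseq[OF w(2)] by (intro edit_distance_le) blast
  finally show ?thesis using w by simp
qed

lemma deletions_le_dyck_distance: "deletions (Dyck T) \<sigma> \<le> 2 * dyck_distance T \<sigma>"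
proof -
  have "dyck_distance T \<sigma> \<in> edit_distance \<sigma> ` Dyck T"
    unfolding dyck_distance_def by (intro Inf_nat_def1) (use Dyck.empty in blast)
  then obtain \<tau> where "\<tau> \<in> Dyck T" "dyck_distance T \<sigma> = edit_distance \<sigma> \<tau>" by blast
  with deletions_Dyck_le_edits[OF edit_distance_steps] show ?thesis by metis
qed

section \<open>The indel distance of two strings\<close>

text \<open>The minimum belongs to a longest common subsequence \<open>c\<close> and equals
  \<open>length x + length y - 2 * length c\<close>, the number of letters that are not
  aligned.\<close>

definition indel :: "'a list \<Rightarrow> 'a list \<Rightarrow> nat" where
  "indel x y = (LEAST k. \<exists>c. subseq c x \<and> subseq c y \<and> length x + length y \<le> 2 * length c + k)"

lemma indel_le: "subseq c x \<Longrightarrow> subseq c y \<Longrightarrow> length x + length y \<le> 2 * length c + k \<Longrightarrow> indel x y \<le> k"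
  unfolding indel_def by (intro Least_le) blast

lemma indel_witness:
  obtains c where "subseq c x" "subseq c y" "length x + length y \<le> 2 * length c + indel x y"
proof -
  have "\<exists>k c. subseq c x \<and> subseq c y \<and> length x + length y \<le> 2 * length c + k"
    by (intro exI[of _ "length x + length y"] exI[of _ "[]"]) auto
  from LeastI_ex[OF this] that show ?thesis unfolding indel_def by blast
qed

lemma indel_self [simp]: "indel x x = 0"
  using indel_le[of x x x 0] by simp

lemma indel_single [simp]: "indel [a] [] = 1" for a :: 'a
proof (rule antisym)
  show "indel [a] [] \<le> 1" using indel_le[of "[]" "[a]" "[]" 1] by simp
  obtain c where "subseq c [a]" "subseq c []" "length [a] + length ([]::'a list) \<le> 2 * length c + indel [a] []"
    by (rule indel_witness)
  then show "1 \<le> indel [a] []" by (cases c) simp_all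
qed

lemma edit_distance_le_indel: "edit_distance x y \<le> indel x y"
proof -
  obtain c where c: "subseq c x" "subseq c y" "length x + length y \<le> 2 * length c + indel x y"
    by (rule indel_witness)
  then have "(edit_step ^^ ((length x - length c) + (length y - length c))) x y"
    using edit_steps_subseq[OF c(1)] edit_steps_subseq[OF c(2)]
    unfolding relpowp_add by blast
  then have "edit_distance x y \<le> (length x - length c) + (length y - length c)" by (rule edit_distance_le)
  also have "\<dots> \<le> indel x y" using c(3) list_emb_length[OF c(1)] list_emb_length[OF c(2)] by simp
  finally show ?thesis .
qed

lemma subseq_drop_letter:
  assumes "subseq c (u @ [a] @ v)"
  obtains c' where "subseq c' c" "subseq c' (u @ v)" "length c \<le> length c' + 1"
proof -
  obtain c1 r where c1: "c = c1 @ r" "subseq c1 u" "subseq r ([a] @ v)"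
    using assms by (rule subseq_appendE)
  obtain m c2 where c2: "r = m @ c2" "subseq m [a]" "subseq c2 v"
    using c1(3) by (rule subseq_appendE)
  have "length m \<le> 1" using list_emb_length[OF c2(2)] by simp
  moreover have "subseq (c1 @ c2) (u @ v)" using c1 c2 by (intro list_emb_append_mono)
  moreover have "subseq (c1 @ c2) c" unfolding c1(1) c2(1) by (intro list_emb_append_mono) auto
  ultimately show ?thesis using c1 c2 by (intro that[of "c1 @ c2"]) auto
qed

lemma indel_le_edits: "(edit_step ^^ k) x y \<Longrightarrow> indel x y \<le> 2 * k"
proof (induction k arbitrary: x)
  case (Suc k)
  then obtain x' where x': "edit_step x x'" "(edit_step ^^ k) x' y"
    by (metis relpowp_Suc_D2)
  obtain c where c: "subseq c x'" "subseq c y" "length x' + length y \<le> 2 * length c + indel x' y"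
    by (rule indel_witness)
  from x'(1) have "indel x y \<le> indel x' y + 2"
  proof cases
    case (insertion u v a)
    from subseq_drop_letter[OF c(1)[unfolded insertion]]
    obtain c' where "subseq c' c" "subseq c' (u @ v)" "length c \<le> length c' + 1" .
    then show ?thesis using c insertion
      by (intro indel_le[OF _ subseq_order.order_trans[of c' c]]) auto
  next
    case (deletion u a v)
    have "subseq (u @ v) (u @ [a] @ v)" by (intro list_emb_append_mono) auto
    then show ?thesis using c deletion
      by (intro indel_le[OF subseq_order.order_trans[of c "u @ v"]]) auto
  next
    case (substitution u a v b)
    from subseq_drop_letter[OF c(1)[unfolded substitution]]
    obtain c' where "subseq c' c" "subseq c' (u @ v)" "length c \<le> length c' + 1" .
    moreover have "subseq (u @ v) (u @ [a] @ v)" by (intro list_emb_append_mono) auto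
    ultimately show ?thesis using c substitution
      by (intro indel_le[OF subseq_order.order_trans[of c' "u @ v"] subseq_order.order_trans[of c' c]]) auto
  qed
  with Suc.IH[OF x'(2)] show ?case by simp
qed simp

text \<open>The factor 2 is attained by a single substitution. It is the reason why the program
  doubles the answer of the subroutine.\<close>

lemma indel_le_edit_distance: "indel x y \<le> 2 * edit_distance x y"
  by (rule indel_le_edits[OF edit_distance_steps])

section \<open>Heavy paths\<close>

text \<open>The pairs run from the outermost to the innermost node, so the close parentheses appear
  in reverse. Comparing \<open>map fst p\<close> with \<open>map snd p\<close> is therefore the
  comparison of the open string with the reversed close string.\<close>

definition spine :: "('a \<times> 'a) list \<Rightarrow> 'a paren list" where
  "spine p = map (Open \<circ> fst) p @ rev (map (Close \<circ> snd) p)"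

abbreviation path_cost :: "('a \<times> 'a) list \<Rightarrow> nat" where
  "path_cost p \<equiv> indel (map fst p) (map snd p)"

lemma spine_Nil [simp]: "spine [] = []"
  by (simp add: spine_def)

lemma spine_Cons: "spine ((a, b) # p) = [Open a] @ spine p @ [Close b]"
  by (simp add: spine_def)

text \<open>The last open and the first close parenthesis are adjacent and so have the same type.
  Peeling off such pairs ends only when one side is exhausted.\<close>

lemma opens_closes_factor:
  assumes "map Open l @ rev (map Close r) \<in> Dyck_factors T"
  shows "\<exists>c. subseq c l \<and> subseq c r \<and> length c = min (length l) (length r)"
  using assms
proof (induction "length l" arbitrary: l r)
  case 0
  then show ?case by (intro exI[of _ "[]"]) auto
next
  case (Suc k)
  show ?case
  proof (cases "r = []")
    case True
    then show ?thesis by (intro exI[of _ "[]"]) auto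
  next
    case False
    then obtain r' b where r: "r = r' @ [b]" by (cases r rule: rev_cases) auto
    obtain l' a where l: "l = l' @ [a]" using Suc(2) by (cases l rule: rev_cases) auto
    obtain u v where "(u @ map Open l') @ [Open a, Close b] @ (rev (map Close r') @ v) \<in> Dyck T"
      using Suc(3) by (auto simp: Dyck_factors_def l r)
    from Dyck_adjacent_pair[OF this] have "a = b" "map Open l' @ rev (map Close r') \<in> Dyck_factors T"
      by (auto simp: Dyck_factors_def)
    with Suc l obtain c where "subseq c l'" "subseq c r'" "length c = min (length l') (length r')"
      by auto
    with l r \<open>a = b\<close> show ?thesis by (intro exI[of _ "c @ [a]"]) auto
  qed
qed

lemma subseq_map_elim:
  assumes "subseq w (map f l)"
  obtains l' where "w = map f l'" "subseq l' l"
proof -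
  have "\<exists>l'. w = map f l' \<and> subseq l' l"
    using assms
  proof (induction w "map f l" arbitrary: l rule: list_emb.induct)
    case (list_emb_Nil)
    then show ?case by (intro exI[of _ "[]"]) auto
  next
    case (list_emb_Cons xs ys y)
    then obtain a l0 where l: "l = a # l0" "ys = map f l0" by (cases l) auto
    with list_emb_Cons obtain l' where "xs = map f l'" "subseq l' l0" by blast
    with l show ?case by auto
  next
    case (list_emb_Cons2 x y xs ys)
    then obtain a l0 where l: "l = a # l0" "ys = map f l0" "y = f a" by (cases l) auto
    with list_emb_Cons2 obtain l' where "xs = map f l'" "subseq l' l0" by blast
    with l list_emb_Cons2 show ?case by (intro exI[of _ "a # l'"]) auto
  qed
  with that show ?thesis by blast
qed

lemma subseq_rev: "subseq x y \<Longrightarrow> subseq (rev x) (rev y)"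
  by (induction rule: list_emb.induct) (auto intro: list_emb_append_mono)

text \<open>If \<open>i\<close> open and \<open>j\<close> close parentheses are deleted, the
  remaining sides share a subsequence of length \<open>length p - max i j\<close>, and
  \<open>2 * max i j \<le> 2 * (i + j)\<close>.\<close>

lemma path_cost_le_deletions: "path_cost p \<le> 2 * deletions (Dyck_factors T) (spine p)"
proof -
  let ?k = "deletions (Dyck_factors T) (spine p)"
  have "[] \<in> Dyck_factors T" using pair_reducible_Dyck_factors[of T] by (simp add: pair_reducible_def)
  then obtain w where w: "w \<in> Dyck_factors T" "subseq w (spine p)"
    "length (spine p) \<le> length w + ?k" by (rule deletions_witness)
  have "spine p = map Open (map fst p) @ map Close (rev (map snd p))"
    by (simp add: spine_def rev_map)
  with w(2) obtain w1 w2 where s: "w = w1 @ w2" "subseq w1 (map Open (map fst p))"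
    "subseq w2 (map Close (rev (map snd p)))"
    by (metis subseq_appendE)
  obtain l where l: "w1 = map Open l" "subseq l (map fst p)" using s(2) by (rule subseq_map_elim)
  obtain r where r: "w2 = map Close r" "subseq r (rev (map snd p))" using s(3) by (rule subseq_map_elim)
  have r': "subseq (rev r) (map snd p)" using subseq_rev[OF r(2)] by simp
  have "map Open l @ rev (map Close (rev r)) \<in> Dyck_factors T" using w(1) s(1) l(1) r(1) by (simp add: rev_map)
  from opens_closes_factor[OF this] obtain c where
    c: "subseq c l" "subseq c (rev r)" "length c = min (length l) (length r)" by auto
  have len: "length l \<le> length p" "length r \<le> length p"
    using list_emb_length[OF l(2)] list_emb_length[OF r(2)] by simp_all
  show ?thesis
  proof (rule indel_le)
    show "subseq c (map fst p)" "subseq c (map snd p)"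
      using c l(2) r' subseq_order.order_trans by blast+
    have "2 * length p \<le> length l + length r + ?k" using w(3) s(1) l(1) r(1) by (simp add: spine_def)
    with c len show "length (map fst p) + length (map snd p) \<le> 2 * length c + 2 * ?k" by simp
  qed
qed

text \<open>The aligned letters, opened in order and closed in reverse, form a nest. What is deleted
  is exactly what the indel distance counts.\<close>

lemma subseq_spine_Dyck:
  assumes "set p \<subseteq> T \<times> T"
  obtains w where "subseq w (spine p)" "w \<in> Dyck T" "length (spine p) \<le> length w + path_cost p"
proof -
  obtain c where c: "subseq c (map fst p)" "subseq c (map snd p)"
    "length (map fst p) + length (map snd p) \<le> 2 * length c + path_cost p" by (rule indel_witness)
  define w where "w = map Open c @ rev (map Close c)"
  have "subseq (rev (map Close c)) (rev (map Close (map snd p)))"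
    by (intro subseq_rev subseq_map c)
  then have "subseq w (spine p)"
    using subseq_map[OF c(1), of Open] unfolding w_def spine_def
    by (intro list_emb_append_mono) simp_all
  moreover have "set c \<subseteq> T" using subseq_set[OF c(1)] assms by fastforce
  then have "w \<in> Dyck T" unfolding w_def
  proof (induction c)
    case (Cons a c)
    then show ?case using Dyck.wrap[of a T "map Open c @ rev (map Close c)"] by simp
  qed (simp add: Dyck.empty)
  ultimately show ?thesis using c(3) by (intro that[of w]) (simp_all add: w_def spine_def)
qed

section \<open>Heavy path decomposition of a balanced string and the bound on its cost\<close>

text \<open>
  \<open>summary T f w p g\<close>: the balanced string \<open>f\<close> is decomposed into the path \<open>p\<close> and finished
  paths of total cost \<open>g\<close>, and \<open>w\<close> is the number of blocks of \<open>f\<close>. Of two adjacent strings, the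
  path of the one with fewer blocks is finished, as in a heavy path decomposition.
\<close>

inductive summary :: "'a set \<Rightarrow> 'a paren list \<Rightarrow> nat \<Rightarrow> ('a \<times> 'a) list \<Rightarrow> nat \<Rightarrow> bool" for T where
  empty: "summary T [] 0 [] 0"
| wrap: "summary T f w p g \<Longrightarrow> a \<in> T \<Longrightarrow> b \<in> T \<Longrightarrow>
    summary T ([Open a] @ f @ [Close b]) (if w = 0 \<and> a \<noteq> b then 1 else w) ((a, b) # p) g"
| right: "summary T f w p g \<Longrightarrow> summary T f' w' p' g' \<Longrightarrow> w \<le> w' \<Longrightarrow>
    summary T (f @ f') (w + w') p' (g + g' + path_cost p)"
| left: "summary T f w p g \<Longrightarrow> summary T f' w' p' g' \<Longrightarrow> w' < w \<Longrightarrow>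
    summary T (f @ f') (w + w') p (g + g' + path_cost p')"

lemma summary_balanced: "summary T f w p g \<Longrightarrow> balanced f"
  by (induction rule: summary.induct) (auto intro: balanced.intros balanced.wrap[simplified])

lemma summary_path: "summary T f w p g \<Longrightarrow> set p \<subseteq> T \<times> T"
  by (induction rule: summary.induct) auto

text \<open>Whatever hangs off the path is balanced, so removing it does not increase the deletion
  distance. The context \<open>u\<close>, \<open>v\<close> carries the enclosing parentheses through
  the induction.\<close>

lemma summary_spine:
  assumes L: "pair_reducible L" and "summary T f w p g"
  shows "deletions L (u @ spine p @ v) \<le> deletions L (u @ f @ v)"
  using assms(2)
proof (induction arbitrary: u v)
  case (wrap f w p g a b)
  from wrap.IH[of "u @ [Open a]" "[Close b] @ v"] show ?case by (simp add: spine_Cons)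
next
  case (right f w p g f' w' p' g')
  have "deletions L (u @ f' @ v) \<le> deletions L (u @ f @ f' @ v)"
    by (rule deletions_drop_balanced[OF L summary_balanced[OF right(1)]])
  with right.IH(2)[of u v] show ?case by simp
next
  case (left f w p g f' w' p' g')
  have "deletions L ((u @ f) @ v) \<le> deletions L ((u @ f) @ f' @ v)"
    by (rule deletions_drop_balanced[OF L summary_balanced[OF left(2)]])
  with left.IH(1)[of u v] show ?case by simp
qed simp

lemma summary_path_cost:
  assumes "summary T f w p g"
  shows "path_cost p \<le> 2 * deletions (Dyck_factors T) f"
proof -
  have "deletions (Dyck_factors T) (spine p) \<le> deletions (Dyck_factors T) f"
    using summary_spine[OF pair_reducible_Dyck_factors[of T] assms, of "[]" "[]"] by simp
  with path_cost_le_deletions[of p T] show ?thesis by linarith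
qed

lemma path_cost_matching: "\<forall>x\<in>set p. fst x = snd x \<Longrightarrow> path_cost p = 0"
proof -
  assume "\<forall>x\<in>set p. fst x = snd x"
  then have "map fst p = map snd p" by simp
  then show "path_cost p = 0" by (simp only: indel_self)
qed

text \<open>A part without blocks leaves the logarithm unchanged when it is attached, so it has to
  be free: all its pairs match.\<close>

lemma summary_no_blocks:
  assumes "summary T f 0 p g"
  shows "g = 0 \<and> path_cost p = 0"
proof -
  have "w = 0 \<longrightarrow> g = 0 \<and> (\<forall>x\<in>set p. fst x = snd x)" if "summary T f w p g" for w
    using that by (induction rule: summary.induct) (auto split: if_splits simp: path_cost_matching)
  from this[OF assms] show ?thesis using path_cost_matching[of p] by simp
qed

lemma log_blocks_mono: "w \<le> w' \<Longrightarrow> log 2 (max 1 (real w)) \<le> log 2 (max 1 (real w'))"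
  by (subst log_le_cancel_iff) auto

text \<open>The doubling argument: the lighter part has at most half of all blocks, so attaching it
  raises the logarithm by at least 1, and this pays the at most \<open>2 * K\<close> of its finished
  path. The argument needs \<open>w \<noteq> 0\<close>; otherwise the part is free.\<close>

lemma summary_light_cost:
  assumes s: "summary T f w p g" and "w \<le> w'"
    and g: "real g \<le> 2 * log 2 (max 1 (real w)) * real (deletions (Dyck_factors T) f)"
  shows "real g + real (path_cost p)
    \<le> 2 * log 2 (max 1 (real (w + w'))) * real (deletions (Dyck_factors T) f)"
    (is "_ \<le> 2 * ?l * ?k")
proof (cases "w = 0")
  case True
  then have "g = 0 \<and> path_cost p = 0" using s summary_no_blocks by blast
  then show ?thesis by simp
next
  case False
  have "log 2 (max 1 (real w)) + 1 = log 2 (2 * real w)" using False by (simp add: log_mult)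
  also have "\<dots> \<le> ?l" using False assms(2) by simp
  finally have "2 * (log 2 (max 1 (real w)) + 1) * ?k \<le> 2 * ?l * ?k"
    by (intro mult_right_mono) auto
  moreover have "real (path_cost p) \<le> 2 * ?k" using summary_path_cost[OF s] by linarith
  ultimately show ?thesis using g by (simp add: algebra_simps)
qed

text \<open>The path \<open>p\<close> that may still grow is not part of \<open>g\<close>; a path is
  charged when it turns out to be the lighter one. Superadditivity then adds up the charges of the
  two sides.\<close>

lemma summary_cost:
  assumes "summary T f w p g"
  shows "real g \<le> 2 * log 2 (max 1 (real w)) * real (deletions (Dyck_factors T) f)"
  using assms
proof induction
  case (wrap f w p g a b)
  let ?f = "[Open a] @ f @ [Close b]"
  have "deletions (Dyck_factors T) f \<le> deletions (Dyck_factors T) ?f"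
    using deletions_factors_append[of T "[Open a]" "f @ [Close b]"]
      deletions_factors_append[of T f "[Close b]"] by simp
  then have *: "2 * log 2 (max 1 (real w)) * real (deletions (Dyck_factors T) f)
    \<le> 2 * log 2 (max 1 (real w)) * real (deletions (Dyck_factors T) ?f)"
    by (intro mult_left_mono) auto
  show ?case
  proof (cases "w = 0 \<and> a \<noteq> b")
    \<comment> \<open>The number of blocks rises from 0 to 1 without changing the logarithm, and
      nothing has been paid so far.\<close>
    case True
    then have "summary T f 0 p g" using wrap by simp
    from summary_no_blocks[OF this] show ?thesis by simp
  next
    case False
    then have "(if w = 0 \<and> a \<noteq> b then 1 else w) = w" by auto
    then show ?thesis using wrap.IH * by (simp only:)
  qed
next
  case (right f w p g f' w' p' g')
  let ?K = "\<lambda>f. real (deletions (Dyck_factors T) f)"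
  let ?l = "log 2 (max 1 (real (w + w')))"
  have "real g + real (path_cost p) \<le> 2 * ?l * ?K f"
    by (rule summary_light_cost[OF right(1,3) right.IH(1)])
  moreover have "real g' \<le> 2 * ?l * ?K f'"
    by (rule order_trans[OF right.IH(2)]) (intro mult_right_mono mult_left_mono log_blocks_mono; simp)
  ultimately have "real (g + g' + path_cost p) \<le> 2 * ?l * (?K f + ?K f')" by (simp add: algebra_simps)
  also have "\<dots> \<le> 2 * ?l * ?K (f @ f')"
    using deletions_factors_append[of T f f'] by (intro mult_left_mono) (simp_all flip: of_nat_add)
  finally show ?case .
next
  case (left f w p g f' w' p' g')
  let ?K = "\<lambda>f. real (deletions (Dyck_factors T) f)"
  let ?l = "log 2 (max 1 (real (w + w')))"
  have "real g' + real (path_cost p') \<le> 2 * ?l * ?K f'"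
    using summary_light_cost[OF left(2) less_imp_le[OF left(3)] left.IH(2)] by (simp add: add.commute)
  moreover have "real g \<le> 2 * ?l * ?K f"
    by (rule order_trans[OF left.IH(1)]) (intro mult_right_mono mult_left_mono log_blocks_mono; simp)
  ultimately have "real (g + g' + path_cost p') \<le> 2 * ?l * (?K f + ?K f')" by (simp add: algebra_simps)
  also have "\<dots> \<le> 2 * ?l * ?K (f @ f')"
    using deletions_factors_append[of T f f'] by (intro mult_left_mono) (simp_all flip: of_nat_add)
  finally show ?case .
qed simp

section \<open>From alignments of the paths to a Dyck word\<close>

text \<open>Replacement in every Dyck context, and not mere membership in \<open>Dyck T\<close>,
  since the kept part of an unfinished path need not be balanced by itself. The property passes
  through enclosing parentheses.\<close>

definition Dyck_refines :: "'a set \<Rightarrow> 'a paren list \<Rightarrow> 'a paren list \<Rightarrow> bool" where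
  "Dyck_refines T w f \<longleftrightarrow> (\<forall>u v. u @ w @ v \<in> Dyck T \<longrightarrow> u @ f @ v \<in> Dyck T)"

lemma Dyck_refines_context: "Dyck_refines T w f \<Longrightarrow> Dyck_refines T (u @ w @ v) (u @ f @ v)"
  unfolding Dyck_refines_def by (metis append_assoc)

text \<open>The alignment of a path is known only when the path is complete, so the claim covers
  every kept part \<open>x\<close> of it. Finished paths contribute Dyck words of their own next to
  \<open>x\<close>, at the price \<open>g\<close>; inserting these does not destroy a Dyck
  word.\<close>

lemma summary_lift:
  assumes "summary T f w p g" "subseq x (spine p)"
  shows "\<exists>f'. subseq f' f \<and> length f + length x \<le> length f' + length (spine p) + g \<and> Dyck_refines T x f'"
  using assms
proof (induction arbitrary: x)
  case empty
  then show ?case by (auto simp: Dyck_refines_def)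
next
  case (wrap f w p g a b)
  from wrap.prems obtain x1 x' where x1: "x = x1 @ x'" "subseq x1 [Open a]" "subseq x' (spine p @ [Close b])"
    unfolding spine_Cons by (rule subseq_appendE)
  from x1(3) obtain y x2 where x2: "x' = y @ x2" "subseq y (spine p)" "subseq x2 [Close b]"
    by (rule subseq_appendE)
  from wrap.IH[OF x2(2)] obtain f' where f': "subseq f' f"
    "length f + length y \<le> length f' + length (spine p) + g" "Dyck_refines T y f'" by blast
  have "subseq (x1 @ f' @ x2) ([Open a] @ f @ [Close b])"
    using x1 x2 f' by (intro list_emb_append_mono)
  with f' x1 x2 Dyck_refines_context[OF f'(3), of x1 x2] show ?case
    by (intro exI[of _ "x1 @ f' @ x2"]) (simp add: spine_Cons)
next
  case (right f w p g f' w' p' g')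
  \<comment> \<open>The path of \<open>f\<close> ends here, so its best alignment can be
    fixed.\<close>
  obtain y where y: "subseq y (spine p)" "y \<in> Dyck T" "length (spine p) \<le> length y + path_cost p"
    using summary_path[OF right(1)] by (rule subseq_spine_Dyck)
  obtain h where h: "subseq h f" "length f + length y \<le> length h + length (spine p) + g" "Dyck_refines T y h"
    using right.IH(1)[OF y(1)] by blast
  obtain h' where h': "subseq h' f'" "length f' + length x \<le> length h' + length (spine p') + g'"
    "Dyck_refines T x h'" using right.IH(2)[OF right.prems] by blast
  \<comment> \<open>The empty context turns replacement of the Dyck word \<open>y\<close> by
    \<open>h\<close> into membership of \<open>h\<close>.\<close>
  have "h \<in> Dyck T" using h(3)[unfolded Dyck_refines_def, rule_format, of "[]" "[]"] y by simp
  then have "Dyck_refines T x (h @ h')"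
    using h'(3) unfolding Dyck_refines_def by (metis Dyck_insert append_assoc)
  moreover have "subseq (h @ h') (f @ f')" using h h' by (intro list_emb_append_mono)
  ultimately show ?case using h h' y by (intro exI[of _ "h @ h'"]) simp
next
  case (left f w p g f' w' p' g')
  obtain y where y: "subseq y (spine p')" "y \<in> Dyck T" "length (spine p') \<le> length y + path_cost p'"
    using summary_path[OF left(2)] by (rule subseq_spine_Dyck)
  obtain h' where h': "subseq h' f'" "length f' + length y \<le> length h' + length (spine p') + g'"
    "Dyck_refines T y h'" using left.IH(2)[OF y(1)] by blast
  obtain h where h: "subseq h f" "length f + length x \<le> length h + length (spine p) + g"
    "Dyck_refines T x h" using left.IH(1)[OF left.prems] by blast
  have "h' \<in> Dyck T" using h'(3)[unfolded Dyck_refines_def, rule_format, of "[]" "[]"] y by simp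
  then have "Dyck_refines T x (h @ h')"
    using h(3) unfolding Dyck_refines_def by (metis Dyck_insert append_assoc)
  moreover have "subseq (h @ h') (f @ f')" using h h' by (intro list_emb_append_mono)
  ultimately show ?case using h h' y by (intro exI[of _ "h @ h'"]) simp
qed

lemma summary_Dyck:
  assumes "summary T f w p g"
  obtains f' where "subseq f' f" "f' \<in> Dyck T" "length f \<le> length f' + g + path_cost p"
proof -
  obtain y where y: "subseq y (spine p)" "y \<in> Dyck T" "length (spine p) \<le> length y + path_cost p"
    using summary_path[OF assms] by (rule subseq_spine_Dyck)
  obtain h where h: "subseq h f" "length f + length y \<le> length h + length (spine p) + g" "Dyck_refines T y h"
    using summary_lift[OF assms y(1)] by blast
  have "h \<in> Dyck T" using h(3)[unfolded Dyck_refines_def, rule_format, of "[]" "[]"] y by simp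
  with h y show ?thesis by (intro that[of h]) simp_all
qed

section \<open>Counting blocks along the decomposition\<close>

text \<open>\<open>count_blocks\<close> counts the places where an open is followed by a close
  parenthesis, and the assumption excludes such a place at the seam.\<close>

lemma count_blocks_append:
  "v = [] \<or> is_open (hd v) \<or> u = [] \<or> \<not> is_open (last u) \<Longrightarrow>
   count_blocks (u @ v) = count_blocks u + count_blocks v"
proof (induction u)
  case (Cons x u)
  show ?case
  proof (cases u)
    case Nil
    with Cons.prems show ?thesis by (cases x; cases v; cases "hd v") auto
  next
    case (Cons y u')
    with Cons.IH Cons.prems show ?thesis by (cases x; cases y) auto
  qed
qed simp

text \<open>Both claims are proved together. What remains of a balanced string never consumes the
  stack below it; after a nonempty remainder the top of the stack is a close parenthesis, so an
  enclosing close parenthesis is pushed and cannot reach further down either.\<close>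

lemma cancel_balanced:
  assumes "balanced f"
  shows "cancel st f = rev st @ cancel [] f"
    and "cancel [] f = [] \<or> is_open (hd (cancel [] f)) \<and> \<not> is_open (last (cancel [] f))"
proof -
  have "(\<forall>st. cancel st f = rev st @ cancel [] f) \<and>
    (cancel [] f = [] \<or> is_open (hd (cancel [] f)) \<and> \<not> is_open (last (cancel [] f)))"
    using assms
  proof induction
    case (append u v)
    have *: "cancel st (u @ v) = rev st @ cancel [] u @ cancel [] v" for st
    proof -
      have "cancel st (u @ v) = cancel (rev (cancel st u)) v" by (rule cancel_append)
      also have "\<dots> = cancel st u @ cancel [] v"
        using append.IH(2) rev_rev_ident[of "cancel st u"] by metis
      also have "cancel st u = rev st @ cancel [] u" using append.IH(1) by blast
      finally show ?thesis by simp
    qed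
    show ?case unfolding *
      using conjunct2[OF append.IH(1)] conjunct2[OF append.IH(2)]
      by (cases "cancel [] u = []"; cases "cancel [] v = []") simp_all
  next
    case (wrap f a b)
    define r where "r = cancel [] f"
    have *: "cancel st ([Open a] @ f @ [Close b]) = cancel (rev r @ Open a # st) [Close b]" for st
    proof -
      have "cancel st ([Open a] @ f @ [Close b]) = cancel (rev (cancel (Open a # st) f)) [Close b]"
        by (simp add: cancel_append[of "Open a # st" f])
      also have "cancel (Open a # st) f = rev (Open a # st) @ r" using wrap.IH r_def by blast
      finally show ?thesis by simp
    qed
    show ?case
    proof (cases "r = []")
      case True
      then show ?thesis unfolding * by auto
    next
      case False
      with conjunct2[OF wrap.IH] have "\<not> is_open (last r)" unfolding r_def by blast
      with False obtain c r' where "rev r = Close c # r'"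
        by (cases "last r"; cases r rule: rev_cases) auto
      then show ?thesis unfolding * by (auto simp: hd_append)
    qed
  qed simp
  then show "cancel st f = rev st @ cancel [] f"
    "cancel [] f = [] \<or> is_open (hd (cancel [] f)) \<and> \<not> is_open (last (cancel [] f))" by blast+
qed

lemma cancel_append_balanced: "balanced f \<Longrightarrow> cancel [] (\<sigma> @ f) = cancel [] \<sigma> @ cancel [] f"
  using cancel_balanced(1)[of f "rev (cancel [] \<sigma>)"] unfolding cancel_append[of _ \<sigma>] rev_rev_ident .

text \<open>A pair around a string that cancels completely is a new block iff its types differ.
  Around a nonempty remainder, which begins with an open and ends with a close parenthesis, it only
  lengthens the outer runs. Between siblings a close meets an open parenthesis, so the counts add
  up.\<close>

lemma summary_blocks:
  assumes "summary T f w p g"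
  shows "count_blocks (cancel [] f) = w \<and> (w = 0 \<longrightarrow> cancel [] f = [])"
  using assms
proof induction
  case (wrap f w p g a b)
  define r where "r = cancel [] f"
  note b = cancel_balanced[OF summary_balanced[OF wrap(1)]]
  have *: "cancel [] ([Open a] @ f @ [Close b]) = cancel (rev r @ [Open a]) [Close b]"
  proof -
    have "cancel [] ([Open a] @ f @ [Close b]) = cancel (rev (cancel [Open a] f)) [Close b]"
      by (simp add: cancel_append[of "[Open a]" f])
    also have "cancel [Open a] f = rev [Open a] @ r" using b(1) r_def by blast
    finally show ?thesis by simp
  qed
  show ?case
  proof (cases "r = []")
    case True
    then show ?thesis using wrap.IH unfolding * by (auto simp: r_def)
  next
    case False
    then have r: "is_open (hd r)" "\<not> is_open (last r)" using b(2) by (auto simp: r_def)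
    with False obtain c r' where "rev r = Close c # r'"
      by (cases "last r"; cases r rule: rev_cases) auto
    then have "cancel (rev r @ [Open a]) [Close b] = rev (Close b # Close c # r' @ [Open a])" by simp
    also have "\<dots> = [Open a] @ r @ [Close b]" using \<open>rev r = Close c # r'\<close>
      by (metis append.assoc append_Cons append_Nil rev.simps(2) rev_append rev_rev_ident)
    finally have "cancel [] ([Open a] @ f @ [Close b]) = [Open a] @ r @ [Close b]" unfolding * .
    moreover have "count_blocks ([Open a] @ (r @ [Close b])) = count_blocks r"
      using r False by (subst count_blocks_append; simp add: count_blocks_append)
    moreover have "w \<noteq> 0" using False wrap.IH by (auto simp: r_def)
    ultimately show ?thesis using wrap.IH by (simp add: r_def)
  qed
next
  case (right f w p g f' w' p' g')
  then show ?case
    using cancel_balanced(2)[OF summary_balanced[OF right(2)]] cancel_append_balanced[OF summary_balanced[OF right(2)]]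
    by (subst cancel_append_balanced) (auto simp: count_blocks_append intro: summary_balanced)
next
  case (left f w p g f' w' p' g')
  then show ?case
    using cancel_balanced(2)[OF summary_balanced[OF left(2)]] cancel_append_balanced[OF summary_balanced[OF left(2)]]
    by (subst cancel_append_balanced) (auto simp: count_blocks_append intro: summary_balanced)
qed simp

section \<open>Whole strings: unmatched parentheses between balanced strings\<close>

text \<open>\<open>toplevel T \<sigma> \<tau> g z\<close>: \<open>\<tau>\<close> consists of the parentheses of \<open>\<sigma>\<close> that remain unmatched, \<open>g\<close> is the
  cost of all paths, and \<open>z\<close> is the number of blocks.\<close>

inductive toplevel :: "'a set \<Rightarrow> 'a paren list \<Rightarrow> 'a paren list \<Rightarrow> nat \<Rightarrow> nat \<Rightarrow> bool" for T where
  empty: "toplevel T [] [] 0 0"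
| balanced: "toplevel T \<sigma> \<tau> g z \<Longrightarrow> summary T f w p h \<Longrightarrow>
    toplevel T (\<sigma> @ f) \<tau> (g + h + path_cost p) (z + w)"
| close: "toplevel T \<sigma> \<tau> g z \<Longrightarrow> set \<tau> \<subseteq> range Close \<Longrightarrow>
    toplevel T (\<sigma> @ [Close b]) (\<tau> @ [Close b]) g z"
| "open": "toplevel T \<sigma> \<tau> g z \<Longrightarrow> toplevel T (\<sigma> @ [Open a]) (\<tau> @ [Open a]) g z"

lemma toplevel_unmatched:
  assumes "toplevel T \<sigma> \<tau> g z"
  shows "\<exists>cl op. \<tau> = cl @ op \<and> set cl \<subseteq> range Close \<and> set op \<subseteq> range Open"
  using assms
proof induction
  case (close \<sigma> \<tau> g z b)
  then show ?case by (intro exI[of _ "\<tau> @ [Close b]"] exI[of _ "[]"]) auto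
next
  case ("open" \<sigma> \<tau> g z a)
  then obtain cl op where "\<tau> = cl @ op" "set cl \<subseteq> range Close" "set op \<subseteq> range Open" by blast
  then show ?case by (intro exI[of _ cl] exI[of _ "op @ [Open a]"]) auto
qed auto

text \<open>Removing the balanced strings does not increase the deletion distance and leaves close
  parentheses followed by open ones, all of which have to be deleted.\<close>

lemma toplevel_length_le_deletions:
  assumes "toplevel T \<sigma> \<tau> g z"
  shows "length \<tau> \<le> deletions (Dyck T) \<sigma>"
proof -
  \<comment> \<open>The suffix \<open>v\<close> collects the unmatched parentheses already peeled
    off on the right.\<close>
  have "deletions (Dyck T) (\<tau> @ v) \<le> deletions (Dyck T) (\<sigma> @ v)" for v
    using assms
  proof (induction arbitrary: v)
    case (balanced \<sigma> \<tau> g z f w p h)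
    have "deletions (Dyck T) (\<sigma> @ v) \<le> deletions (Dyck T) (\<sigma> @ f @ v)"
      by (rule deletions_drop_balanced[OF pair_reducible_Dyck summary_balanced[OF balanced(2)]])
    with balanced.IH[of v] show ?case by simp
  next
    case (close \<sigma> \<tau> g z b)
    from close.IH[of "Close b # v"] show ?case by simp
  next
    case ("open" \<sigma> \<tau> g z a)
    from open.IH[of "Open a # v"] show ?case by simp
  qed simp
  from this[of "[]"] show ?thesis using toplevel_unmatched[OF assms] deletions_closes_opens[of _ _ T]
    by fastforce
qed

lemma toplevel_deletions_le:
  assumes "toplevel T \<sigma> \<tau> g z"
  shows "deletions (Dyck T) \<sigma> \<le> g + length \<tau>"
proof -
  have "\<exists>\<sigma>'\<in>Dyck T. subseq \<sigma>' \<sigma> \<and> length \<sigma> \<le> length \<sigma>' + (g + length \<tau>)"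
    using assms
  proof induction
    case empty
    then show ?case by (auto intro: Dyck.empty)
  next
    case (balanced \<sigma> \<tau> g z f w p h)
    obtain f' where f': "subseq f' f" "f' \<in> Dyck T" "length f \<le> length f' + h + path_cost p"
      using balanced(2) by (rule summary_Dyck)
    from balanced.IH obtain \<sigma>' where \<sigma>': "\<sigma>' \<in> Dyck T" "subseq \<sigma>' \<sigma>"
      "length \<sigma> \<le> length \<sigma>' + (g + length \<tau>)" by blast
    have "subseq (\<sigma>' @ f') (\<sigma> @ f)" using f' \<sigma>' by (intro list_emb_append_mono)
    with f' \<sigma>' Dyck.append[OF \<sigma>'(1) f'(2)] show ?case by (intro bexI[of _ "\<sigma>' @ f'"]) auto
  next
    case (close \<sigma> \<tau> g z b)
    then show ?case by (auto intro: list_emb_prefix)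
  next
    case ("open" \<sigma> \<tau> g z a)
    then show ?case by (auto intro: list_emb_prefix)
  qed
  then show ?thesis by (auto intro: deletions_le)
qed

text \<open>At top level no path continues, so each balanced string also pays at most
  \<open>2 * K\<close> for its last path; this is the summand 1 next to the logarithm.\<close>

lemma toplevel_cost:
  assumes "toplevel T \<sigma> \<tau> g z"
  shows "real g \<le> 2 * (1 + log 2 (max 1 (real z))) * real (deletions (Dyck_factors T) \<sigma>)"
  using assms
proof induction
  case (balanced \<sigma> \<tau> g z f w p h)
  let ?K = "\<lambda>f. real (deletions (Dyck_factors T) f)"
  let ?l = "1 + log 2 (max 1 (real (z + w)))"
  have l: "0 \<le> ?l" by (intro add_nonneg_nonneg) auto
  have "real g \<le> 2 * ?l * ?K \<sigma>"
    by (rule order_trans[OF balanced.IH])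
      (intro mult_right_mono mult_left_mono add_left_mono log_blocks_mono; simp)
  moreover have "real (path_cost p) \<le> 2 * ?K f" using summary_path_cost[OF balanced(2)] by linarith
  then have "real h + real (path_cost p) \<le> 2 * (1 + log 2 (max 1 (real w))) * ?K f"
    using summary_cost[OF balanced(2)] by (simp add: algebra_simps)
  then have "real h + real (path_cost p) \<le> 2 * ?l * ?K f"
    by (rule order_trans) (intro mult_right_mono mult_left_mono add_left_mono log_blocks_mono; simp)
  ultimately have "real (g + h + path_cost p) \<le> 2 * ?l * (?K \<sigma> + ?K f)" by (simp add: algebra_simps)
  also have "\<dots> \<le> 2 * ?l * ?K (\<sigma> @ f)"
    using deletions_factors_append[of T \<sigma> f] l by (intro mult_left_mono) (simp_all flip: of_nat_add)
  finally show ?case .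
next
  case (close \<sigma> \<tau> g z b)
  have "deletions (Dyck_factors T) \<sigma> \<le> deletions (Dyck_factors T) (\<sigma> @ [Close b])"
    using deletions_factors_append[of T \<sigma> "[Close b]"] by simp
  then have "2 * (1 + log 2 (max 1 (real z))) * real (deletions (Dyck_factors T) \<sigma>)
    \<le> 2 * (1 + log 2 (max 1 (real z))) * real (deletions (Dyck_factors T) (\<sigma> @ [Close b]))"
    by (intro mult_left_mono) (auto intro: add_nonneg_nonneg)
  with close.IH show ?case by linarith
next
  case ("open" \<sigma> \<tau> g z a)
  have "deletions (Dyck_factors T) \<sigma> \<le> deletions (Dyck_factors T) (\<sigma> @ [Open a])"
    using deletions_factors_append[of T \<sigma> "[Open a]"] by simp
  then have "2 * (1 + log 2 (max 1 (real z))) * real (deletions (Dyck_factors T) \<sigma>)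
    \<le> 2 * (1 + log 2 (max 1 (real z))) * real (deletions (Dyck_factors T) (\<sigma> @ [Open a]))"
    by (intro mult_left_mono) (auto intro: add_nonneg_nonneg)
  with open.IH show ?case by linarith
qed simp

text \<open>The second conjunct is needed for an unmatched close parenthesis: it meets no open one
  in the remainder, so it neither cancels nor completes a block.\<close>

lemma toplevel_blocks:
  assumes "toplevel T \<sigma> \<tau> g z"
  shows "count_blocks (cancel [] \<sigma>) = z \<and>
    (set \<tau> \<subseteq> range Close \<longrightarrow> cancel [] \<sigma> = [] \<or> \<not> is_open (last (cancel [] \<sigma>)))"
  using assms
proof induction
  case (balanced \<sigma> \<tau> g z f w p h)
  note b = summary_balanced[OF balanced(2)]
  show ?case using balanced.IH cancel_balanced(2)[OF b] summary_blocks[OF balanced(2)]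
    by (cases "cancel [] f = []") (auto simp: cancel_append_balanced[OF b] count_blocks_append)
next
  case (close \<sigma> \<tau> g z b)
  define r where "r = cancel [] \<sigma>"
  have r: "r = [] \<or> \<not> is_open (last r)" using close by (auto simp: r_def)
  have "cancel (rev r) [Close b] = r @ [Close b]"
    using r by (cases r rule: rev_cases; cases "last r") auto
  then have "cancel [] (\<sigma> @ [Close b]) = r @ [Close b]" by (simp add: cancel_append[of _ \<sigma>] r_def)
  with r close.IH show ?case by (auto simp: r_def count_blocks_append)
next
  case ("open" \<sigma> \<tau> g z a)
  then show ?case by (auto simp: cancel_append[of _ \<sigma>] count_blocks_append)
qed simp

text \<open>Leading close and trailing open parentheses take part in no change from open to
  close.\<close>

lemma count_blocks_trim: "count_blocks (trim \<sigma>) = count_blocks (cancel [] \<sigma>)"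
proof -
  define r where "r = cancel [] \<sigma>"
  define r' where "r' = dropWhile (Not \<circ> is_open) r"
  have "r = takeWhile (Not \<circ> is_open) r @ r'" by (simp add: r'_def)
  moreover have "set (takeWhile (Not \<circ> is_open) r) \<subseteq> range Close"
    by (auto dest!: set_takeWhileD simp: is_open_iff(2))
  ultimately have 1: "count_blocks r = count_blocks r'" by (metis count_blocks_Close)
  have opens: "count_blocks q = 0 \<and> (q = [] \<or> is_open (hd q))" if "\<forall>x\<in>set q. is_open x" for q :: "'a paren list"
    using that
  proof (induction q)
    case (Cons x q)
    then show ?case by (cases x; cases q; cases "hd q") auto
  qed simp
  have "rev (rev r') = rev (dropWhile is_open (rev r')) @ rev (takeWhile is_open (rev r'))"
    by (simp flip: rev_append)
  moreover have "\<forall>x\<in>set (rev (takeWhile is_open (rev r'))). is_open x" by (auto dest: set_takeWhileD)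
  ultimately have "count_blocks r' = count_blocks (rev (dropWhile is_open (rev r')))"
    using opens count_blocks_append by (metis add.right_neutral rev_rev_ident)
  with 1 show ?thesis by (simp add: trim_def r_def r'_def)
qed

lemma num_blocks_eq:
  assumes "\<sigma> \<in> dyck_strings T"
  shows "num_blocks T \<sigma> = count_blocks (cancel [] \<sigma>)"
proof -
  have "has_blocks T \<sigma> (num_blocks T \<sigma>)"
    unfolding num_blocks_def by (rule theI'[OF ex1_has_blocks[OF assms]])
  then have "num_blocks T \<sigma> = count_blocks (trim \<sigma>)"
    using assms trim_steps trimmed_trim(1) by (metis has_blocks_def length_block_decomposition)
  then show ?thesis by (simp add: count_blocks_trim)
qed

section \<open>The reduction to string edit distance\<close>

lemma indel_append: "indel (x @ x') (y @ y') \<le> indel x y + indel x' y'"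
proof -
  obtain c where c: "subseq c x" "subseq c y" "length x + length y \<le> 2 * length c + indel x y"
    by (rule indel_witness)
  obtain c' where c': "subseq c' x'" "subseq c' y'" "length x' + length y' \<le> 2 * length c' + indel x' y'"
    by (rule indel_witness)
  show ?thesis
  proof (rule indel_le)
    show "subseq (c @ c') (x @ x')" "subseq (c @ c') (y @ y')" using c c' by (auto intro: list_emb_append_mono)
    show "length (x @ x') + length (y @ y') \<le> 2 * length (c @ c') + (indel x y + indel x' y')"
      using c c' by simp
  qed
qed

text \<open>A common subsequence is cut once by \<open>x\<close>, \<open>x'\<close> and once by
  \<open>y\<close>, \<open>y'\<close>. With disjoint alphabets both cuts agree, because the letters
  themselves tell to which part they belong.\<close>

lemma indel_append_disjoint:
  assumes "(set x \<union> set y) \<inter> (set x' \<union> set y') = {}"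
  shows "indel x y + indel x' y' \<le> indel (x @ x') (y @ y')"
proof -
  obtain c where c: "subseq c (x @ x')" "subseq c (y @ y')"
    "length (x @ x') + length (y @ y') \<le> 2 * length c + indel (x @ x') (y @ y')"
    by (rule indel_witness)
  obtain c1 c2 where s: "c = c1 @ c2" "subseq c1 x" "subseq c2 x'" using c(1) by (rule subseq_appendE)
  obtain c3 c4 where s': "c = c3 @ c4" "subseq c3 y" "subseq c4 y'" using c(2) by (rule subseq_appendE)
  have sub: "set c1 \<subseteq> set x" "set c2 \<subseteq> set x'" "set c3 \<subseteq> set y" "set c4 \<subseteq> set y'"
    using s s' by (auto dest: subseq_set)
  define P where "P a \<longleftrightarrow> a \<in> set x \<union> set y" for a
  have P: "\<forall>a\<in>set c1. P a" "\<forall>a\<in>set c3. P a" "\<forall>a\<in>set c2. \<not> P a" "\<forall>a\<in>set c4. \<not> P a"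
    using sub assms by (auto simp: P_def)
  have "filter P c = c1" unfolding s(1) using P by (simp add: filter_empty_conv)
  moreover have "filter P c = c3" unfolding s'(1) using P by (simp add: filter_empty_conv)
  ultimately have eq: "c1 = c3" "c2 = c4" using s(1) s'(1) by simp_all
  have l: "length c1 \<le> length x" "length c1 \<le> length y" "length c2 \<le> length x'" "length c2 \<le> length y'"
    using s s' eq by (auto dest: list_emb_length)
  have "indel x y \<le> length x + length y - 2 * length c1"
    using s(2) s'(2) eq by (intro indel_le[of c1]) auto
  moreover have "indel x' y' \<le> length x' + length y' - 2 * length c2"
    using s(3) s'(3) eq by (intro indel_le[of c2]) auto
  ultimately show ?thesis using c(3) s(1) l by simp
qed

lemma indel_map:
  assumes "inj f"
  shows "indel (map f x) (map f y) = indel x y"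
proof (rule antisym)
  obtain c where c: "subseq c x" "subseq c y" "length x + length y \<le> 2 * length c + indel x y"
    by (rule indel_witness)
  then show "indel (map f x) (map f y) \<le> indel x y"
    by (intro indel_le[of "map f c"]) (auto intro: subseq_map)
next
  obtain c where c: "subseq c (map f x)" "subseq c (map f y)"
    "length (map f x) + length (map f y) \<le> 2 * length c + indel (map f x) (map f y)"
    by (rule indel_witness)
  obtain a where a: "c = map f a" "subseq a x" using c(1) by (rule subseq_map_elim)
  obtain b where b: "c = map f b" "subseq b y" using c(2) by (rule subseq_map_elim)
  have "a = b" using a(1) b(1) assms by (simp add: inj_map_eq_map)
  with a b c(3) show "indel x y \<le> indel (map f x) (map f y)" by (intro indel_le[of a]) auto
qed

section \<open>The stack algorithm on lists\<close>

type_synonym 'a node = "nat \<times> 'a \<times> 'a"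
type_synonym 'a frame = "nat \<times> 'a \<times> nat \<times> 'a node list"
type_synonym 'a group = "'a list \<times> 'a list"

text \<open>
  Every open parenthesis on the stack has a frame: its position, its type, the number of blocks
  in the balanced string that follows it, and the current path in that string, given as a list of
  nodes (position of the open parenthesis, type of the open and of the close parenthesis).
\<close>

definition path_group :: "'a node list \<Rightarrow> 'a group" where
  "path_group p = (map (fst \<circ> snd) p, map (snd \<circ> snd) p)"

text \<open>The returned path is the one to be emitted: the lighter of the two, or \<open>p\<close>
  itself at top level. On a tie the older path goes, in agreement with
  \<open>summary.right\<close>.\<close>

fun attach :: "nat \<Rightarrow> 'a node list \<Rightarrow> 'a frame list \<Rightarrow> 'a frame list \<times> 'a node list" where
  "attach w p [] = ([], p)"
| "attach w p ((i, a, w', p') # fs) =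
     (if w' \<le> w then ((i, a, w' + w, p) # fs, p') else ((i, a, w' + w, p') # fs, p))"

text \<open>An unmatched parenthesis becomes a group of indel distance 1. Even a close one is put
  into the left component, so that no right component is longer than the left one and every nonempty
  group advances the tags, which count left letters only.\<close>

fun scan_step :: "nat \<Rightarrow> 'a frame list \<times> 'a group list \<Rightarrow> 'a paren \<Rightarrow> 'a frame list \<times> 'a group list" where
  "scan_step i (fs, out) (Open a) = ((i, a, 0, []) # fs, out)"
| "scan_step i ([], out) (Close b) = ([], out @ [([b], [])])"
| "scan_step i ((j, a, w, p) # fs, out) (Close b) =
     (let (fs', q) = attach (if w = 0 \<and> a \<noteq> b then 1 else w) ((j, a, b) # p) fs
      in (fs', out @ [path_group q]))"

fun scan :: "'a paren list \<Rightarrow> nat \<Rightarrow> 'a frame list \<times> 'a group list" where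
  "scan \<sigma> 0 = ([], [])"
| "scan \<sigma> (Suc k) = scan_step (Suc k) (scan \<sigma> k) (\<sigma> ! k)"

fun drain :: "'a frame list \<Rightarrow> 'a group list" where
  "drain [] = []"
| "drain ((i, a, w, p) # fs) = [path_group p, ([a], [])] @ drain fs"

definition groups :: "'a paren list \<Rightarrow> 'a group list" where
  "groups \<sigma> = (case scan \<sigma> (length \<sigma>) of (fs, out) \<Rightarrow> out @ drain fs)"

definition cost :: "'a group list \<Rightarrow> nat" where
  "cost gs = (\<Sum>(l, r)\<leftarrow>gs. indel l r)"

lemma cost_simps [simp]: "cost [] = 0" "cost ((l, r) # gs) = indel l r + cost gs"
  "cost (gs @ hs) = cost gs + cost hs"
  by (simp_all add: cost_def)

lemma cost_group: "cost [path_group p] = path_cost (map snd p)"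
  by (simp add: path_group_def)

text \<open>In \<open>parsed T \<sigma> fs g\<close>, the number \<open>g\<close> is the cost of the groups that are already finished.\<close>

inductive parsed :: "'a set \<Rightarrow> 'a paren list \<Rightarrow> 'a frame list \<Rightarrow> nat \<Rightarrow> bool" for T where
  base: "toplevel T \<sigma> \<tau> g z \<Longrightarrow> set \<tau> \<subseteq> range Close \<Longrightarrow> parsed T \<sigma> [] (g + length \<tau>)"
| push: "parsed T \<sigma> fs g \<Longrightarrow> summary T f w (map snd p) h \<Longrightarrow> a \<in> T \<Longrightarrow>
    parsed T (\<sigma> @ [Open a] @ f) ((i, a, w, p) # fs) (g + h)"

text \<open>The two branches of \<open>attach\<close> are \<open>summary.right\<close> and
  \<open>summary.left\<close> applied to the content of the top frame; an empty stack is the rule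
  \<open>toplevel.balanced\<close>.\<close>

lemma parsed_attach:
  assumes "parsed T \<sigma> fs g" "summary T f w (map snd p) h" "attach w p fs = (fs', q)"
  shows "parsed T (\<sigma> @ f) fs' (g + h + path_cost (map snd q))"
  using assms(1)
proof cases
  case (base \<tau> g0 z)
  with toplevel.balanced[OF base(3) assms(2)] assms(3) parsed.base show ?thesis
    by (fastforce simp: ac_simps)
next
  case (push \<sigma>1 fs1 g1 f1 w1 p1 h1 a1 i1)
  show ?thesis
  proof (cases "w1 \<le> w")
    case True
    with assms(3) push have "fs' = (i1, a1, w1 + w, p) # fs1" "q = p1" by auto
    with parsed.push[OF push(4) summary.right[OF push(5) assms(2) True] push(6)] push
    show ?thesis by (simp add: ac_simps)
  next
    case False
    with assms(3) push have "fs' = (i1, a1, w1 + w, p1) # fs1" "q = p" by auto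
    with False parsed.push[OF push(4) summary.left[OF push(5) assms(2)] push(6)] push
    show ?thesis by (simp add: ac_simps)
  qed
qed

lemma parsed_step:
  assumes "parsed T \<sigma> fs (cost out)" "x \<in> Open ` T \<union> Close ` T" "scan_step i (fs, out) x = (fs', out')"
  shows "parsed T (\<sigma> @ [x]) fs' (cost out')"
proof (cases x)
  case (Open a)
  with assms parsed.push[OF assms(1), of "[]" 0 "[]" 0 a] show ?thesis
    by (auto intro: summary.empty)
next
  case x: (Close b)
  show ?thesis
    using assms(1)
  proof cases
    case (base \<tau> g z)
    from toplevel.close[OF base(3,4)] parsed.base base(4)
    have "parsed T (\<sigma> @ [Close b]) [] (g + length (\<tau> @ [Close b]))" by fastforce
    with base assms(3) x show ?thesis by auto
  next
    case (push \<sigma>1 fs1 g f w p h a j)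
    obtain q where q: "attach (if w = 0 \<and> a \<noteq> b then 1 else w) ((j, a, b) # p) fs1 = (fs', q)"
      "out' = out @ [path_group q]"
      using assms(3) push x by (auto split: prod.splits)
    have "b \<in> T" using x assms(2) by auto
    from summary.wrap[OF push(5,6) this]
    have "summary T ([Open a] @ f @ [Close b]) (if w = 0 \<and> a \<noteq> b then 1 else w) (map snd ((j, a, b) # p)) h"
      by simp
    from parsed_attach[OF push(4) this q(1)] push x q(2) show ?thesis by (simp add: cost_group[simplified])
  qed
qed

lemma parsed_scan:
  assumes "\<sigma> \<in> dyck_strings T" "k \<le> length \<sigma>" "scan \<sigma> k = (fs, out)"
  shows "parsed T (take k \<sigma>) fs (cost out)"
  using assms(2,3)
proof (induction k arbitrary: fs out)
  case 0
  then show ?case using parsed.base[OF toplevel.empty] by simp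
next
  case (Suc k)
  obtain fs1 out1 where s: "scan \<sigma> k = (fs1, out1)" by force
  have "\<sigma> ! k \<in> Open ` T \<union> Close ` T" using assms(1) Suc.prems(1) by (auto simp: dyck_strings_def)
  from parsed_step[OF Suc.IH[OF _ s] this, of "Suc k" fs out] Suc.prems s show ?case
    by (simp add: take_Suc_conv_app_nth)
qed

lemma parsed_drain:
  assumes "parsed T \<sigma> fs g"
  shows "\<exists>\<tau> g' z. toplevel T \<sigma> \<tau> g' z \<and> g' + length \<tau> = g + cost (drain fs)"
  using assms
proof induction
  case (base \<sigma> \<tau> g z)
  then show ?case by auto
next
  case (push \<sigma> fs g f w p h a i)
  then obtain \<tau> g' z where "toplevel T \<sigma> \<tau> g' z" and g': "g' + length \<tau> = g + cost (drain fs)" by blast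
  then have "toplevel T ((\<sigma> @ [Open a]) @ f) (\<tau> @ [Open a]) (g' + h + path_cost (map snd p)) (z + w)"
    using push by (intro toplevel.balanced toplevel.open)
  moreover have "g' + h + path_cost (map snd p) + length (\<tau> @ [Open a]) = g + h + cost (drain ((i, a, w, p) # fs))"
    using g' cost_group[of p] by (simp add: path_group_def)
  ultimately show ?case by (metis append_assoc)
qed

text \<open>The constant 10 is \<open>(4 + 1) * 2\<close>: with \<open>m\<close> the maximum in the
  bound, \<open>2 * (1 + log 2 z)\<close> is at most \<open>4 * m\<close> for the paths, the
  unmatched parentheses add at most \<open>1 \<le> m\<close>, and passing from deletions to edits
  doubles.\<close>

theorem groups_cost:
  assumes "\<sigma> \<in> dyck_strings T"
  shows "dyck_distance T \<sigma> \<le> cost (groups \<sigma>)"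
    and "real (cost (groups \<sigma>)) \<le> 10 * max 1 (log 2 (real (num_blocks T \<sigma>))) * real (dyck_distance T \<sigma>)"
proof -
  obtain fs out where s: "scan \<sigma> (length \<sigma>) = (fs, out)" by force
  from parsed_drain[OF parsed_scan[OF assms _ s]] obtain \<tau> g z where
    t: "toplevel T \<sigma> \<tau> g z" and g: "g + length \<tau> = cost (groups \<sigma>)" by (auto simp: groups_def s)
  have "dyck_distance T \<sigma> \<le> deletions (Dyck T) \<sigma>" by (rule dyck_distance_le_deletions)
  with toplevel_deletions_le[OF t] g show "dyck_distance T \<sigma> \<le> cost (groups \<sigma>)" by simp
  let ?m = "max 1 (log 2 (real (num_blocks T \<sigma>)))" and ?D = "real (deletions (Dyck T) \<sigma>)"
  have z: "num_blocks T \<sigma> = z" using num_blocks_eq[OF assms] toplevel_blocks[OF t] by simp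
  have "log 2 (max 1 (real z)) \<le> ?m" unfolding z by (cases "z = 0") (auto simp: max_def)
  then have "2 * (1 + log 2 (max 1 (real z))) \<le> 4 * ?m" by simp
  moreover have "Dyck T \<subseteq> Dyck_factors T"
    unfolding Dyck_factors_def by (auto intro!: exI[of _ "[]"])
  from deletions_antimono[OF this Dyck.empty] have "real (deletions (Dyck_factors T) \<sigma>) \<le> ?D" by simp
  ultimately have "2 * (1 + log 2 (max 1 (real z))) * real (deletions (Dyck_factors T) \<sigma>) \<le> 4 * ?m * ?D"
    by (rule mult_mono) simp_all
  with toplevel_cost[OF t] have "real g \<le> 4 * ?m * ?D" by linarith
  moreover have "real (length \<tau>) \<le> 1 * ?D" using toplevel_length_le_deletions[OF t] by simp
  then have "real (length \<tau>) \<le> ?m * ?D" by (rule order_trans) (intro mult_right_mono; simp)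
  ultimately have "real (cost (groups \<sigma>)) \<le> 5 * ?m * ?D" using g by (simp flip: g)
  also have "\<dots> \<le> 5 * ?m * (2 * real (dyck_distance T \<sigma>))"
  proof (rule mult_left_mono)
    show "?D \<le> 2 * real (dyck_distance T \<sigma>)" using deletions_le_dyck_distance[of T \<sigma>] by linarith
  qed simp
  finally show "real (cost (groups \<sigma>)) \<le> 10 * ?m * real (dyck_distance T \<sigma>)" by simp
qed

section \<open>All groups in one pair of strings\<close>

text \<open>
  The letters of a group are tagged with the total length of the left components of the groups
  before it, so that different nonempty groups use disjoint alphabets.
\<close>

fun encode_left :: "nat \<Rightarrow> nat \<Rightarrow> nat group list \<Rightarrow> nat list" where
  "encode_left n g [] = []"
| "encode_left n g ((l, r) # gs) = map (\<lambda>a. (2 * a + 1) * n + g) l @ encode_left n (g + length l) gs"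

fun encode_right :: "nat \<Rightarrow> nat \<Rightarrow> nat group list \<Rightarrow> nat list" where
  "encode_right n g [] = []"
| "encode_right n g ((l, r) # gs) = map (\<lambda>a. (2 * a + 1) * n + g) r @ encode_right n (g + length l) gs"

lemma encode_left_append:
  "encode_left n g (gs @ hs) = encode_left n g gs @ encode_left n (g + length (encode_left n g gs)) hs"
  by (induction n g gs rule: encode_left.induct) (auto simp: ac_simps)

lemma encode_right_append:
  "encode_right n g (gs @ hs) = encode_right n g gs @ encode_right n (g + length (encode_left n g gs)) hs"
  by (induction n g gs rule: encode_right.induct) (auto simp: ac_simps)

text \<open>A letter is congruent to its tag modulo \<open>n\<close>, because the tag of a nonempty
  group is less than the total length of the left components, which is at most
  \<open>n\<close>.\<close>

lemma encode_letters:
  assumes "\<forall>(l, r)\<in>set gs. length r \<le> length l" "g + length (encode_left n g gs) \<le> n"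
  shows "\<forall>c\<in>set (encode_left n g gs) \<union> set (encode_right n g gs). g \<le> c mod n"
  using assms
proof (induction n g gs rule: encode_left.induct)
  case (2 n g l r gs)
  show ?case
  proof (cases "l = []")
    case True
    with 2 show ?thesis by auto
  next
    case False
    with 2(3) have "g < n" by (cases l) auto
    then have "\<forall>c\<in>set (map (\<lambda>a. (2 * a + 1) * n + g) l) \<union> set (map (\<lambda>a. (2 * a + 1) * n + g) r). c mod n = g"
      by (auto simp: mod_mult_self3 simp del: mult_Suc mult_Suc_right add_mult_distrib distrib_right)
    moreover from 2 have "\<forall>c\<in>set (encode_left n (g + length l) gs) \<union> set (encode_right n (g + length l) gs). g + length l \<le> c mod n"
      by simp
    ultimately have "g \<le> c mod n" if "c \<in> (set (map (\<lambda>a. (2 * a + 1) * n + g) l) \<union> set (map (\<lambda>a. (2 * a + 1) * n + g) r))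
      \<union> (set (encode_left n (g + length l) gs) \<union> set (encode_right n (g + length l) gs))" for c
      using that by (elim UnE[of c "_ \<union> _"]) (blast intro: add_leD1 eq_imp_le[OF sym])+
    then show ?thesis unfolding encode_left.simps encode_right.simps set_append by blast
  qed
qed simp

text \<open>After a nonempty left component all later tags are strictly larger, which separates the
  alphabets; if the left component is empty, so is the right one.\<close>

lemma indel_encode:
  assumes "\<forall>(l, r)\<in>set gs. length r \<le> length l" "g + length (encode_left n g gs) \<le> n"
  shows "indel (encode_left n g gs) (encode_right n g gs) = cost gs"
  using assms
proof (induction n g gs rule: encode_left.induct)
  case (2 n g l r gs)
  show ?case
  proof (cases "l = []")
    case True
    with 2 show ?thesis by simp
  next
    case False
    with 2(3) have "g < n" by (cases l) auto
    let ?f = "\<lambda>a. (2 * a + 1) * n + g"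
    let ?x = "encode_left n (g + length l) gs" and ?y = "encode_right n (g + length l) gs"
    have m: "?f a mod n = g" for a using \<open>g < n\<close> by (metis mod_less mod_mult_self3)
    have "inj ?f" using \<open>g < n\<close> by (auto simp: inj_def)
    then have i: "indel (map ?f l) (map ?f r) = indel l r" by (rule indel_map)
    have IH: "indel ?x ?y = cost gs" using 2 by simp
    have "\<forall>c\<in>set ?x \<union> set ?y. g + length l \<le> c mod n" using 2 by (intro encode_letters) auto
    moreover have "g < g + length l" using False by simp
    moreover have "\<forall>c\<in>set (map ?f l) \<union> set (map ?f r). c mod n = g" using m by (simp add: ball_Un)
    ultimately have "(set (map ?f l) \<union> set (map ?f r)) \<inter> (set ?x \<union> set ?y) = {}"
      by (metis disjoint_iff not_le)
    from indel_append_disjoint[OF this] indel_append[of "map ?f l" ?x "map ?f r" ?y] i IH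
    show ?thesis by simp
  qed
qed simp

fun frame_size :: "'a frame \<Rightarrow> nat" where
  "frame_size (i, a, w, p) = 1 + 2 * length p"

fun group_size :: "'a group \<Rightarrow> nat" where
  "group_size (l, r) = length l + length r"

fun frame_weight :: "'a frame \<Rightarrow> nat" where
  "frame_weight (i, a, w, p) = w"

text \<open>No letter is lost: each one read is in a frame or in a finished group. This gives the
  total length \<open>n\<close> of the output. The bound on the weights, where each close
  parenthesis adds at most one block, keeps the counters of the program small.\<close>

lemma scan_sizes:
  assumes "scan \<sigma> k = (fs, out)"
  shows "(\<Sum>f\<leftarrow>fs. frame_size f) + (\<Sum>x\<leftarrow>out. group_size x) = k"
    and "(\<Sum>f\<leftarrow>fs. frame_weight f) \<le> k"
    and "\<forall>(l, r)\<in>set out. length r \<le> length l"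
proof -
  have "(\<Sum>f\<leftarrow>fs. frame_size f) + (\<Sum>x\<leftarrow>out. group_size x) = k \<and> (\<Sum>f\<leftarrow>fs. frame_weight f) \<le> k \<and>
    (\<forall>(l, r)\<in>set out. length r \<le> length l)"
    using assms
  proof (induction k arbitrary: fs out)
    case (Suc k)
    obtain fs1 out1 where s: "scan \<sigma> k = (fs1, out1)" by force
    show ?case
    proof (cases "\<sigma> ! k")
      case (Open a)
      then show ?thesis using Suc.IH[OF s] Suc.prems s by auto
    next
      case c: (Close b)
      show ?thesis
      proof (cases fs1)
        case Nil
        then show ?thesis using Suc.IH[OF s] Suc.prems s c by auto
      next
        case (Cons f fs2)
        obtain j a w p where f: "f = (j, a, w, p)" by (cases f)
        show ?thesis
        proof (cases fs2)
          case Nil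
          then show ?thesis using Suc.IH[OF s] Suc.prems s c Cons f
            by (auto simp: path_group_def split: if_splits)
        next
          case (Cons f' fs3)
          obtain j' a' w' p' where f': "f' = (j', a', w', p')" by (cases f')
          show ?thesis using Suc.IH[OF s] Suc.prems s c \<open>fs1 = f # fs2\<close> f f' Cons
            by (auto simp: path_group_def split: if_splits)
        qed
      qed
    qed
  qed simp
  then show "(\<Sum>f\<leftarrow>fs. frame_size f) + (\<Sum>x\<leftarrow>out. group_size x) = k" "(\<Sum>f\<leftarrow>fs. frame_weight f) \<le> k"
    "\<forall>(l, r)\<in>set out. length r \<le> length l" by auto
qed

lemma length_encode:
  "length (encode_left n g gs) + length (encode_right n g gs) = (\<Sum>x\<leftarrow>gs. group_size x)"
  by (induction n g gs rule: encode_left.induct) auto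

lemma drain_sizes:
  "(\<Sum>x\<leftarrow>drain fs. group_size x) = (\<Sum>f\<leftarrow>fs. frame_size f)"
  "\<forall>(l, r)\<in>set (drain fs). length r \<le> length l"
  by (induction fs rule: drain.induct) (auto simp: path_group_def)

lemma groups_sizes:
  "(\<Sum>x\<leftarrow>groups \<sigma>. group_size x) = length \<sigma>"
  "\<forall>(l, r)\<in>set (groups \<sigma>). length r \<le> length l"
proof -
  obtain fs out where s: "scan \<sigma> (length \<sigma>) = (fs, out)" by force
  show "(\<Sum>x\<leftarrow>groups \<sigma>. group_size x) = length \<sigma>"
    using scan_sizes(1)[OF s] drain_sizes(1)[of fs] by (simp add: groups_def s)
  show "\<forall>(l, r)\<in>set (groups \<sigma>). length r \<le> length l"
    using scan_sizes(3)[OF s] drain_sizes(2)[of fs] by (auto simp: groups_def s)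
qed

section \<open>Structured programs\<close>

datatype com =
    Prim instr
  | Seq com com (infixr \<open>;;\<close> 60)
  | Unless nat nat com
  | Repeat com nat nat

text \<open>\<open>Unless a b c\<close> skips \<open>c\<close> if register \<open>a\<close> is less than register \<open>b\<close>; \<open>Repeat c a b\<close> repeats \<open>c\<close>
  as long as this holds afterwards. Neither needs an unconditional jump, which the machine lacks.\<close>

fun compile :: "nat \<Rightarrow> com \<Rightarrow> instr list" where
  "compile p (Prim i) = [i]"
| "compile p (c ;; c') = compile p c @ compile (p + length (compile p c)) c'"
| "compile p (Unless a b c) = JumpLess a b (Suc p + length (compile (Suc p) c)) # compile (Suc p) c"
| "compile p (Repeat c a b) = compile p c @ [JumpLess a b p]"

section \<open>Big-step semantics and correctness of the compiler\<close>

type_synonym store = "(nat \<Rightarrow> nat) \<times> (nat \<Rightarrow> nat)"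

text \<open>\<open>None\<close> covers overflow as well as \<open>JumpLess\<close>,
  \<open>Rand\<close> and \<open>Halt\<close>. \<open>Sub\<close>, \<open>Div\<close> and
  \<open>Load\<close> are unchecked because their results are words whenever registers and memory
  hold words.\<close>

fun effect :: "nat \<Rightarrow> instr \<Rightarrow> store \<Rightarrow> store option" where
  "effect W (Const r k) (R, M) = (if k < W then Some (R(r := k), M) else None)"
| "effect W (Add r a b) (R, M) = (if R a + R b < W then Some (R(r := R a + R b), M) else None)"
| "effect W (Sub r a b) (R, M) = Some (R(r := R a - R b), M)"
| "effect W (Mul r a b) (R, M) = (if R a * R b < W then Some (R(r := R a * R b), M) else None)"
| "effect W (Div r a b) (R, M) = Some (R(r := R a div R b), M)"
| "effect W (Load r a) (R, M) = Some (R(r := M (R a)), M)"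
| "effect W (Store a b) (R, M) = Some (R, M(R a := R b))"
| "effect W i s = None"

inductive exec :: "nat \<Rightarrow> com \<Rightarrow> store \<Rightarrow> nat \<Rightarrow> store \<Rightarrow> bool" for W where
  prim: "effect W i s = Some s' \<Longrightarrow> exec W (Prim i) s (Suc 0) s'"
| seq: "exec W c s t s1 \<Longrightarrow> exec W c' s1 t' s' \<Longrightarrow> exec W (c ;; c') s (t + t') s'"
| skip: "fst s a < fst s b \<Longrightarrow> exec W (Unless a b c) s (Suc 0) s"
| unless: "\<not> fst s a < fst s b \<Longrightarrow> exec W c s t s' \<Longrightarrow> exec W (Unless a b c) s (Suc t) s'"
| loop: "exec W c s t s1 \<Longrightarrow> fst s1 a < fst s1 b \<Longrightarrow> exec W (Repeat c a b) s1 t' s' \<Longrightarrow>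
    exec W (Repeat c a b) s (t + Suc t') s'"
| exit: "exec W c s t s' \<Longrightarrow> \<not> fst s' a < fst s' b \<Longrightarrow> exec W (Repeat c a b) s (Suc t) s'"

definition words :: "nat \<Rightarrow> store \<Rightarrow> bool" where
  "words W s \<longleftrightarrow> (\<forall>r. fst s r < W) \<and> (\<forall>a. snd s a < W)"

lemma div_less_word: "a < W \<Longrightarrow> a div b < W" for a :: nat
  by (meson div_le_dividend le_less_trans)

lemma effect_words: "effect W i s = Some s' \<Longrightarrow> words W s \<Longrightarrow> words W s'"
  by (induction W i s rule: effect.induct)
    (auto simp: words_def less_imp_diff_less div_less_word split: if_splits)

lemma step_effect:
  assumes "effect W i (R, M) = Some (R', M')" "words W (R, M)"
  shows "exec_instr W p R M i = return_pmf (Running (Suc p) R' M')"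
  using assms
  by (cases i) (auto simp: set_reg_def words_def less_imp_diff_less div_less_word split: if_splits)

lemma exec_words: "exec W c s t s' \<Longrightarrow> words W s \<Longrightarrow> words W s'"
  by (induction rule: exec.induct) (auto simp: effect_words)

abbreviation running :: "nat \<Rightarrow> store \<Rightarrow> state" where
  "running p s \<equiv> Running p (fst s) (snd s)"

lemma run_step:
  "p < length P \<Longrightarrow> exec_instr W p (fst s) (snd s) (P ! p) = return_pmf S \<Longrightarrow>
   run W P (Suc t) (running p s) = run W P t S"
  by (simp add: bind_return_pmf)

text \<open>Jump targets are absolute, so the code is compiled for its address
  \<open>length pre\<close> and may stand between arbitrary code. The remaining time
  \<open>u\<close> makes the statement composable.\<close>

lemma exec_compile:
  assumes "exec W c s t s'" "words W s"
  shows "run W (pre @ compile (length pre) c @ post) (t + u) (running (length pre) s)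
    = run W (pre @ compile (length pre) c @ post) u (running (length pre + length (compile (length pre) c)) s')"
  using assms
proof (induction arbitrary: pre post u rule: exec.induct)
  case (prim i s s')
  then have "exec_instr W (length pre) (fst s) (snd s) i = return_pmf (running (Suc (length pre)) s')"
    by (metis prod.collapse step_effect)
  then show ?case by (simp add: bind_return_pmf nth_append)
next
  case (seq c s t s1 c' t' s')
  let ?l = "compile (length pre) c"
  have "words W s1" using seq exec_words by blast
  from seq.IH(1)[of pre "compile (length pre + length ?l) c' @ post" "t' + u"]
    seq.IH(2)[of "pre @ ?l" post u] seq.prems this
  show ?case by (simp add: ac_simps)
next
  case (skip s a b c)
  then show ?case by (simp add: bind_return_pmf nth_append)
next
  case (unless s a b c t s')
  let ?j = "JumpLess a b (Suc (length pre + length (compile (Suc (length pre)) c)))"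
  from unless.IH[of "pre @ [?j]" post u] unless show ?case
    by (simp add: bind_return_pmf nth_append)
next
  case (loop c s t s1 a b t' s')
  let ?l = "compile (length pre) c"
  have w: "words W s1" using loop exec_words by blast
  from loop.IH(1)[of pre "[JumpLess a b (length pre)] @ post" "Suc (t' + u)"] loop.prems
  have "run W (pre @ compile (length pre) (Repeat c a b) @ post) (t + Suc t' + u) (running (length pre) s)
    = run W (pre @ compile (length pre) (Repeat c a b) @ post) (Suc (t' + u)) (running (length pre + length ?l) s1)"
    by (simp add: ac_simps)
  also have "\<dots> = run W (pre @ compile (length pre) (Repeat c a b) @ post) (t' + u) (running (length pre) s1)"
    by (rule run_step) (use loop(2) in \<open>simp_all add: nth_append\<close>)
  also have "\<dots> = run W (pre @ compile (length pre) (Repeat c a b) @ post) u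
      (running (length pre + length (compile (length pre) (Repeat c a b))) s')"
    by (rule loop.IH(2)[OF w])
  finally show ?case .
next
  case (exit c s t s' a b)
  let ?l = "compile (length pre) c"
  from exit.IH[of pre "[JumpLess a b (length pre)] @ post" "Suc u"] exit.prems
  have "run W (pre @ compile (length pre) (Repeat c a b) @ post) (Suc t + u) (running (length pre) s)
    = run W (pre @ compile (length pre) (Repeat c a b) @ post) (Suc u) (running (length pre + length ?l) s')"
    by (simp add: ac_simps)
  also have "\<dots> = run W (pre @ compile (length pre) (Repeat c a b) @ post) u
      (running (length pre + length (compile (length pre) (Repeat c a b))) s')"
    by (rule run_step) (use exit(2) in \<open>simp_all add: nth_append\<close>)
  finally show ?case .
qed

text \<open>The last argument of a postcondition is the time, which starts at \<open>t\<close>.\<close>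

definition wp :: "nat \<Rightarrow> com \<Rightarrow> ((nat \<Rightarrow> nat) \<Rightarrow> (nat \<Rightarrow> nat) \<Rightarrow> nat \<Rightarrow> bool) \<Rightarrow>
    (nat \<Rightarrow> nat) \<Rightarrow> (nat \<Rightarrow> nat) \<Rightarrow> nat \<Rightarrow> bool" where
  "wp W c Q R M t \<longleftrightarrow> (\<exists>t' R' M'. exec W c (R, M) t' (R', M') \<and> Q R' M' (t + t'))"

inductive_cases exec_PrimE: "exec W (Prim i) s t s'"
inductive_cases exec_SeqE: "exec W (c ;; c') s t s'"
inductive_cases exec_UnlessE: "exec W (Unless a b c) s t s'"

lemma wp_Prim: "wp W (Prim i) Q R M t \<longleftrightarrow> (\<exists>R' M'. effect W i (R, M) = Some (R', M') \<and> Q R' M' (Suc t))"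
  unfolding wp_def by (auto elim!: exec_PrimE intro!: exI[of _ "Suc 0"]) (blast intro: exec.prim)

lemma wp_simps [simp]:
  "wp W (Prim (Const r k)) Q R M t \<longleftrightarrow> k < W \<and> Q (R(r := k)) M (Suc t)"
  "wp W (Prim (Add r a b)) Q R M t \<longleftrightarrow> R a + R b < W \<and> Q (R(r := R a + R b)) M (Suc t)"
  "wp W (Prim (Sub r a b)) Q R M t \<longleftrightarrow> Q (R(r := R a - R b)) M (Suc t)"
  "wp W (Prim (Mul r a b)) Q R M t \<longleftrightarrow> R a * R b < W \<and> Q (R(r := R a * R b)) M (Suc t)"
  "wp W (Prim (Div r a b)) Q R M t \<longleftrightarrow> Q (R(r := R a div R b)) M (Suc t)"
  "wp W (Prim (Load r a)) Q R M t \<longleftrightarrow> Q (R(r := M (R a))) M (Suc t)"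
  "wp W (Prim (Store a b)) Q R M t \<longleftrightarrow> Q R (M(R a := R b)) (Suc t)"
  by (auto simp: wp_Prim)

lemma wp_Seq [simp]: "wp W (c ;; c') Q R M t \<longleftrightarrow> wp W c (wp W c' Q) R M t"
proof
  assume "wp W (c ;; c') Q R M t"
  then show "wp W c (wp W c' Q) R M t"
    unfolding wp_def by (fastforce elim!: exec_SeqE simp: add.assoc)
next
  assume "wp W c (wp W c' Q) R M t"
  then obtain t1 R1 M1 t2 R2 M2 where "exec W c (R, M) t1 (R1, M1)" "exec W c' (R1, M1) t2 (R2, M2)"
    "Q R2 M2 (t + (t1 + t2))" unfolding wp_def by (auto simp: add.assoc)
  then show "wp W (c ;; c') Q R M t" unfolding wp_def by (blast intro: exec.seq)
qed

lemma wp_Unless [simp]: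
  "wp W (Unless a b c) Q R M t \<longleftrightarrow> (if R a < R b then Q R M (Suc t) else wp W c Q R M (Suc t))"
proof (cases "R a < R b")
  case True
  then have "exec W (Unless a b c) (R, M) (Suc 0) (R, M)" by (simp add: exec.skip)
  then have "Q R M (Suc t) \<Longrightarrow> wp W (Unless a b c) Q R M t"
    unfolding wp_def by (metis add_0_right add_Suc_right)
  moreover have "wp W (Unless a b c) Q R M t \<Longrightarrow> Q R M (Suc t)"
    using True unfolding wp_def by (auto elim!: exec_UnlessE)
  ultimately show ?thesis using True by auto
next
  case False
  show ?thesis
  proof
    assume "wp W (Unless a b c) Q R M t"
    with False show "if R a < R b then Q R M (Suc t) else wp W c Q R M (Suc t)"
      unfolding wp_def by (fastforce elim!: exec_UnlessE)
  next
    assume "if R a < R b then Q R M (Suc t) else wp W c Q R M (Suc t)"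
    with False obtain t' R' M' where "exec W c (R, M) t' (R', M')" "Q R' M' (t + Suc t')"
      unfolding wp_def by auto
    with False exec.unless[of "(R, M)" a b W c t' "(R', M')"] show "wp W (Unless a b c) Q R M t"
      unfolding wp_def by (metis fst_conv)
  qed
qed

lemma wp_Repeat:
  assumes "wp W c (\<lambda>R M t. if R a < R b then wp W (Repeat c a b) Q R M (Suc t) else Q R M (Suc t)) R M t"
  shows "wp W (Repeat c a b) Q R M t"
proof -
  obtain t1 R1 M1 where 1: "exec W c (R, M) t1 (R1, M1)"
    "if R1 a < R1 b then wp W (Repeat c a b) Q R1 M1 (Suc (t + t1)) else Q R1 M1 (Suc (t + t1))"
    using assms unfolding wp_def[of W c] by blast
  show ?thesis
  proof (cases "R1 a < R1 b")
    case True
    with 1 obtain t2 R2 M2 where 2: "exec W (Repeat c a b) (R1, M1) t2 (R2, M2)" "Q R2 M2 (Suc (t + t1) + t2)"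
      unfolding wp_def by auto
    from exec.loop[OF 1(1) _ 2(1)] True have "exec W (Repeat c a b) (R, M) (t1 + Suc t2) (R2, M2)" by simp
    with 2(2) show ?thesis unfolding wp_def by (metis add.assoc add_Suc add_Suc_right)
  next
    case False
    with exec.exit[OF 1(1), of a b] 1(2) show ?thesis unfolding wp_def by (metis add_Suc_right fst_conv)
  qed
qed

lemma wp_mono:
  assumes "wp W c Q R M t" "\<And>R M t. Q R M t \<Longrightarrow> Q' R M t"
  shows "wp W c Q' R M t"
  using assms unfolding wp_def by blast

text \<open>A counted loop whose index \<open>k\<close> is a ghost variable. The body runs before
  the first test, hence \<open>k < N\<close> at entry.\<close>

lemma wp_Repeat_upto:
  assumes step: "\<And>k R M t. k < N \<Longrightarrow> I k R M t \<Longrightarrow>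
      wp W c (\<lambda>R M t. I (Suc k) R M (Suc t) \<and> (R a < R b \<longleftrightarrow> Suc k < N)) R M t"
    and "k < N" "I k R M t"
  shows "wp W (Repeat c a b) (I N) R M t"
  using assms(2,3)
proof (induction "N - k" arbitrary: k R M t)
  case (Suc d)
  show ?case
  proof (rule wp_Repeat, rule wp_mono[OF step[OF Suc(3,4)]])
    fix R M t assume *: "I (Suc k) R M (Suc t) \<and> (R a < R b \<longleftrightarrow> Suc k < N)"
    show "if R a < R b then wp W (Repeat c a b) (I N) R M (Suc t) else I N R M (Suc t)"
    proof (cases "Suc k < N")
      case True
      with * Suc(1)[of "Suc k"] Suc(2) show ?thesis by auto
    next
      case False
      with Suc(3) have "Suc k = N" by simp
      with * show ?thesis by auto
    qed
  qed
qed simp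

section \<open>Embedding the given algorithm\<close>

text \<open>Only \<open>Halt\<close> calls for a second instruction, but a uniform size keeps the
  map of addresses affine, from \<open>l\<close> to \<open>k + 2 * l\<close>.\<close>

fun relocate_instr :: "nat \<Rightarrow> instr \<Rightarrow> instr list" where
  "relocate_instr k (JumpLess a b l) = [JumpLess a b (k + 2 * l), JumpLess 0 0 0]"
| "relocate_instr k Halt = [Add 0 0 0, Halt]"
| "relocate_instr k i = [i, JumpLess 0 0 0]"

text \<open>The program shifted to address \<open>k\<close> and modified to double its output. Every instruction
  gets two slots; \<open>JumpLess 0 0 0\<close> does nothing.\<close>

definition relocate :: "nat \<Rightarrow> instr list \<Rightarrow> instr list" where
  "relocate k P = concat (map (relocate_instr k) P)"

lemma length_relocate_instr [simp]: "length (relocate_instr k i) = 2"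
  by (cases i) auto

lemma relocate_nth:
  assumes "p < length P"
  shows "relocate k P ! (2 * p) = relocate_instr k (P ! p) ! 0"
    "relocate k P ! Suc (2 * p) = relocate_instr k (P ! p) ! 1"
    "Suc (2 * p) < length (relocate k P)"
proof -
  have "relocate k P ! (2 * p) = relocate_instr k (P ! p) ! 0 \<and>
    relocate k P ! Suc (2 * p) = relocate_instr k (P ! p) ! 1"
    using assms
  proof (induction P arbitrary: p)
    case (Cons i P)
    then show ?case by (cases p) (auto simp: relocate_def nth_append)
  qed simp
  then show "relocate k P ! (2 * p) = relocate_instr k (P ! p) ! 0"
    "relocate k P ! Suc (2 * p) = relocate_instr k (P ! p) ! 1" by auto
  have "length (relocate k P) = 2 * length P" by (induction P) (auto simp: relocate_def)
  then show "Suc (2 * p) < length (relocate k P)" using assms by simp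
qed

lemma run_Fault: "run W P t Fault = return_pmf Fault"
  by (induction t) (auto simp: bind_return_pmf)

lemma run_Halted: "run W P t (Halted e) = return_pmf (Halted e)"
  by (induction t) (auto simp: bind_return_pmf)

lemma run_add: "run W P (t + u) S = bind_pmf (run W P t S) (run W P u)"
  by (induction t arbitrary: S) (auto simp: bind_return_pmf bind_assoc_pmf intro!: bind_pmf_cong)

text \<open>As every outcome of the original run has halted, no value it produces reaches
  \<open>W0\<close>, and the copy with larger words behaves alike. The bound \<open>B\<close> on
  registers may exceed \<open>W0\<close> because initial registers are not checked;
  \<open>2 * B \<le> W\<close> leaves room for the doubled output.\<close>

lemma run_relocate:
  assumes "set_pmf (run W0 P t (Running p R M)) \<subseteq> Halted ` E" "W0 \<le> B" "2 * B \<le> W" "\<forall>r. R r < B"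
  shows "set_pmf (run W (Q @ relocate (length Q) P) (2 * t) (Running (length Q + 2 * p) R M))
    \<subseteq> (\<lambda>e. Halted (2 * e)) ` E"
  using assms(1,4)
proof (induction t arbitrary: p R M)
  case 0
  then show ?case by auto
next
  case (Suc t)
  let ?P = "Q @ relocate (length Q) P"
  have p: "p < length P"
  proof (rule ccontr)
    assume "\<not> p < length P"
    with Suc.prems(1) show False by (auto simp: bind_return_pmf run_Fault)
  qed
  have nop: "run W ?P (Suc u) (Running (Suc (length Q + 2 * p)) R' M') = run W ?P u (Running (length Q + 2 * Suc p) R' M')"
    if "P ! p \<noteq> Halt" for u R' M'
  proof -
    have "relocate_instr (length Q) (P ! p) ! 1 = JumpLess 0 0 0" using that by (cases "P ! p") auto
    then show ?thesis using relocate_nth[OF p, of "length Q"] by (simp add: nth_append bind_return_pmf)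
  qed
  have next_instr: "set_pmf (run W ?P (2 * t + 1) (Running (Suc (length Q + 2 * p)) R' M')) \<subseteq> (\<lambda>e. Halted (2 * e)) ` E"
    if "set_pmf (run W0 P t (Running (Suc p) R' M')) \<subseteq> Halted ` E" "\<forall>r. R' r < B" "P ! p \<noteq> Halt" for R' M'
    unfolding Suc_eq_plus1[symmetric] nop[OF that(3)] by (rule Suc.IH[OF that(1,2)])
  have first: "step W ?P (Running (length Q + 2 * p) R M)
    = exec_instr W (length Q + 2 * p) R M (relocate_instr (length Q) (P ! p) ! 0)"
    using relocate_nth[OF p, of "length Q"] by (simp add: nth_append)
  have sub: "set_pmf (run W0 P t S) \<subseteq> Halted ` E" if "S \<in> set_pmf (exec_instr W0 p R M (P ! p))" for S
    using Suc.prems(1) p that by auto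
  have reg: "set_pmf (run W ?P (2 * t + 1) (set_reg W (length Q + 2 * p) R M r v)) \<subseteq> (\<lambda>e. Halted (2 * e)) ` E"
    if "set_reg W0 p R M r v \<in> set_pmf (exec_instr W0 p R M (P ! p))" "P ! p \<noteq> Halt" for r v
  proof -
    \<comment> \<open>Otherwise the original run would be in \<open>Fault\<close> and never leave
      it.\<close>
    have v: "v < W0"
    proof (rule ccontr)
      assume "\<not> v < W0"
      with sub[OF that(1)] show False by (auto simp: set_reg_def run_Fault)
    qed
    have "set_pmf (run W0 P t (Running (Suc p) (R(r := v)) M)) \<subseteq> Halted ` E"
      using sub[OF that(1)] v by (simp add: set_reg_def)
    moreover have "\<forall>x. (R(r := v)) x < B" using v Suc.prems(2) assms(2) by simp
    moreover have "set_reg W (length Q + 2 * p) R M r v = Running (Suc (length Q + 2 * p)) (R(r := v)) M"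
      using v assms(2,3) by (simp add: set_reg_def)
    ultimately show ?thesis using next_instr that(2) by metis
  qed
  have two: "run W ?P (2 * Suc t) (Running (length Q + 2 * p) R M)
    = bind_pmf (step W ?P (Running (length Q + 2 * p) R M)) (run W ?P (2 * t + 1))"
    by simp
  show ?case
  proof (cases "P ! p")
    case (Store a b)
    have "set_pmf (run W0 P t (Running (Suc p) R (M(R a := R b)))) \<subseteq> Halted ` E"
      using sub Store by simp
    from next_instr[OF this Suc.prems(2)] show ?thesis
      unfolding two first using Store by (simp add: bind_return_pmf del: run.simps)
  next
    case (JumpLess a b l)
    show ?thesis
    proof (cases "R a < R b")
      case True
      then have "set_pmf (run W0 P t (Running l R M)) \<subseteq> Halted ` E"
        using sub JumpLess by simp
      from Suc.IH[OF this Suc.prems(2)]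
      have IH: "set_pmf (run W ?P (2 * t) (Running (length Q + 2 * l) R M)) \<subseteq> (\<lambda>e. Halted (2 * e)) ` E" .
      have "\<forall>S\<in>set_pmf (run W ?P (2 * t) (Running (length Q + 2 * l) R M)). \<exists>e\<in>E. S = Halted (2 * e)"
        using IH by auto
      \<comment> \<open>A taken jump saves one of the two time units; the spare one is spent in a
        halted state.\<close>
      then have "set_pmf (run W ?P (2 * t + 1) (Running (length Q + 2 * l) R M)) \<subseteq> (\<lambda>e. Halted (2 * e)) ` E"
        unfolding run_add[of W ?P "2 * t" 1] by (auto simp: bind_return_pmf)
      then show ?thesis unfolding two first using JumpLess True
        by (simp add: bind_return_pmf del: run.simps)
    next
      case False
      then have "set_pmf (run W0 P t (Running (Suc p) R M)) \<subseteq> Halted ` E"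
        using sub JumpLess by simp
      from next_instr[OF this Suc.prems(2)] show ?thesis
        unfolding two first using JumpLess False by (simp add: bind_return_pmf del: run.simps)
    qed
  next
    case (Rand r a)
    then show ?thesis unfolding two first using reg[of r] by (fastforce simp: set_pmf_of_set simp del: run.simps)
  next
    case Halt
    then have e: "R 0 \<in> E" using sub by (auto simp: run_Halted)
    have "R 0 + R 0 < W" using Suc.prems(2)[rule_format, of 0] assms(3) by simp
    moreover have "?P ! Suc (length Q + 2 * p) = Halt" "Suc (length Q + 2 * p) < length ?P"
      using relocate_nth[OF p, of "length Q"] Halt by (auto simp: nth_append)
    ultimately show ?thesis unfolding two first using Halt e
      by (auto simp: bind_return_pmf set_reg_def run_Halted mult_2)
  qed (use reg two first in \<open>simp_all add: bind_return_pmf del: run.simps\<close>)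
qed

section \<open>The program\<close>

fun block :: "instr list \<Rightarrow> com" where
  "block [] = Prim Halt"
| "block [i] = Prim i"
| "block (i # is) = Prim i ;; block is"

text \<open>
  Registers: 0 the length \<open>n\<close>; 1 the number of letters read; 2 the top frame; 3 and 4 the numbers
  of letters written to the two output strings; 5 to 9 the numbers \<open>2n\<close>, \<open>3n\<close>, \<open>4n\<close>, \<open>5n\<close>, \<open>7n\<close>;
  10 to 12 the numbers 0, 1, 2; the others are scratch.

  A node or frame is the 1-based position \<open>j\<close> of its open parenthesis, and 0 is the null pointer.
  Its open and close letter, the head of its path below, its number of blocks and the next frame
  are at \<open>n + j\<close>, \<open>2n + j\<close>, \<open>3n + j\<close>, \<open>4n + j\<close> and \<open>5n + j\<close>. The left output overwrites the input,
  the right output is collected from \<open>7n\<close>.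
\<close>

definition emit_loop :: com where
  "emit_loop = Repeat
     (block [Add 17 0 15, Load 18 17, Mul 18 18 0, Add 18 18 16, Store 3 18, Add 3 3 11,
             Add 17 5 15, Load 18 17] ;;
      Unless 18 11 (block [Mul 18 18 0, Add 18 18 16, Add 17 9 4, Store 17 18, Add 4 4 11]) ;;
      block [Add 17 6 15, Load 15 17]) 10 15"

text \<open>The tag is saved in register 16 before the loop, as register 3 advances with every left
  letter. A null path is skipped, since a loop executes its body at least once.\<close>

definition emit :: com where
  "emit = Unless 15 11 (Prim (Add 16 3 10) ;; emit_loop)"

text \<open>Register 1 has already been advanced and so is the 1-based position.\<close>

definition read_open :: com where
  "read_open = block [Add 17 0 1, Store 17 19, Add 17 8 1, Store 17 2, Add 2 1 10]"

text \<open>The cells for a partner and for a successor are still 0, so one store creates a path of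
  one node.\<close>

definition read_unmatched_close :: com where
  "read_unmatched_close = block [Add 17 0 1, Store 17 13, Add 15 1 10]"

text \<open>Storing the close letter turns the frame into a node on top of the path below it; no
  link has to change. Equality of types is tested by the sum of the two truncated differences, which
  is 0 iff the letters agree.\<close>

definition read_matched_close :: com where
  "read_matched_close =
     block [Add 17 5 2, Store 17 13, Add 17 0 2, Load 18 17, Add 17 7 2, Load 19 17] ;;
     Unless 10 19 (block [Sub 14 18 13, Sub 20 13 18, Add 14 14 20] ;; Unless 14 11 (Prim (Const 19 1))) ;;
     block [Add 17 8 2, Load 20 17, Add 15 2 10] ;;
     Unless 20 11
       (block [Add 17 7 20, Load 18 17, Add 14 18 19, Store 17 14] ;;
        Unless 19 18 (block [Add 17 6 20, Load 15 17, Store 17 2])) ;;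
     Prim (Add 2 20 10)"

definition read_close :: com where
  "read_close = Unless 10 2 read_unmatched_close ;; Unless 2 11 read_matched_close ;; emit"

text \<open>The parity of the code decides. \<open>read_open\<close> preserves registers 13 and 14,
  so the second test still sees the letter.\<close>

definition read_letter :: com where
  "read_letter =
     block [Load 13 1, Add 1 1 11, Div 14 13 12, Mul 14 14 12, Add 19 13 11] ;;
     Unless 14 13 read_open ;;
     Prim (Add 14 14 11) ;;
     Unless 13 14 read_close"

text \<open>The link to the path is cleared before the path is emitted; afterwards the frame itself
  is a path of one node without a close letter.\<close>

definition drain_frame :: com where
  "drain_frame =
     block [Add 17 6 2, Load 15 17, Store 17 10] ;; emit ;;
     Prim (Add 15 2 10) ;; emit ;;
     block [Add 17 8 2, Load 2 17]"

text \<open>The right string is moved behind the left one. Then memory and scratch registers are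
  cleared, because the given algorithm is only known to work from a \<open>start\<close>
  state.\<close>

definition preprocess :: com where
  "preprocess =
     block [Const 10 0, Const 11 1, Const 12 2, Add 5 0 0, Add 6 5 0, Add 7 5 5, Add 8 7 0, Add 9 7 6] ;;
     Repeat read_letter 1 0 ;;
     Unless 2 11 (Repeat drain_frame 10 2) ;;
     Prim (Const 14 0) ;;
     Unless 4 11 (Repeat (block [Add 17 9 14, Load 18 17, Add 19 3 14, Store 19 18, Add 14 14 11]) 14 4) ;;
     block [Add 14 0 10, Add 15 9 0] ;;
     Repeat (block [Store 14 10, Add 14 14 11]) 14 15 ;;
     block [Add 0 3 10, Add 1 4 10, Const 2 0, Const 3 0, Const 4 0, Const 5 0, Const 6 0, Const 7 0,
       Const 8 0, Const 9 0, Const 10 0, Const 11 0, Const 12 0, Const 13 0, Const 14 0, Const 15 0,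
       Const 16 0, Const 17 0, Const 18 0, Const 19 0, Const 20 0]"

section \<open>Memory invariants and correctness of the code\<close>

definition fixed_regs :: "nat \<Rightarrow> (nat \<Rightarrow> nat) \<Rightarrow> bool" where
  "fixed_regs n R \<longleftrightarrow> R 0 = n \<and> R 5 = 2 * n \<and> R 6 = 3 * n \<and> R 7 = 4 * n \<and> R 8 = 5 * n \<and> R 9 = 7 * n \<and>
     R 10 = 0 \<and> R 11 = 1 \<and> R 12 = 2 \<and> (\<forall>r>20. R r = 0)"

fun path_at :: "(nat \<Rightarrow> nat) \<Rightarrow> nat \<Rightarrow> nat \<Rightarrow> (nat \<times> nat \<times> nat) list \<Rightarrow> bool" where
  "path_at M n q [] \<longleftrightarrow> q = 0"
| "path_at M n q ((j, a, b) # p) \<longleftrightarrow> q = j \<and> 0 < j \<and> j \<le> n \<and> M (n + j) = a \<and> M (2 * n + j) = b \<and>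
     path_at M n (M (3 * n + j)) p"

definition put :: "nat \<Rightarrow> nat list \<Rightarrow> (nat \<Rightarrow> nat) \<Rightarrow> nat \<Rightarrow> nat" where
  "put a xs M = (\<lambda>i. if a \<le> i \<and> i < a + length xs then xs ! (i - a) else M i)"

lemma put_Nil [simp]: "put a [] M = M"
  by (auto simp: put_def)

lemma put_Cons: "put a (x # xs) M = put (Suc a) xs (M(a := x))"
  by (auto simp: put_def fun_eq_iff nth_Cons')

lemma put_outside: "i < a \<or> a + length xs \<le> i \<Longrightarrow> put a xs M i = M i"
  by (auto simp: put_def)

lemma put_upd: "b < a \<or> a + length xs \<le> b \<Longrightarrow> put a xs (M(b := y)) = (put a xs M)(b := y)"
  by (auto simp: put_def fun_eq_iff)

lemma path_at_cong:
  "(\<And>j. j \<in> fst ` set p \<Longrightarrow> M (n + j) = M' (n + j) \<and> M (2 * n + j) = M' (2 * n + j) \<and> M (3 * n + j) = M' (3 * n + j)) \<Longrightarrow>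
   path_at M n q p = path_at M' n q p"
  by (induction M n q p rule: path_at.induct) auto

lemma path_at_bounds: "path_at M n q p \<Longrightarrow> j \<in> fst ` set p \<Longrightarrow> 0 < j \<and> j \<le> n"
  by (induction M n q p rule: path_at.induct) auto

definition letters_left :: "nat \<Rightarrow> nat \<Rightarrow> (nat \<times> nat \<times> nat) list \<Rightarrow> nat list" where
  "letters_left n g p = map (\<lambda>(j, a, b). a * n + g) p"

definition letters_right :: "nat \<Rightarrow> nat \<Rightarrow> (nat \<times> nat \<times> nat) list \<Rightarrow> nat list" where
  "letters_right n g p = map (\<lambda>(j, a, b). b * n + g) (filter (\<lambda>(j, a, b). b \<noteq> 0) p)"

text \<open>The left output stays below address \<open>n\<close> and the right one starts at
  \<open>7 * n\<close>, so neither overwrites the tables of nodes between them. The bound 20 per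
  node includes the loop test.\<close>

lemma wp_emit_loop:
  assumes "p \<noteq> []" "path_at M n (R 15) p" "fixed_regs n R" "R 16 = g" "g < n"
    and "R 3 + length p \<le> n" "R 4 + length (letters_right n g p) \<le> n"
    and "\<forall>(j, a, b)\<in>set p. a * n + n \<le> W \<and> b * n + n \<le> W" and W: "10 * n + 10 \<le> W"
  shows "wp W emit_loop (\<lambda>R' M' t'. M' = put (7 * n + R 4) (letters_right n g p) (put (R 3) (letters_left n g p) M) \<and>
      R' 3 = R 3 + length p \<and> R' 4 = R 4 + length (letters_right n g p) \<and> t' \<le> t + 20 * length p \<and>
      (\<forall>r. r \<notin> {3, 4, 15, 16, 17, 18} \<longrightarrow> R' r = R r)) R M t"
  using assms(1-8)
proof (induction p arbitrary: R M t)
  case (Cons x p)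
  obtain j a b where x: "x = (j, a, b)" by (cases x)
  from Cons.prems(3) have r: "R 0 = n" "R 5 = 2 * n" "R 6 = 3 * n" "R 9 = 7 * n" "R 10 = 0" "R 11 = 1"
    by (auto simp: fixed_regs_def)
  have j: "R 15 = j" "0 < j" "j \<le> n" "M (n + j) = a" "M (2 * n + j) = b" "path_at M n (M (3 * n + j)) p"
    using Cons.prems(2) x by auto
  have ab: "a * n + n \<le> W" "b * n + n \<le> W" using Cons.prems(8) x by auto
  have sz: "R 3 < n" using Cons.prems(6) by simp
  define y where "y = (if b = 0 then [] else [b * n + g])"
  define M1 where "M1 = put (7 * n + R 4) y (M(R 3 := a * n + g))"
  have lr: "letters_right n g (x # p) = y @ letters_right n g p"
    by (simp add: letters_right_def y_def x)
  have ll: "letters_left n g (x # p) = (a * n + g) # letters_left n g p"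
    by (simp add: letters_left_def x)
  have y4: "b \<noteq> 0 \<Longrightarrow> R 4 < n" using Cons.prems(7) lr y_def by simp
  have M1: "M1 i = M i" if "n < i" "i < 7 * n" for i
    using that sz by (auto simp: M1_def y_def put_def)
  have path: "path_at M1 n (M (3 * n + j)) p"
  proof -
    have "path_at M1 n (M (3 * n + j)) p = path_at M n (M (3 * n + j)) p"
      by (rule path_at_cong) (use path_at_bounds[OF j(6)] in \<open>auto intro!: M1; force\<close>)
    with j show ?thesis by simp
  qed
  let ?body = "block [Add 17 0 15, Load 18 17, Mul 18 18 0, Add 18 18 16, Store 3 18, Add 3 3 11,
             Add 17 5 15, Load 18 17] ;;
      Unless 18 11 (block [Mul 18 18 0, Add 18 18 16, Add 17 9 4, Store 17 18, Add 4 4 11]) ;;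
      block [Add 17 6 15, Load 15 17]"
  have body: "wp W ?body (\<lambda>R' M' t'. M' = M1 \<and> R' 3 = Suc (R 3) \<and> R' 4 = R 4 + length y \<and>
      R' 15 = M (3 * n + j) \<and> fixed_regs n R' \<and> R' 16 = g \<and> t' \<le> t + 19 \<and>
      (\<forall>r. r \<notin> {3, 4, 15, 16, 17, 18} \<longrightarrow> R' r = R r)) R M t"
    using r j ab sz y4 W Cons.prems(3,4,5) by (auto simp: M1_def y_def fixed_regs_def put_Cons)
  show ?case unfolding emit_loop_def
  proof (rule wp_Repeat, fold emit_loop_def, rule wp_mono[OF body])
    fix R' M' t'
    assume a: "M' = M1 \<and> R' 3 = Suc (R 3) \<and> R' 4 = R 4 + length y \<and>
      R' 15 = M (3 * n + j) \<and> fixed_regs n R' \<and> R' 16 = g \<and> t' \<le> t + 19 \<and>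
      (\<forall>r. r \<notin> {3, 4, 15, 16, 17, 18} \<longrightarrow> R' r = R r)"
    let ?Q = "\<lambda>R' M' t'. M' = put (7 * n + R 4) (letters_right n g (x # p)) (put (R 3) (letters_left n g (x # p)) M) \<and>
      R' 3 = R 3 + length (x # p) \<and> R' 4 = R 4 + length (letters_right n g (x # p)) \<and> t' \<le> t + 20 * length (x # p) \<and>
      (\<forall>r. r \<notin> {3, 4, 15, 16, 17, 18} \<longrightarrow> R' r = R r)"
    have len: "length (letters_left n g p) = length p" by (simp add: letters_left_def)
    have mem: "put (7 * n + (R 4 + length y)) (letters_right n g p) (put (Suc (R 3)) (letters_left n g p) M1)
      = put (7 * n + R 4) (letters_right n g (x # p)) (put (R 3) (letters_left n g (x # p)) M)"
      unfolding lr ll M1_def using sz Cons.prems(6) len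
      by (auto simp: y_def put_Cons put_upd)
    show "if R' 10 < R' 15 then wp W emit_loop ?Q R' M' (Suc t') else ?Q R' M' (Suc t')"
    proof (cases "p = []")
      case True
      with path a r have "\<not> R' 10 < R' 15" by (auto simp: fixed_regs_def)
      with True a mem lr len show ?thesis by (auto simp: letters_right_def letters_left_def)
    next
      case False
      then have "R' 10 < R' 15" using path a r by (cases p) (auto simp: fixed_regs_def)
      moreover have "wp W emit_loop ?Q R' M' (Suc t')"
      proof (rule wp_mono[OF Cons.IH[OF False]])
        show "path_at M' n (R' 15) p" "fixed_regs n R'" "R' 16 = g" "g < n" using path a Cons.prems by auto
        show "R' 3 + length p \<le> n" "R' 4 + length (letters_right n g p) \<le> n"
          "\<forall>(j, a, b)\<in>set p. a * n + n \<le> W \<and> b * n + n \<le> W"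
          using a Cons.prems lr by auto
      next
        fix R2 M2 t2
        assume "M2 = put (7 * n + R' 4) (letters_right n g p) (put (R' 3) (letters_left n g p) M') \<and>
          R2 3 = R' 3 + length p \<and> R2 4 = R' 4 + length (letters_right n g p) \<and> t2 \<le> Suc t' + 20 * length p \<and>
          (\<forall>r. r \<notin> {3, 4, 15, 16, 17, 18} \<longrightarrow> R2 r = R' r)"
        with a mem lr show "?Q R2 M2 t2" by auto
      qed
      ultimately show ?thesis by simp
    qed
  qed
qed simp

fun frame_ids :: "nat frame \<Rightarrow> nat list" where
  "frame_ids (j, a, w, p) = j # map fst p"

definition ids :: "nat frame list \<Rightarrow> nat list" where
  "ids fs = concat (map frame_ids fs)"

lemma ids_simps [simp]: "ids [] = []" "ids ((j, a, w, p) # fs) = j # map fst p @ ids fs"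
  by (simp_all add: ids_def)

text \<open>Both parentheses of type \<open>a\<close> are stored as \<open>2 * a + 1\<close>, which
  is the code of the close one and the code of the open one plus 1. Being odd it is never 0, the
  mark of a missing partner.\<close>

definition raw :: "nat node list \<Rightarrow> (nat \<times> nat \<times> nat) list" where
  "raw p = map (\<lambda>(j, a, b). (j, 2 * a + 1, 2 * b + 1)) p"

lemma raw_simps [simp]: "raw [] = []" "raw ((j, a, b) # p) = (j, 2 * a + 1, 2 * b + 1) # raw p"
  by (simp_all add: raw_def)

lemma ids_raw: "fst ` set (raw p) = fst ` set p"
  by (force simp: raw_def)

fun frames_at :: "(nat \<Rightarrow> nat) \<Rightarrow> nat \<Rightarrow> nat \<Rightarrow> nat frame list \<Rightarrow> bool" where
  "frames_at M n t [] \<longleftrightarrow> t = 0"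
| "frames_at M n t ((j, a, w, p) # fs) \<longleftrightarrow> t = j \<and> M (n + j) = 2 * a + 1 \<and> M (2 * n + j) = 0 \<and>
     path_at M n (M (3 * n + j)) (raw p) \<and> M (4 * n + j) = w \<and> frames_at M n (M (5 * n + j)) fs"

lemma frames_at_cong:
  "(\<And>j. j \<in> set (ids fs) \<Longrightarrow> M (n + j) = M' (n + j) \<and> M (2 * n + j) = M' (2 * n + j) \<and>
      M (3 * n + j) = M' (3 * n + j) \<and> M (4 * n + j) = M' (4 * n + j) \<and> M (5 * n + j) = M' (5 * n + j)) \<Longrightarrow>
   frames_at M n t fs = frames_at M' n t fs"
proof (induction M n t fs rule: frames_at.induct)
  case (2 M n t j a w p fs)
  have "path_at M n q (raw p) = path_at M' n q (raw p)" for q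
    by (rule path_at_cong) (use 2(2) in \<open>auto simp: ids_raw\<close>)
  moreover have "frames_at M n (M (5 * n + j)) fs = frames_at M' n (M (5 * n + j)) fs"
    using 2 by auto
  ultimately show ?case using 2(2)[of j] by auto
qed simp

text \<open>\<open>R 3 + R 4 \<le> k\<close> keeps the left output behind the read position, so that
  it overwrites only letters already read. The zeros at unread positions make a new frame start with
  no partner, an empty path and no blocks.\<close>

definition layout :: "nat \<Rightarrow> nat paren list \<Rightarrow> nat \<Rightarrow> nat frame list \<Rightarrow> nat group list \<Rightarrow>
    (nat \<Rightarrow> nat) \<Rightarrow> (nat \<Rightarrow> nat) \<Rightarrow> bool" where
  "layout n \<sigma> k fs gs R M \<longleftrightarrow> fixed_regs n R \<and> frames_at M n (R 2) fs \<and>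
     distinct (ids fs) \<and> set (ids fs) \<subseteq> {1..k} \<and>
     R 3 = length (encode_left n 0 gs) \<and> R 4 = length (encode_right n 0 gs) \<and> R 3 + R 4 \<le> k \<and>
     (\<forall>i<R 3. M i = encode_left n 0 gs ! i) \<and> (\<forall>i<R 4. M (7 * n + i) = encode_right n 0 gs ! i) \<and>
     (\<forall>i. k \<le> i \<and> i < n \<longrightarrow> M i = paren_code (\<sigma> ! i)) \<and>
     (\<forall>j. k < j \<and> j \<le> n \<longrightarrow> M (2 * n + j) = 0 \<and> M (3 * n + j) = 0 \<and> M (4 * n + j) = 0) \<and>
     (\<forall>i\<ge>8 * n. M i = 0)"

text \<open>Relating the stored path to an arbitrary group \<open>(l, r)\<close> lets the lemma
  serve for heavy paths and for single unmatched parentheses.\<close>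

lemma wp_emit_layout:
  assumes lay: "layout n \<sigma> k fs gs R M" and "k \<le> n" and path: "path_at M n (R 15) p"
    and l: "letters_left n (R 3) p = map (\<lambda>a. (2 * a + 1) * n + R 3) l"
    and r: "letters_right n (R 3) p = map (\<lambda>a. (2 * a + 1) * n + R 3) r"
    and size: "R 3 + length l + R 4 + length r \<le> k"
    and "\<forall>(j, a, b)\<in>set p. a * n + n \<le> W \<and> b * n + n \<le> W" and W: "10 * n + 10 \<le> W"
  shows "wp W emit (\<lambda>R' M' t'. layout n \<sigma> k fs (gs @ [(l, r)]) R' M' \<and>
      (\<forall>r. r \<notin> {3, 4, 15, 16, 17, 18} \<longrightarrow> R' r = R r) \<and> (\<forall>i. n \<le> i \<and> i < 7 * n \<longrightarrow> M' i = M i) \<and>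
      R' 3 = R 3 + length l \<and> t' \<le> t + 2 + 20 * length l) R M t"
proof -
  have len: "length p = length l" using arg_cong[OF l, of length] by (simp add: letters_left_def)
  have lenr: "length (letters_right n (R 3) p) = length r" using r by simp
  have rg: "R 3 = length (encode_left n 0 gs)" "R 4 = length (encode_right n 0 gs)" "R 10 = 0" "R 11 = 1"
    "fixed_regs n R" using lay by (auto simp: layout_def fixed_regs_def)
  show ?thesis
  proof (cases "p = []")
    case True
    then have "R 15 = 0" "l = []" "r = []" using path len lenr by (auto simp: letters_right_def)
    then show ?thesis using lay rg
      by (simp add: emit_def) (simp add: layout_def encode_left_append encode_right_append)
  next
    case False
    then have q: "0 < R 15" using path by (cases p) auto
    have "0 < length l" using False len by auto
    let ?R = "R(16 := R 3)"
    have "wp W emit_loop (\<lambda>R' M' t'. layout n \<sigma> k fs (gs @ [(l, r)]) R' M' \<and>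
      (\<forall>r. r \<notin> {3, 4, 15, 16, 17, 18} \<longrightarrow> R' r = R r) \<and> (\<forall>i. n \<le> i \<and> i < 7 * n \<longrightarrow> M' i = M i) \<and>
      R' 3 = R 3 + length l \<and> t' \<le> t + 2 + 20 * length l) ?R M (Suc (Suc t))"
    proof (rule wp_mono[OF wp_emit_loop[where n = n and g = "R 3" and p = p]])
      show "p \<noteq> []" "path_at M n (?R 15) p" "fixed_regs n ?R" "?R 16 = R 3" using False path rg by (auto simp: fixed_regs_def)
      show "R 3 < n" using size \<open>k \<le> n\<close> \<open>0 < length l\<close> by linarith
      show "?R 3 + length p \<le> n" "?R 4 + length (letters_right n (R 3) p) \<le> n"
        using size \<open>k \<le> n\<close> \<open>0 < length l\<close> len lenr by auto
      show "\<forall>(j, a, b)\<in>set p. a * n + n \<le> W \<and> b * n + n \<le> W" "10 * n + 10 \<le> W" by fact+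
    next
      fix R' M' t'
      assume a: "M' = put (7 * n + ?R 4) (letters_right n (R 3) p) (put (?R 3) (letters_left n (R 3) p) M) \<and>
        R' 3 = ?R 3 + length p \<and> R' 4 = ?R 4 + length (letters_right n (R 3) p) \<and>
        t' \<le> Suc (Suc t) + 20 * length p \<and> (\<forall>r. r \<notin> {3, 4, 15, 16, 17, 18} \<longrightarrow> R' r = ?R r)"
      let ?l = "map (\<lambda>a. (2 * a + 1) * n + R 3) l" and ?r = "map (\<lambda>a. (2 * a + 1) * n + R 3) r"
      have M': "M' = put (7 * n + R 4) ?r (put (R 3) ?l M)" using a l r by simp
      have el: "encode_left n 0 (gs @ [(l, r)]) = encode_left n 0 gs @ ?l"
        using rg by (simp add: encode_left_append)
      have er: "encode_right n 0 (gs @ [(l, r)]) = encode_right n 0 gs @ ?r"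
        using rg by (simp add: encode_right_append)
      have out: "M' i = M i" if "R 3 + length l \<le> i" "i < 7 * n + R 4 \<or> 7 * n + R 4 + length r \<le> i" for i
        using that unfolding M' by (simp add: put_outside)
      have mid: "M' i = M i" if "n \<le> i" "i < 7 * n" for i
        using that size \<open>k \<le> n\<close> by (intro out) auto
      have R': "R' 3 = R 3 + length l" "R' 4 = R 4 + length r" "R' 2 = R 2"
        using a len lenr by auto
      have "fixed_regs n R'" using a rg(5) by (auto simp: fixed_regs_def)
      moreover have "frames_at M' n (R' 2) fs"
      proof -
        have "frames_at M' n (R 2) fs = frames_at M n (R 2) fs"
          by (rule frames_at_cong) (use lay \<open>k \<le> n\<close> in \<open>fastforce simp: layout_def intro!: mid\<close>)
        then show ?thesis using lay R' by (simp add: layout_def)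
      qed
      moreover have "\<forall>i<R' 3. M' i = encode_left n 0 (gs @ [(l, r)]) ! i"
      proof (intro allI impI)
        fix i assume i: "i < R' 3"
        then have "i < 7 * n" using R' size \<open>k \<le> n\<close> by auto
        then have "M' i = put (R 3) ?l M i" unfolding M' by (simp add: put_outside)
        then show "M' i = encode_left n 0 (gs @ [(l, r)]) ! i"
          unfolding el using i R' lay rg by (auto simp: put_def nth_append layout_def)
      qed
      moreover have "\<forall>i<R' 4. M' (7 * n + i) = encode_right n 0 (gs @ [(l, r)]) ! i"
      proof (intro allI impI)
        fix i assume i: "i < R' 4"
        have "put (R 3) ?l M (7 * n + i) = M (7 * n + i)" using size \<open>k \<le> n\<close> by (simp add: put_outside)
        then show "M' (7 * n + i) = encode_right n 0 (gs @ [(l, r)]) ! i"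
          unfolding er M' using i R' lay rg by (auto simp: put_def nth_append layout_def)
      qed
      moreover have "\<forall>i. k \<le> i \<and> i < n \<longrightarrow> M' i = M i" using size by (auto intro!: out)
      moreover have "\<forall>i\<ge>8 * n. M' i = M i" using size \<open>k \<le> n\<close> by (auto intro!: out)
      moreover have "\<forall>j. k < j \<and> j \<le> n \<longrightarrow> M' (2 * n + j) = 0 \<and> M' (3 * n + j) = 0 \<and> M' (4 * n + j) = 0"
        using lay mid by (auto simp: layout_def)
      ultimately have "layout n \<sigma> k fs (gs @ [(l, r)]) R' M'"
        using lay R' rg size unfolding layout_def el er by auto
      then show "layout n \<sigma> k fs (gs @ [(l, r)]) R' M' \<and>
        (\<forall>r. r \<notin> {3, 4, 15, 16, 17, 18} \<longrightarrow> R' r = R r) \<and> (\<forall>i. n \<le> i \<and> i < 7 * n \<longrightarrow> M' i = M i) \<and>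
        R' 3 = R 3 + length l \<and> t' \<le> t + 2 + 20 * length l" using a R' mid len by auto
    qed
    moreover have "R 3 < W" using size \<open>k \<le> n\<close> W by simp
    ultimately show ?thesis using q rg by (simp add: emit_def)
  qed
qed

lemma letters_raw:
  "letters_left n g (raw p) = map (\<lambda>a. (2 * a + 1) * n + g) (fst (path_group p))"
  "letters_right n g (raw p) = map (\<lambda>a. (2 * a + 1) * n + g) (snd (path_group p))"
  by (induction p) (auto simp: letters_left_def letters_right_def raw_def path_group_def)

lemma layout_update:
  assumes "layout n \<sigma> k fs gs R M" "k < n"
    and "\<And>i. i \<le> n \<or> 6 * n < i \<Longrightarrow> M' i = M i"
    and "\<And>j. Suc k < j \<Longrightarrow> j \<le> n \<Longrightarrow>
      M' (2 * n + j) = M (2 * n + j) \<and> M' (3 * n + j) = M (3 * n + j) \<and> M' (4 * n + j) = M (4 * n + j)"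
    and "fixed_regs n R'" "R' 3 = R 3" "R' 4 = R 4"
    and "frames_at M' n (R' 2) fs'" "distinct (ids fs')" "set (ids fs') \<subseteq> {1..Suc k}"
  shows "layout n \<sigma> (Suc k) fs' gs R' M'"
  using assms by (auto simp: layout_def)

text \<open>Distinct positions own distinct cells, so the node \<open>j\<close> receives its close
  letter, and the parent frame its new count and possibly its new path, without affecting any other
  path or frame.\<close>

lemma wp_read_matched_close:
  assumes lay: "layout n \<sigma> k ((j, a, w, p) # fs) gs R M" and k: "k < n" and R13: "R 13 = 2 * b + 1"
    and at: "attach (if w = 0 \<and> a \<noteq> b then 1 else w) ((j, a, b) # p) fs = (fs', q)"
    and W: "10 * n + 10 \<le> W" "2 * a + 2 \<le> W" "2 * b + 2 \<le> W" and wt: "w + (\<Sum>f\<leftarrow>fs. frame_weight f) \<le> n"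
  shows "wp W read_matched_close (\<lambda>R' M' t'. layout n \<sigma> (Suc k) fs' gs R' M' \<and> path_at M' n (R' 15) (raw q) \<and>
     R' 1 = R 1 \<and> R' 3 = R 3 \<and> R' 4 = R 4 \<and> t' \<le> t + 28) R M t"
proof -
  define w1 where "w1 = (if w = 0 \<and> a \<noteq> b then 1 else w)"
  define M1 where "M1 = M(2 * n + j := 2 * b + 1)"
  have r: "R 0 = n" "R 5 = 2 * n" "R 6 = 3 * n" "R 7 = 4 * n" "R 8 = 5 * n" "R 9 = 7 * n" "R 10 = 0" "R 11 = 1"
    and rg: "fixed_regs n R" using lay by (auto simp: layout_def fixed_regs_def)
  have j: "R 2 = j" "M (n + j) = 2 * a + 1" "M (4 * n + j) = w" "path_at M n (M (3 * n + j)) (raw p)"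
    "frames_at M n (M (5 * n + j)) fs" "0 < j" "j \<le> k"
    and d: "distinct (j # map fst p @ ids fs)" "set (j # map fst p @ ids fs) \<subseteq> {1..k}"
    using lay by (auto simp: layout_def)
  have M1: "M1 (n + i) = M (n + i)" "M1 (3 * n + i) = M (3 * n + i)" "M1 (4 * n + i) = M (4 * n + i)"
    "M1 (5 * n + i) = M (5 * n + i)" "i \<noteq> j \<Longrightarrow> M1 (2 * n + i) = M (2 * n + i)" if "0 < i" "i \<le> n" for i
    using that j k by (auto simp: M1_def)
  have M1j: "M1 (2 * n + j) = 2 * b + 1" by (simp add: M1_def)
  have M1o: "M1 i = M i" if "i \<le> n \<or> 6 * n < i" for i using that j k by (auto simp: M1_def)
  have dp: "0 < i \<and> i \<le> n \<and> i \<noteq> j" if "i \<in> fst ` set (raw p)" for i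
  proof -
    have "i \<in> set (map fst p)" using that by (simp add: ids_raw)
    then have "i \<in> {1..k}" "i \<noteq> j" using d by auto
    then show ?thesis using k by auto
  qed
  have df: "0 < i \<and> i \<le> n \<and> i \<noteq> j" if "i \<in> set (ids fs)" for i
  proof -
    have "i \<in> {1..k}" "i \<noteq> j" using d that by auto
    then show ?thesis using k by auto
  qed
  have p1: "path_at M1 n t (raw p) = path_at M n t (raw p)" for t
  proof (rule path_at_cong)
    fix i assume "i \<in> fst ` set (raw p)"
    then have "0 < i \<and> i \<le> n \<and> i \<noteq> j" using dp by blast
    then show "M1 (n + i) = M (n + i) \<and> M1 (2 * n + i) = M (2 * n + i) \<and> M1 (3 * n + i) = M (3 * n + i)"
      using M1 by blast
  qed
  have f1: "frames_at M1 n t fs = frames_at M n t fs" for t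
  proof (rule frames_at_cong)
    fix i assume "i \<in> set (ids fs)"
    then have "0 < i \<and> i \<le> n \<and> i \<noteq> j" using df by blast
    then show "M1 (n + i) = M (n + i) \<and> M1 (2 * n + i) = M (2 * n + i) \<and> M1 (3 * n + i) = M (3 * n + i) \<and>
      M1 (4 * n + i) = M (4 * n + i) \<and> M1 (5 * n + i) = M (5 * n + i)"
      using M1 by blast
  qed
  \<comment> \<open>The code is cut where the entry of \<open>j\<close> is final and only the parent
    frame remains to be updated.\<close>
  define A where "A = block [Add 17 5 2, Store 17 13, Add 17 0 2, Load 18 17, Add 17 7 2, Load 19 17] ;;
     Unless 10 19 (block [Sub 14 18 13, Sub 20 13 18, Add 14 14 20] ;; Unless 14 11 (Prim (Const 19 1))) ;;
     block [Add 17 8 2, Load 20 17, Add 15 2 10]"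
  define B where "B = Unless 20 11
       (block [Add 17 7 20, Load 18 17, Add 14 18 19, Store 17 14] ;;
        Unless 19 18 (block [Add 17 6 20, Load 15 17, Store 17 2])) ;;
     Prim (Add 2 20 10)"
  have split: "wp W read_matched_close Q R M t = wp W A (wp W B Q) R M t" for Q
    by (simp add: read_matched_close_def A_def B_def)
  have 1: "wp W A (\<lambda>R' M' t'. M' = M1 \<and> R' 19 = w1 \<and> R' 20 = M (5 * n + j) \<and> R' 15 = j \<and> t' \<le> t + 16 \<and>
    (\<forall>r. r \<notin> {14, 15, 17, 18, 19, 20} \<longrightarrow> R' r = R r)) R M t"
    using r j k R13 W by (auto simp: A_def w1_def M1_def)
  show ?thesis unfolding split
  proof (rule wp_mono[OF 1])
    fix R1 M' t1
    assume a1: "M' = M1 \<and> R1 19 = w1 \<and> R1 20 = M (5 * n + j) \<and> R1 15 = j \<and> t1 \<le> t + 16 \<and>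
      (\<forall>r. r \<notin> {14, 15, 17, 18, 19, 20} \<longrightarrow> R1 r = R r)"
    then have r1: "R1 0 = n" "R1 5 = 2 * n" "R1 6 = 3 * n" "R1 7 = 4 * n" "R1 8 = 5 * n" "R1 9 = 7 * n" "R1 10 = 0"
      "R1 11 = 1" "fixed_regs n R1" "R1 1 = R 1" "R1 2 = j" "R1 3 = R 3" "R1 4 = R 4"
      using r rg j by (auto simp: fixed_regs_def)
    let ?Q = "\<lambda>R' M' t'. layout n \<sigma> (Suc k) fs' gs R' M' \<and> path_at M' n (R' 15) (raw q) \<and>
     R' 1 = R 1 \<and> R' 3 = R 3 \<and> R' 4 = R 4 \<and> t' \<le> t + 28"
    have pathj: "path_at M1 n j (raw ((j, a, b) # p))"
      using j k M1[of j] M1j p1 by auto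
    show "wp W B ?Q R1 M' t1"
    proof (cases fs)
      case Nil
      have "wp W B (\<lambda>R' M' t'. M' = M1 \<and> R' 2 = 0 \<and> t' \<le> t1 + 2 \<and> (\<forall>r. r \<noteq> 2 \<longrightarrow> R' r = R1 r)) R1 M' t1"
        using a1 r1 j W Nil by (auto simp: B_def)
      then show ?thesis
      proof (rule wp_mono)
        fix R2 M2 t2
        assume a2: "M2 = M1 \<and> R2 2 = 0 \<and> t2 \<le> t1 + 2 \<and> (\<forall>r. r \<noteq> 2 \<longrightarrow> R2 r = R1 r)"
        have fs': "fs' = []" "q = (j, a, b) # p" using at Nil by auto
        have "layout n \<sigma> (Suc k) [] gs R2 M1"
        proof (rule layout_update[OF lay k])
          show "fixed_regs n R2" using a2 r1 by (auto simp: fixed_regs_def)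
        qed (use a2 r1 j k M1 M1o in auto)
        then show "?Q R2 M2 t2" using a1 a2 r1 pathj fs' by auto
      qed
    next
      case (Cons f fs3)
      obtain j' a' w' p' where f: "f = (j', a', w', p')" by (cases f)
      have j': "M (5 * n + j) = j'" "M (n + j') = 2 * a' + 1" "M (2 * n + j') = 0" "M (4 * n + j') = w'"
        "path_at M n (M (3 * n + j')) (raw p')" "frames_at M n (M (5 * n + j')) fs3"
        using j(5) Cons f by auto
      have d': "0 < j'" "j' \<le> k" "j' \<noteq> j" using d Cons f by auto
      \<comment> \<open>The extra 1 is the block that the pair may have just created.\<close>
      have ww: "w1 + w' \<le> n + 1" "w' \<le> n" using wt Cons f by (auto simp: w1_def)
      define M2 where "M2 = M1(4 * n + j' := w' + w1)"
      define M3 where "M3 = (if w' \<le> w1 then M2(3 * n + j' := j) else M2)"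
      have B: "wp W B (\<lambda>R' M' t'. M' = M3 \<and> R' 2 = j' \<and> R' 15 = (if w' \<le> w1 then M (3 * n + j') else j) \<and>
         t' \<le> t1 + 12 \<and> (\<forall>r. r \<notin> {2, 14, 15, 17, 18} \<longrightarrow> R' r = R1 r)) R1 M' t1"
        using a1 r1 j'(1,4) d' k W ww M1[of j'] by (auto simp: B_def M3_def M2_def)
      have M3: "M3 (n + i) = M1 (n + i)" "M3 (2 * n + i) = M1 (2 * n + i)" "M3 (5 * n + i) = M1 (5 * n + i)"
        "i \<noteq> j' \<Longrightarrow> M3 (3 * n + i) = M1 (3 * n + i)" "i \<noteq> j' \<Longrightarrow> M3 (4 * n + i) = M1 (4 * n + i)" if "0 < i" "i \<le> n" for i
        using that d' k by (auto simp: M3_def M2_def)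
      have M3j: "M3 (4 * n + j') = w' + w1" "M3 (3 * n + j') = (if w' \<le> w1 then j else M (3 * n + j'))"
        using d' k M1[of j'] by (auto simp: M3_def M2_def)
      have M3o: "M3 i = M1 i" if "i \<le> n \<or> 6 * n < i" for i using that d' k by (auto simp: M3_def M2_def)
      have dj': "i \<noteq> j'" if "i \<in> fst ` set (raw p) \<or> i \<in> fst ` set (raw p') \<or> i \<in> set (ids fs3)" for i
        using that d(1) unfolding Cons f ids_raw by auto
      have dp': "0 < i \<and> i \<le> n \<and> i \<noteq> j" if "i \<in> fst ` set (raw p') \<or> i \<in> set (ids fs3)" for i
        by (rule df) (use that in \<open>auto simp: ids_raw Cons f\<close>)
      have p3: "path_at M3 n t (raw p) = path_at M1 n t (raw p)" "path_at M3 n t (raw p') = path_at M1 n t (raw p')"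
        "path_at M1 n t (raw p') = path_at M n t (raw p')" for t
      proof -
        have *: "M3 (n + i) = M1 (n + i) \<and> M3 (2 * n + i) = M1 (2 * n + i) \<and> M3 (3 * n + i) = M1 (3 * n + i)"
          if "i \<in> fst ` set (raw p) \<or> i \<in> fst ` set (raw p')" for i
        proof -
          have "0 < i" "i \<le> n" "i \<noteq> j'" using that dp[of i] dp'[of i] dj'[of i] by blast+
          then show ?thesis by (simp add: M3)
        qed
        show "path_at M3 n t (raw p) = path_at M1 n t (raw p)"
          by (rule path_at_cong) (rule *, blast)
        show "path_at M3 n t (raw p') = path_at M1 n t (raw p')"
          by (rule path_at_cong) (rule *, blast)
        show "path_at M1 n t (raw p') = path_at M n t (raw p')"
        proof (rule path_at_cong)
          fix i assume "i \<in> fst ` set (raw p')"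
          then have "0 < i" "i \<le> n" "i \<noteq> j" using dp'[of i] by blast+
          then show "M1 (n + i) = M (n + i) \<and> M1 (2 * n + i) = M (2 * n + i) \<and> M1 (3 * n + i) = M (3 * n + i)"
            by (simp add: M1)
        qed
      qed
      have f3: "frames_at M3 n t fs3 = frames_at M1 n t fs3" "frames_at M1 n t fs3 = frames_at M n t fs3" for t
      proof -
        show "frames_at M3 n t fs3 = frames_at M1 n t fs3"
        proof (rule frames_at_cong)
          fix i assume "i \<in> set (ids fs3)"
          then have "0 < i" "i \<le> n" "i \<noteq> j'" using dp'[of i] dj'[of i] by blast+
          then show "M3 (n + i) = M1 (n + i) \<and> M3 (2 * n + i) = M1 (2 * n + i) \<and> M3 (3 * n + i) = M1 (3 * n + i) \<and>
            M3 (4 * n + i) = M1 (4 * n + i) \<and> M3 (5 * n + i) = M1 (5 * n + i)" by (simp add: M3)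
        qed
        show "frames_at M1 n t fs3 = frames_at M n t fs3"
        proof (rule frames_at_cong)
          fix i assume "i \<in> set (ids fs3)"
          then have "0 < i" "i \<le> n" "i \<noteq> j" using dp'[of i] by blast+
          then show "M1 (n + i) = M (n + i) \<and> M1 (2 * n + i) = M (2 * n + i) \<and> M1 (3 * n + i) = M (3 * n + i) \<and>
            M1 (4 * n + i) = M (4 * n + i) \<and> M1 (5 * n + i) = M (5 * n + i)" by (simp add: M1)
        qed
      qed
      have pathj3: "path_at M3 n j (raw ((j, a, b) # p))"
        using pathj p3 M3[of j] d' j k by auto
      from B show ?thesis
      proof (rule wp_mono)
        fix R2 M4 t2
        assume a2: "M4 = M3 \<and> R2 2 = j' \<and> R2 15 = (if w' \<le> w1 then M (3 * n + j') else j) \<and>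
         t2 \<le> t1 + 12 \<and> (\<forall>r. r \<notin> {2, 14, 15, 17, 18} \<longrightarrow> R2 r = R1 r)"
        have fq: "fs' = (j', a', w' + w1, if w' \<le> w1 then (j, a, b) # p else p') # fs3"
          "q = (if w' \<le> w1 then p' else (j, a, b) # p)"
          using at Cons f unfolding w1_def[symmetric] by (auto split: if_splits)
        have "layout n \<sigma> (Suc k) fs' gs R2 M3"
        proof (rule layout_update[OF lay k])
          show "fixed_regs n R2" "R2 3 = R 3" "R2 4 = R 4" using a2 r1 by (auto simp: fixed_regs_def)
          show "M3 i = M i" if "i \<le> n \<or> 6 * n < i" for i using M3o[OF that] M1o[OF that] by simp
          show "M3 (2 * n + i) = M (2 * n + i) \<and> M3 (3 * n + i) = M (3 * n + i) \<and> M3 (4 * n + i) = M (4 * n + i)"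
            if "Suc k < i" "i \<le> n" for i using that M3[of i] M1[of i] d' j by auto
          show "distinct (ids fs')" using d Cons f fq by auto
          show "set (ids fs') \<subseteq> {1..Suc k}" using d Cons f fq by (auto split: if_splits)
          show "frames_at M3 n (R2 2) fs'"
            using a2 fq M3[of j'] M1[of j'] M3j j' d' k p3 f3 pathj3 by auto
        qed
        moreover have "path_at M3 n (R2 15) (raw q)" using a2 fq p3 j' pathj3 by auto
        ultimately show "?Q R2 M4 t2" using a1 a2 r1 by auto
      qed
    qed
  qed
qed

lemma parsed_types:
  "parsed T \<sigma> fs g \<Longrightarrow> (j, a, w, p) \<in> set fs \<Longrightarrow> a \<in> T \<and> set (map snd p) \<subseteq> T \<times> T"
proof (induction rule: parsed.induct)
  case (push \<sigma> fs g f w' p' h a' i)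
  then show ?case using summary_path[OF push(2)] by (auto simp del: set_map)
qed simp

lemma raw_word_bound:
  assumes "set (map snd p) \<subseteq> {..<s} \<times> {..<s}" "2 * s * n \<le> W"
  shows "\<forall>(j, a, b)\<in>set (raw p). a * n + n \<le> W \<and> b * n + n \<le> W"
proof -
  have *: "(2 * a + 1) * n + n \<le> W" if "a < s" for a
  proof -
    have "(2 * a + 2) * n \<le> (2 * s) * n" using that by (intro mult_right_mono) auto
    then show ?thesis using assms(2) by (simp add: algebra_simps)
  qed
  have "a < s \<and> b < s" if "(j, a, b) \<in> set p" for j a b using that assms(1) by force
  then show ?thesis using * unfolding raw_def by fastforce
qed

text \<open>The time is amortized, since one close parenthesis may emit a long path: each letter of
  the left output pays 20 units, everything else takes at most 60.\<close>

lemma wp_read_letter: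
  assumes \<sigma>: "\<sigma> \<in> dyck_strings {..<s}" "length \<sigma> = n" and k: "k < n" and sc: "scan \<sigma> k = (fs, gs)"
    and lay: "layout n \<sigma> k fs gs R M" and R1: "R 1 = k"
    and W: "10 * n + 10 \<le> W" "2 * s + 2 \<le> W" "2 * s * n \<le> W"
  shows "wp W read_letter (\<lambda>R' M' t'. (\<forall>fs' gs'. scan \<sigma> (Suc k) = (fs', gs') \<longrightarrow> layout n \<sigma> (Suc k) fs' gs' R' M') \<and>
    R' 1 = Suc k \<and> t' + 20 * R 3 \<le> t + 60 + 20 * R' 3) R M t"
    (is "wp W read_letter ?Q R M t")
proof -
  have r: "R 0 = n" "R 5 = 2 * n" "R 6 = 3 * n" "R 7 = 4 * n" "R 8 = 5 * n" "R 9 = 7 * n" "R 10 = 0" "R 11 = 1"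
    "R 12 = 2" and rg: "fixed_regs n R" using lay by (auto simp: layout_def fixed_regs_def)
  have c: "M k = paren_code (\<sigma> ! k)" and fresh: "M (2 * n + Suc k) = 0" "M (3 * n + Suc k) = 0" "M (4 * n + Suc k) = 0"
    and fr: "frames_at M n (R 2) fs" and di: "distinct (ids fs)" "set (ids fs) \<subseteq> {1..k}"
    and len: "R 3 = length (encode_left n 0 gs)" "R 4 = length (encode_right n 0 gs)"
    using lay k by (auto simp: layout_def)
  have pt: "parsed {..<s} (take k \<sigma>) fs (cost gs)" using \<sigma> k by (intro parsed_scan[OF _ _ sc]) auto
  have in_T: "\<sigma> ! k \<in> Open ` {..<s} \<union> Close ` {..<s}" using \<sigma> k by (auto simp: dyck_strings_def)
  show ?thesis
  proof (cases "\<sigma> ! k")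
    case (Open a)
    have a: "a < s" "M k = 2 * a" using in_T c Open by auto
    define M1 where "M1 = M(n + Suc k := 2 * a + 1, 5 * n + Suc k := R 2)"
    have "wp W read_letter (\<lambda>R' M' t'. M' = M1 \<and> R' 1 = Suc k \<and> R' 2 = Suc k \<and> t' \<le> t + 20 \<and>
      (\<forall>r. r \<notin> {1, 2, 13, 14, 17, 19} \<longrightarrow> R' r = R r)) R M t"
      using a r R1 k W by (auto simp: read_letter_def read_open_def M1_def)
    then show ?thesis
    proof (rule wp_mono)
      fix R' M' t'
      assume a1: "M' = M1 \<and> R' 1 = Suc k \<and> R' 2 = Suc k \<and> t' \<le> t + 20 \<and>
        (\<forall>r. r \<notin> {1, 2, 13, 14, 17, 19} \<longrightarrow> R' r = R r)"
      have "layout n \<sigma> (Suc k) ((Suc k, a, 0, []) # fs) gs R' M1"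
      proof (rule layout_update[OF lay k])
        show "fixed_regs n R'" using a1 rg by (auto simp: fixed_regs_def)
        show "M1 i = M i" if "i \<le> n \<or> 6 * n < i" for i using that k by (auto simp: M1_def)
        show "distinct (ids ((Suc k, a, 0, []) # fs))" "set (ids ((Suc k, a, 0, []) # fs)) \<subseteq> {1..Suc k}"
          using di by auto
        have "frames_at M1 n (R 2) fs = frames_at M n (R 2) fs"
        proof (rule frames_at_cong)
          fix i assume "i \<in> set (ids fs)"
          then have "0 < i" "i \<le> k" using di(2) by auto
          then show "M1 (n + i) = M (n + i) \<and> M1 (2 * n + i) = M (2 * n + i) \<and> M1 (3 * n + i) = M (3 * n + i) \<and>
            M1 (4 * n + i) = M (4 * n + i) \<and> M1 (5 * n + i) = M (5 * n + i)" using k by (auto simp: M1_def)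
        qed
        then show "frames_at M1 n (R' 2) ((Suc k, a, 0, []) # fs)"
          using a1 fr fresh k by (auto simp: M1_def)
      qed (use a1 k in \<open>auto simp: M1_def\<close>)
      then show "?Q R' M' t'" using a1 sc Open by auto
    qed
  next
    case cl: (Close b)
    have b: "b < s" "M k = 2 * b + 1" using in_T c cl by auto
    have pre: "wp W read_letter Q R M t" if "\<And>R' t'. R' 1 = Suc k \<Longrightarrow> R' 13 = 2 * b + 1 \<Longrightarrow> t' \<le> t + 8 \<Longrightarrow>
      \<forall>r. r \<notin> {1, 13, 14, 19} \<longrightarrow> R' r = R r \<Longrightarrow> wp W read_close Q R' M t'" for Q
      using b r R1 k W unfolding read_letter_def by (simp, intro that) auto
    show ?thesis
    proof (rule pre)
      fix R1 t1
      assume a1: "R1 1 = Suc k" "R1 13 = 2 * b + 1" "t1 \<le> t + 8" "\<forall>r. r \<notin> {1, 13, 14, 19} \<longrightarrow> R1 r = R r"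
      have r1: "R1 0 = n" "R1 10 = 0" "R1 11 = 1" "fixed_regs n R1" "R1 2 = R 2" "R1 3 = R 3" "R1 4 = R 4"
        using a1(4) r rg by (auto simp: fixed_regs_def)
      have lay1: "layout n \<sigma> k fs gs R1 M" using lay r1 unfolding layout_def by auto
      show "wp W read_close ?Q R1 M t1"
      proof (cases fs)
        case Nil
        then have R2: "R1 2 = 0" using fr r1 by simp
        define M1 where "M1 = M(n + Suc k := 2 * b + 1)"
        have lay2: "layout n \<sigma> (Suc k) [] gs (R1(17 := n + Suc k, 15 := Suc k)) M1" (is "layout _ _ _ _ _ ?R2 _")
          by (rule layout_update[OF lay1 k]) (use r1 R2 k in \<open>auto simp: M1_def fixed_regs_def\<close>)
        have "wp W emit (\<lambda>R' M' t'. layout n \<sigma> (Suc k) [] (gs @ [([b], [])]) R' M' \<and>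
          (\<forall>r. r \<notin> {3, 4, 15, 16, 17, 18} \<longrightarrow> R' r = ?R2 r) \<and> (\<forall>i. n \<le> i \<and> i < 7 * n \<longrightarrow> M' i = M1 i) \<and>
          R' 3 = ?R2 3 + length [b] \<and> t' \<le> (Suc (Suc (Suc (Suc (Suc t1))))) + 2 + 20 * length [b]) ?R2 M1 (Suc (Suc (Suc (Suc (Suc t1)))))"
        proof (rule wp_emit_layout[OF lay2, where p = "[(Suc k, 2 * b + 1, 0)]"])
          show "path_at M1 n (?R2 15) [(Suc k, 2 * b + 1, 0)]" using fresh k by (auto simp: M1_def)
          have "R 3 + R 4 \<le> k" using lay by (simp add: layout_def)
          then show "?R2 3 + length [b] + ?R2 4 + length [] \<le> Suc k" using r1 by simp
          have "(2 * b + 1) * n + n \<le> W" "n \<le> W"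
            using raw_word_bound[of "[(0, b, b)]" s n W] b W by auto
          then show "\<forall>(j, a, b)\<in>set [(Suc k, 2 * b + 1, 0)]. a * n + n \<le> W \<and> b * n + n \<le> W" by simp
        qed (use k W in \<open>auto simp: letters_left_def letters_right_def\<close>)
        then have "wp W emit ?Q ?R2 M1 (Suc (Suc (Suc (Suc (Suc t1)))))"
        proof (rule wp_mono)
          fix R' M' t'
          assume "layout n \<sigma> (Suc k) [] (gs @ [([b], [])]) R' M' \<and>
          (\<forall>r. r \<notin> {3, 4, 15, 16, 17, 18} \<longrightarrow> R' r = ?R2 r) \<and> (\<forall>i. n \<le> i \<and> i < 7 * n \<longrightarrow> M' i = M1 i) \<and>
          R' 3 = ?R2 3 + length [b] \<and> t' \<le> (Suc (Suc (Suc (Suc (Suc t1))))) + 2 + 20 * length [b]"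
          then show "?Q R' M' t'" using sc cl Nil a1 r1 by auto
        qed
        then show ?thesis using a1 r1 R2 k W
          by (simp add: read_close_def read_unmatched_close_def M1_def)
      next
        case (Cons f fs2)
        obtain j a w p where f: "f = (j, a, w, p)" by (cases f)
        obtain fs' q where at: "attach (if w = 0 \<and> a \<noteq> b then 1 else w) ((j, a, b) # p) fs2 = (fs', q)" by force
        have sc': "scan \<sigma> (Suc k) = (fs', gs @ [path_group q])" using sc cl Cons f at by simp
        have j: "R1 2 = j" "0 < j" using fr r1 Cons f di by auto
        have ty: "a < s" "set (map snd p) \<subseteq> {..<s} \<times> {..<s}"
          using parsed_types[OF pt, of j a w p] Cons f by auto
        have tn: "set (map snd ((j, a, b) # p)) \<subseteq> {..<s} \<times> {..<s}" using ty b by simp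
        have tq: "set (map snd q) \<subseteq> {..<s} \<times> {..<s}"
        proof (cases fs2)
          case Nil
          then have "q = (j, a, b) # p" using at by auto
          then show ?thesis using tn by blast
        next
          case (Cons f' fs3)
          obtain j' a' w' p' where f': "f' = (j', a', w', p')" by (cases f')
          have "set (map snd p') \<subseteq> {..<s} \<times> {..<s}"
            using parsed_types[OF pt, of j' a' w' p'] \<open>fs = f # fs2\<close> Cons f' by auto
          moreover have "q = p' \<or> q = (j, a, b) # p" using at Cons f' by (auto split: if_splits)
          ultimately show ?thesis using tn by blast
        qed
        have wt: "w + (\<Sum>f\<leftarrow>fs2. frame_weight f) \<le> n" using scan_sizes(2)[OF sc] Cons f k by simp
        have "wp W read_matched_close (\<lambda>R' M' t'. layout n \<sigma> (Suc k) fs' gs R' M' \<and> path_at M' n (R' 15) (raw q) \<and>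
          R' 1 = R1 1 \<and> R' 3 = R1 3 \<and> R' 4 = R1 4 \<and> t' \<le> Suc (Suc t1) + 28) R1 M (Suc (Suc t1))"
          by (rule wp_read_matched_close[OF lay1[unfolded Cons f] k a1(2) at W(1) _ _ wt]) (use ty b W in auto)
        then have "wp W read_matched_close (wp W emit ?Q) R1 M (Suc (Suc t1))"
        proof (rule wp_mono)
          fix R2 M2 t2
          assume a2: "layout n \<sigma> (Suc k) fs' gs R2 M2 \<and> path_at M2 n (R2 15) (raw q) \<and>
          R2 1 = R1 1 \<and> R2 3 = R1 3 \<and> R2 4 = R1 4 \<and> t2 \<le> Suc (Suc t1) + 28"
          let ?l = "fst (path_group q)" and ?r = "snd (path_group q)"
          have "wp W emit (\<lambda>R' M' t'. layout n \<sigma> (Suc k) fs' (gs @ [(?l, ?r)]) R' M' \<and>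
            (\<forall>r. r \<notin> {3, 4, 15, 16, 17, 18} \<longrightarrow> R' r = R2 r) \<and> (\<forall>i. n \<le> i \<and> i < 7 * n \<longrightarrow> M' i = M2 i) \<and>
            R' 3 = R2 3 + length ?l \<and> t' \<le> t2 + 2 + 20 * length ?l) R2 M2 t2"
          proof (rule wp_emit_layout[where p = "raw q"])
            have "length (encode_left n 0 gs) + length (encode_right n 0 gs) + length ?l + length ?r \<le> Suc k"
              using scan_sizes(1)[OF sc'] length_encode[of n 0 gs] by (simp add: path_group_def)
            then show "R2 3 + length ?l + R2 4 + length ?r \<le> Suc k" using a2 r1 len by simp
            show "\<forall>(j, a, b)\<in>set (raw q). a * n + n \<le> W \<and> b * n + n \<le> W"
              by (rule raw_word_bound[OF tq W(3)])
          qed (use a2 k W letters_raw in auto)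
          then show "wp W emit ?Q R2 M2 t2"
          proof (rule wp_mono)
            fix R' M' t'
            assume "layout n \<sigma> (Suc k) fs' (gs @ [(?l, ?r)]) R' M' \<and>
            (\<forall>r. r \<notin> {3, 4, 15, 16, 17, 18} \<longrightarrow> R' r = R2 r) \<and> (\<forall>i. n \<le> i \<and> i < 7 * n \<longrightarrow> M' i = M2 i) \<and>
            R' 3 = R2 3 + length ?l \<and> t' \<le> t2 + 2 + 20 * length ?l"
            then show "?Q R' M' t'" using sc' a1 a2 r1 by auto
          qed
        qed
        then show ?thesis using j r1 by (simp add: read_close_def)
      qed
    qed
  qed
qed

lemma drain_append: "drain (fs @ fs') = drain fs @ drain fs'"
  by (induction fs rule: drain.induct) auto

text \<open>Between the two calls of \<open>emit\<close> the stack is described with an empty path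
  in its top frame.\<close>

lemma wp_drain_frame:
  assumes lay: "layout n \<sigma> n ((j, a, w, p) # fs) gs R M"
    and size: "length (encode_left n 0 gs) + length (encode_right n 0 gs) + 1 + 2 * length p \<le> n"
    and ty: "a < s" "set (map snd p) \<subseteq> {..<s} \<times> {..<s}"
    and W: "10 * n + 10 \<le> W" "2 * s * n \<le> W"
  shows "wp W drain_frame (\<lambda>R' M' t'. layout n \<sigma> n fs (gs @ [path_group p, ([a], [])]) R' M' \<and>
    t' + 20 * R 3 \<le> t + 12 + 20 * R' 3) R M t"
    (is "wp W drain_frame ?Q R M t")
proof -
  have r: "R 0 = n" "R 6 = 3 * n" "R 8 = 5 * n" "R 10 = 0" "R 11 = 1" and rg: "fixed_regs n R"
    using lay by (auto simp: layout_def fixed_regs_def)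
  have j: "R 2 = j" "M (n + j) = 2 * a + 1" "M (2 * n + j) = 0" "path_at M n (M (3 * n + j)) (raw p)"
    "frames_at M n (M (5 * n + j)) fs" "0 < j" "j \<le> n"
    and di: "distinct (j # map fst p @ ids fs)" "set (j # map fst p @ ids fs) \<subseteq> {1..n}"
    and len: "R 3 = length (encode_left n 0 gs)" "R 4 = length (encode_right n 0 gs)"
    using lay by (auto simp: layout_def)
  define M1 where "M1 = M(3 * n + j := 0)"
  define R1 where "R1 = R(17 := 3 * n + j, 15 := M (3 * n + j))"
  have M1: "M1 (n + i) = M (n + i)" "M1 (2 * n + i) = M (2 * n + i)" "M1 (4 * n + i) = M (4 * n + i)"
    "M1 (5 * n + i) = M (5 * n + i)" "i \<noteq> j \<Longrightarrow> M1 (3 * n + i) = M (3 * n + i)" if "0 < i" "i \<le> n" for i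
    using that j by (auto simp: M1_def)
  have p1: "path_at M1 n q (raw p) = path_at M n q (raw p)" for q
  proof (rule path_at_cong)
    fix i assume "i \<in> fst ` set (raw p)"
    then have "i \<in> set (map fst p)" by (simp add: ids_raw)
    then have "i \<in> {1..n}" "i \<noteq> j" using di by auto
    then show "M1 (n + i) = M (n + i) \<and> M1 (2 * n + i) = M (2 * n + i) \<and> M1 (3 * n + i) = M (3 * n + i)"
      by (simp add: M1)
  qed
  have f1: "frames_at M1 n q fs = frames_at M n q fs" for q
  proof (rule frames_at_cong)
    fix i assume "i \<in> set (ids fs)"
    then have "i \<in> {1..n}" "i \<noteq> j" using di by auto
    then show "M1 (n + i) = M (n + i) \<and> M1 (2 * n + i) = M (2 * n + i) \<and> M1 (3 * n + i) = M (3 * n + i) \<and>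
      M1 (4 * n + i) = M (4 * n + i) \<and> M1 (5 * n + i) = M (5 * n + i)" by (simp add: M1)
  qed
  have fr1: "frames_at M1 n j ((j, a, w, []) # fs)"
    using lay M1[of j] f1 j by (auto simp: layout_def M1_def)
  have o1: "M1 i = M i" if "i < n \<or> 7 * n \<le> i" for i using that j by (auto simp: M1_def)
  have lay1: "layout n \<sigma> n ((j, a, w, []) # fs) gs R1 M1"
    using lay fr1 o1 di j unfolding layout_def by (auto simp: R1_def fixed_regs_def)
  let ?l = "fst (path_group p)" and ?r = "snd (path_group p)"
  have e1: "wp W emit (\<lambda>R' M' t'. layout n \<sigma> n ((j, a, w, []) # fs) (gs @ [(?l, ?r)]) R' M' \<and>
      (\<forall>r. r \<notin> {3, 4, 15, 16, 17, 18} \<longrightarrow> R' r = R1 r) \<and> (\<forall>i. n \<le> i \<and> i < 7 * n \<longrightarrow> M' i = M1 i) \<and>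
      R' 3 = R1 3 + length ?l \<and> t' \<le> Suc (Suc (Suc t)) + 2 + 20 * length ?l) R1 M1 (Suc (Suc (Suc t)))"
  proof (rule wp_emit_layout[OF lay1 order_refl, where p = "raw p"])
    show "path_at M1 n (R1 15) (raw p)" using j p1 by (simp add: R1_def)
    show "R1 3 + length ?l + R1 4 + length ?r \<le> n" using size len by (simp add: R1_def path_group_def)
    show "\<forall>(j, a, b)\<in>set (raw p). a * n + n \<le> W \<and> b * n + n \<le> W" by (rule raw_word_bound[OF ty(2) W(2)])
  qed (use W letters_raw in auto)
  have "wp W emit (wp W (Prim (Add 15 2 10) ;; emit ;; block [Add 17 8 2, Load 2 17]) ?Q) R1 M1 (Suc (Suc (Suc t)))"
  proof (rule wp_mono[OF e1])
    fix R2 M2 t2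
    assume a2: "layout n \<sigma> n ((j, a, w, []) # fs) (gs @ [(?l, ?r)]) R2 M2 \<and>
      (\<forall>r. r \<notin> {3, 4, 15, 16, 17, 18} \<longrightarrow> R2 r = R1 r) \<and> (\<forall>i. n \<le> i \<and> i < 7 * n \<longrightarrow> M2 i = M1 i) \<and>
      R2 3 = R1 3 + length ?l \<and> t2 \<le> Suc (Suc (Suc t)) + 2 + 20 * length ?l"
    define R3 where "R3 = R2(15 := j)"
    have R2: "R2 2 = j" "R2 3 = R 3 + length p" "R2 4 = R 4 + length p" "R2 8 = 5 * n" "R2 10 = 0"
    proof -
      show "R2 2 = j" "R2 3 = R 3 + length p" "R2 8 = 5 * n" "R2 10 = 0"
        using a2 j r by (auto simp: R1_def path_group_def)
      have "R2 4 = length (encode_right n 0 (gs @ [(?l, ?r)]))" using a2 by (simp add: layout_def)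
      then show "R2 4 = R 4 + length p" using len by (simp add: encode_right_append path_group_def)
    qed
    have lay3: "layout n \<sigma> n ((j, a, w, []) # fs) (gs @ [(?l, ?r)]) R3 M2"
      using a2 unfolding layout_def by (auto simp: R3_def fixed_regs_def)
    have M2: "M2 (n + j) = 2 * a + 1" "M2 (2 * n + j) = 0" "M2 (3 * n + j) = 0" "frames_at M2 n (M2 (5 * n + j)) fs"
      using lay3 by (auto simp: layout_def)
    have e2: "wp W emit (\<lambda>R' M' t'. layout n \<sigma> n ((j, a, w, []) # fs) ((gs @ [(?l, ?r)]) @ [([a], [])]) R' M' \<and>
      (\<forall>r. r \<notin> {3, 4, 15, 16, 17, 18} \<longrightarrow> R' r = R3 r) \<and> (\<forall>i. n \<le> i \<and> i < 7 * n \<longrightarrow> M' i = M2 i) \<and>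
      R' 3 = R3 3 + length [a] \<and> t' \<le> Suc t2 + 2 + 20 * length [a]) R3 M2 (Suc t2)"
    proof (rule wp_emit_layout[OF lay3 order_refl, where p = "[(j, 2 * a + 1, 0)]"])
      show "path_at M2 n (R3 15) [(j, 2 * a + 1, 0)]" using M2 j by (simp add: R3_def)
      show "R3 3 + length [a] + R3 4 + length [] \<le> n" using size len R2 by (simp add: R3_def)
      have "(2 * a + 1) * n + n \<le> W" "n \<le> W"
        using raw_word_bound[of "[(0, a, a)]" s n W] ty W by auto
      then show "\<forall>(j, a, b)\<in>set [(j, 2 * a + 1, 0)]. a * n + n \<le> W \<and> b * n + n \<le> W" by simp
    qed (use W in \<open>auto simp: letters_left_def letters_right_def\<close>)
    have "wp W emit (wp W (block [Add 17 8 2, Load 2 17]) ?Q) R3 M2 (Suc t2)"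
    proof (rule wp_mono[OF e2])
      fix R4 M4 t4
      assume a4: "layout n \<sigma> n ((j, a, w, []) # fs) ((gs @ [(?l, ?r)]) @ [([a], [])]) R4 M4 \<and>
        (\<forall>r. r \<notin> {3, 4, 15, 16, 17, 18} \<longrightarrow> R4 r = R3 r) \<and> (\<forall>i. n \<le> i \<and> i < 7 * n \<longrightarrow> M4 i = M2 i) \<and>
        R4 3 = R3 3 + length [a] \<and> t4 \<le> Suc t2 + 2 + 20 * length [a]"
      have r4: "R4 2 = j" "R4 8 = 5 * n" using a4 R2 by (auto simp: R3_def)
      have l4: "layout n \<sigma> n fs (gs @ [path_group p, ([a], [])]) (R4(17 := 5 * n + j, 2 := M4 (5 * n + j))) M4"
        using a4 r4 unfolding layout_def by (auto simp: fixed_regs_def)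
      show "wp W (block [Add 17 8 2, Load 2 17]) ?Q R4 M4 t4"
        using l4 r4 a4 a2 R2 W j by (auto simp: R3_def R1_def path_group_def)
    qed
    then show "wp W (Prim (Add 15 2 10) ;; emit ;; block [Add 17 8 2, Load 2 17]) ?Q R2 M2 t2"
      using R2 W j by (simp add: R3_def)
  qed
  then show ?thesis using r j W by (simp add: drain_frame_def R1_def M1_def)
qed

text \<open>At most \<open>n\<close> frames cost 13 units each, and at most \<open>n\<close> left
  letters 20 units each.\<close>

lemma wp_drain:
  assumes lay: "layout n \<sigma> n fs gs R M"
    and size: "length (encode_left n 0 gs) + length (encode_right n 0 gs) + (\<Sum>f\<leftarrow>fs. frame_size f) = n"
    and ty: "\<And>j a w p. (j, a, w, p) \<in> set fs \<Longrightarrow> a < s \<and> set (map snd p) \<subseteq> {..<s} \<times> {..<s}"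
    and W: "10 * n + 10 \<le> W" "2 * s * n \<le> W"
  shows "wp W (Unless 2 11 (Repeat drain_frame 10 2)) (\<lambda>R' M' t'. layout n \<sigma> n [] (gs @ drain fs) R' M' \<and>
    t' \<le> t + 1 + 33 * n) R M t"
proof (cases "fs = []")
  case True
  then have "R 2 = 0" "R 11 = 1" using lay by (auto simp: layout_def fixed_regs_def)
  then show ?thesis using lay True by simp
next
  case False
  define I where "I m R' M' t' \<longleftrightarrow> layout n \<sigma> n (drop m fs) (gs @ drain (take m fs)) R' M' \<and>
    t' \<le> Suc t + 13 * m + 20 * R' 3" for m R' M' and t' :: nat
  have pos: "0 < R' 2 \<longleftrightarrow> fs' \<noteq> []" if "layout n \<sigma> n fs' gs' R' M'" for fs' gs' R' M'
    using that by (cases fs') (auto simp: layout_def)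
  have "length fs \<le> (\<Sum>f\<leftarrow>fs. frame_size f)" by (induction fs) auto
  then have fn: "length fs \<le> n" using size by simp
  have "wp W (Repeat drain_frame 10 2) (I (length fs)) R M (Suc t)"
  proof (rule wp_Repeat_upto[where k = 0])
    fix m R1 M1 t1
    assume m: "m < length fs" and i: "I m R1 M1 t1"
    obtain j a w p where f: "fs ! m = (j, a, w, p)" by (cases "fs ! m")
    have d: "drop m fs = (j, a, w, p) # drop (Suc m) fs" using Cons_nth_drop_Suc[OF m] f by simp
    have tk: "drain (take (Suc m) fs) = drain (take m fs) @ [path_group p, ([a], [])]"
      using m f by (simp add: take_Suc_conv_app_nth drain_append)
    let ?gs = "gs @ drain (take m fs)"
    have "length (encode_left n 0 ?gs) + length (encode_right n 0 ?gs)
      = (\<Sum>x\<leftarrow>gs. group_size x) + (\<Sum>f\<leftarrow>take m fs. frame_size f)"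
      unfolding length_encode using drain_sizes(1) by simp
    also have "(\<Sum>x\<leftarrow>gs. group_size x) = length (encode_left n 0 gs) + length (encode_right n 0 gs)"
      by (simp add: length_encode)
    finally have "length (encode_left n 0 ?gs) + length (encode_right n 0 ?gs)
      = length (encode_left n 0 gs) + length (encode_right n 0 gs) + (\<Sum>f\<leftarrow>take m fs. frame_size f)" .
    moreover have "(\<Sum>f\<leftarrow>fs. frame_size f) = (\<Sum>f\<leftarrow>take m fs. frame_size f) + (\<Sum>f\<leftarrow>drop m fs. frame_size f)"
      by (metis append_take_drop_id map_append sum_list_append)
    ultimately have sz: "length (encode_left n 0 ?gs) + length (encode_right n 0 ?gs) + 1 + 2 * length p \<le> n"
      using size d by simp
    have "(j, a, w, p) \<in> set fs" using f m by (metis nth_mem)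
    note ty' = ty[OF this]
    have "layout n \<sigma> n ((j, a, w, p) # drop (Suc m) fs) ?gs R1 M1" using i d by (simp add: I_def)
    from wp_drain_frame[OF this sz conjunct1[OF ty'] conjunct2[OF ty'] W]
    show "wp W drain_frame (\<lambda>R M t. I (Suc m) R M (Suc t) \<and> (R 10 < R 2 \<longleftrightarrow> Suc m < length fs)) R1 M1 t1"
    proof (rule wp_mono)
      fix R2 M2 t2
      assume a: "layout n \<sigma> n (drop (Suc m) fs) (?gs @ [path_group p, ([a], [])]) R2 M2 \<and> t2 + 20 * R1 3 \<le> t1 + 12 + 20 * R2 3"
      then have "R2 10 = 0" by (simp add: layout_def fixed_regs_def)
      then show "I (Suc m) R2 M2 (Suc t2) \<and> (R2 10 < R2 2 \<longleftrightarrow> Suc m < length fs)"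
        using a i tk pos[OF conjunct1[OF a]] by (simp add: I_def not_le)
    qed
  qed (use False lay in \<open>auto simp: I_def\<close>)
  then have "wp W (Repeat drain_frame 10 2) (\<lambda>R' M' t'. layout n \<sigma> n [] (gs @ drain fs) R' M' \<and>
    t' \<le> t + 1 + 33 * n) R M (Suc t)"
  proof (rule wp_mono)
    fix R' M' t'
    assume a: "I (length fs) R' M' t'"
    then have "R' 3 \<le> n" by (auto simp: I_def layout_def)
    then show "layout n \<sigma> n [] (gs @ drain fs) R' M' \<and> t' \<le> t + 1 + 33 * n" using a fn by (simp add: I_def)
  qed
  moreover have "0 < R 2" "R 11 = 1" using pos[OF lay] False lay by (auto simp: layout_def fixed_regs_def)
  ultimately show ?thesis by simp
qed

lemma wp_copy:
  assumes lay: "layout n \<sigma> n [] gs R M" and xy: "x = encode_left n 0 gs" "y = encode_right n 0 gs"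
    and n: "length x + length y = n" and W: "10 * n + 10 \<le> W"
  shows "wp W (Prim (Const 14 0) ;;
      Unless 4 11 (Repeat (block [Add 17 9 14, Load 18 17, Add 19 3 14, Store 19 18, Add 14 14 11]) 14 4))
    (\<lambda>R' M' t'. fixed_regs n R' \<and> R' 3 = length x \<and> R' 4 = length y \<and> (\<forall>i<n. M' i = (x @ y) ! i) \<and>
      (\<forall>i\<ge>8 * n. M' i = 0) \<and> t' \<le> t + 2 + 6 * n) R M t"
proof -
  have rg: "fixed_regs n R" "R 3 = length x" "R 4 = length y" "R 11 = 1"
    and M: "\<forall>i<length x. M i = x ! i" "\<forall>i<length y. M (7 * n + i) = y ! i" "\<forall>i\<ge>8 * n. M i = 0"
    using lay xy by (auto simp: layout_def fixed_regs_def)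
  define I where "I m R' M' t' \<longleftrightarrow> fixed_regs n R' \<and> R' 3 = length x \<and> R' 4 = length y \<and> R' 14 = m \<and>
    (\<forall>i<length x + m. M' i = (x @ y) ! i) \<and> (\<forall>i<length y. M' (7 * n + i) = y ! i) \<and>
    (\<forall>i\<ge>8 * n. M' i = 0) \<and> t' \<le> t + 2 + 6 * m" for m R' M' and t' :: nat
  have I0: "I 0 (R(14 := 0)) M (Suc (Suc t))" using rg M by (auto simp: I_def fixed_regs_def nth_append)
  show ?thesis
  proof (cases "length y = 0")
    case True
    with rg I0 n W show ?thesis by (auto simp: I_def)
  next
    case False
    have "wp W (Repeat (block [Add 17 9 14, Load 18 17, Add 19 3 14, Store 19 18, Add 14 14 11]) 14 4)
      (I (length y)) (R(14 := 0)) M (Suc (Suc t))"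
    proof (rule wp_Repeat_upto[where k = 0])
      show "I 0 (R(14 := 0)) M (Suc (Suc t))" by (rule I0)
    next
      fix m R1 M1 t1
      assume m: "m < length y" and i: "I m R1 M1 t1"
      have r: "R1 9 = 7 * n" "R1 3 = length x" "R1 4 = length y" "R1 14 = m" "R1 11 = 1" "fixed_regs n R1"
        using i by (auto simp: I_def fixed_regs_def)
      have "M1 (7 * n + m) = y ! m" using i m by (auto simp: I_def)
      moreover have "(x @ y) ! (length x + m) = y ! m" by simp
      ultimately have I': "I (Suc m) (R1(17 := 7 * n + m, 18 := M1 (7 * n + m), 19 := length x + m, 14 := Suc m))
        (M1(length x + m := M1 (7 * n + m))) (Suc (Suc (Suc (Suc (Suc (Suc t1))))))"
        using i m n r unfolding I_def by (auto simp: fixed_regs_def less_Suc_eq)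
      show "wp W (block [Add 17 9 14, Load 18 17, Add 19 3 14, Store 19 18, Add 14 14 11])
        (\<lambda>R M t. I (Suc m) R M (Suc t) \<and> (R 14 < R 4 \<longleftrightarrow> Suc m < length y)) R1 M1 t1"
        using r m n W I' by simp
    qed (use False in simp)
    then have "wp W (Repeat (block [Add 17 9 14, Load 18 17, Add 19 3 14, Store 19 18, Add 14 14 11]) 14 4)
      (\<lambda>R' M' t'. fixed_regs n R' \<and> R' 3 = length x \<and> R' 4 = length y \<and> (\<forall>i<n. M' i = (x @ y) ! i) \<and>
      (\<forall>i\<ge>8 * n. M' i = 0) \<and> t' \<le> t + 2 + 6 * n) (R(14 := 0)) M (Suc (Suc t))"
      by (rule wp_mono) (use n in \<open>auto simp: I_def\<close>)
    then show ?thesis using False rg W by simp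
  qed
qed

text \<open>The \<open>7 * n\<close> cells between the output and address \<open>8 * n\<close> are
  cleared at 3 units each; the cells beyond have never been used.\<close>

lemma wp_clean:
  assumes rg: "fixed_regs n R" "0 < n" and M: "\<forall>i<n. M i = z ! i" "\<forall>i\<ge>8 * n. M i = 0" and W: "10 * n + 10 \<le> W"
  shows "wp W (block [Add 14 0 10, Add 15 9 0] ;; Repeat (block [Store 14 10, Add 14 14 11]) 14 15)
    (\<lambda>R' M' t'. fixed_regs n R' \<and> R' 3 = R 3 \<and> R' 4 = R 4 \<and> (\<forall>i<n. M' i = z ! i) \<and> (\<forall>i\<ge>n. M' i = 0) \<and>
      t' \<le> t + 2 + 21 * n) R M t"
proof -
  have r: "R 0 = n" "R 9 = 7 * n" "R 10 = 0" using rg by (auto simp: fixed_regs_def)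
  define I where "I m R' M' t' \<longleftrightarrow> fixed_regs n R' \<and> R' 3 = R 3 \<and> R' 4 = R 4 \<and> R' 14 = n + m \<and> R' 15 = 8 * n \<and>
    (\<forall>i<n. M' i = z ! i) \<and> (\<forall>i. n \<le> i \<and> i < n + m \<longrightarrow> M' i = 0) \<and> (\<forall>i\<ge>8 * n. M' i = 0) \<and>
    t' \<le> t + 2 + 3 * m" for m R' M' and t' :: nat
  have "wp W (Repeat (block [Store 14 10, Add 14 14 11]) 14 15) (I (7 * n)) (R(14 := n, 15 := 8 * n)) M (Suc (Suc t))"
  proof (rule wp_Repeat_upto[where k = 0])
    show "I 0 (R(14 := n, 15 := 8 * n)) M (Suc (Suc t))" using rg M by (auto simp: I_def fixed_regs_def)
  next
    fix m R1 M1 t1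
    assume m: "m < 7 * n" and i: "I m R1 M1 t1"
    have r: "R1 10 = 0" "R1 14 = n + m" "R1 11 = 1" "R1 15 = 8 * n" using i by (auto simp: I_def fixed_regs_def)
    have "I (Suc m) (R1(14 := Suc (n + m))) (M1(n + m := 0)) (Suc (Suc (Suc t1)))"
      using i m unfolding I_def by (auto simp: fixed_regs_def less_Suc_eq)
    then show "wp W (block [Store 14 10, Add 14 14 11])
      (\<lambda>R M t. I (Suc m) R M (Suc t) \<and> (R 14 < R 15 \<longleftrightarrow> Suc m < 7 * n)) R1 M1 t1"
      using r m W by auto
  qed (use rg in simp)
  then have "wp W (Repeat (block [Store 14 10, Add 14 14 11]) 14 15)
    (\<lambda>R' M' t'. fixed_regs n R' \<and> R' 3 = R 3 \<and> R' 4 = R 4 \<and> (\<forall>i<n. M' i = z ! i) \<and> (\<forall>i\<ge>n. M' i = 0) \<and>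
      t' \<le> t + 2 + 21 * n) (R(14 := n, 15 := 8 * n)) M (Suc (Suc t))"
  proof (rule wp_mono)
    fix R' M' t'
    assume a: "I (7 * n) R' M' t'"
    have "M' i = 0" if "n \<le> i" for i using a that by (cases "i < 8 * n") (auto simp: I_def)
    with a show "fixed_regs n R' \<and> R' 3 = R 3 \<and> R' 4 = R 4 \<and> (\<forall>i<n. M' i = z ! i) \<and> (\<forall>i\<ge>n. M' i = 0) \<and>
      t' \<le> t + 2 + 21 * n" by (simp add: I_def)
  qed
  then show ?thesis using r W by simp
qed

text \<open>The final store equals the \<open>start\<close> state for the pair \<open>x\<close>,
  \<open>y\<close>. The stages have cumulative time bounds from \<open>100 * n\<close> to
  \<open>200 * n\<close>; \<open>0 < n\<close> absorbs their additive constants.\<close>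

lemma wp_preprocess:
  assumes \<sigma>: "\<sigma> \<in> dyck_strings {..<s}" "length \<sigma> = n" "0 < n"
    and xy: "x = encode_left n 0 (groups \<sigma>)" "y = encode_right n 0 (groups \<sigma>)"
    and R0: "R0 = (\<lambda>i. if i < 1 then [n] ! i else 0)"
    and M0: "M0 = (\<lambda>i. if i < n then map paren_code \<sigma> ! i else 0)"
    and W: "10 * n + 10 \<le> W" "2 * s + 2 \<le> W" "2 * s * n \<le> W"
  shows "wp W preprocess (\<lambda>R M t. R = (\<lambda>i. if i < 2 then [length x, length y] ! i else 0) \<and>
    M = (\<lambda>i. if i < n then (x @ y) ! i else 0) \<and> t \<le> 200 * n) R0 M0 0"
proof -
  define A where "A = block [Const 10 0, Const 11 1, Const 12 2, Add 5 0 0, Add 6 5 0, Add 7 5 5, Add 8 7 0, Add 9 7 6]"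
  define B where "B = Repeat read_letter 1 0"
  define C where "C = Unless 2 11 (Repeat drain_frame 10 2)"
  define D where "D = Prim (Const 14 0) ;;
     Unless 4 11 (Repeat (block [Add 17 9 14, Load 18 17, Add 19 3 14, Store 19 18, Add 14 14 11]) 14 4)"
  define E where "E = block [Add 14 0 10, Add 15 9 0] ;; Repeat (block [Store 14 10, Add 14 14 11]) 14 15"
  define F where "F = block [Add 0 3 10, Add 1 4 10, Const 2 0, Const 3 0, Const 4 0, Const 5 0, Const 6 0, Const 7 0,
       Const 8 0, Const 9 0, Const 10 0, Const 11 0, Const 12 0, Const 13 0, Const 14 0, Const 15 0,
       Const 16 0, Const 17 0, Const 18 0, Const 19 0, Const 20 0]"
  have split: "wp W preprocess Q R M t = wp W A (wp W B (wp W C (wp W D (wp W E (wp W F Q))))) R M t" for Q R M t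
  proof -
    have "wp W (c ;; c') Q = wp W c (wp W c' Q)" for c c' Q by (intro ext) (rule wp_Seq)
    then show ?thesis unfolding preprocess_def A_def B_def C_def D_def E_def F_def by (simp only:)
  qed
  let ?Q = "\<lambda>R M t. R = (\<lambda>i. if i < 2 then [length x, length y] ! i else 0) \<and>
    M = (\<lambda>i. if i < n then (x @ y) ! i else 0) \<and> t \<le> 200 * n"
  have lxy: "length x + length y = n" using groups_sizes(1)[of \<sigma>] \<sigma> xy length_encode[of n 0 "groups \<sigma>"] by simp
  have F: "wp W F ?Q R M t" if "fixed_regs n R" "R 3 = length x" "R 4 = length y" "\<forall>i<n. M i = (x @ y) ! i"
    "\<forall>i\<ge>n. M i = 0" "t \<le> 200 * n - 21" for R M t
  proof -
    have "wp W F (\<lambda>R' M' t'. R' 0 = length x \<and> R' 1 = length y \<and> (\<forall>r. 2 \<le> r \<and> r \<le> 20 \<longrightarrow> R' r = 0) \<and>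
      (\<forall>r>20. R' r = R r) \<and> M' = M \<and> t' = t + 21) R M t"
    proof -
      have r: "R 10 = 0" "length x < W" "length y < W" "2 < W" using that(1) lxy W by (auto simp: fixed_regs_def)
      have le: "r \<le> 20 \<longleftrightarrow> r \<in> {0,1,2,3,4,5,6,7,8,9,10,11,12,13,14,15,16,17,18,19,20}" for r :: nat
        by (auto simp: le_Suc_eq numeral_eq_Suc)
      show ?thesis using r that(2,3) by (auto simp: F_def le)
    qed
    then show ?thesis
    proof (rule wp_mono)
      fix R' M' t'
      assume a: "R' 0 = length x \<and> R' 1 = length y \<and> (\<forall>r. 2 \<le> r \<and> r \<le> 20 \<longrightarrow> R' r = 0) \<and>
      (\<forall>r>20. R' r = R r) \<and> M' = M \<and> t' = t + 21"
      have "R' r = (if r < 2 then [length x, length y] ! r else 0)" for r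
      proof -
        consider "r = 0" | "r = 1" | "2 \<le> r" "r \<le> 20" | "20 < r" by linarith
        then show ?thesis using a that(1) by cases (auto simp: fixed_regs_def)
      qed
      moreover have "M' i = (if i < n then (x @ y) ! i else 0)" for i using a that by simp
      ultimately show "?Q R' M' t'" using a that(6) \<sigma>(3) by auto
    qed
  qed
  have E: "wp W E (wp W F ?Q) R M t" if "fixed_regs n R" "R 3 = length x" "R 4 = length y" "\<forall>i<n. M i = (x @ y) ! i"
    "\<forall>i\<ge>8 * n. M i = 0" "t \<le> 150 * n" for R M t
    unfolding E_def
    by (rule wp_mono[OF wp_clean[OF that(1) \<sigma>(3) that(4,5) W(1)]]) (rule F; use that \<sigma>(3) in auto)
  have D: "wp W D (wp W E (wp W F ?Q)) R M t" if "layout n \<sigma> n [] (groups \<sigma>) R M" "t \<le> 140 * n" for R M t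
    unfolding D_def
    by (rule wp_mono[OF wp_copy[OF that(1) xy lxy W(1)]]) (rule E; use that \<sigma>(3) in auto)
  obtain fs gs where sc: "scan \<sigma> n = (fs, gs)" by force
  have gr: "groups \<sigma> = gs @ drain fs" using sc \<sigma> by (simp add: groups_def)
  have C: "wp W C (wp W D (wp W E (wp W F ?Q))) R M t" if "layout n \<sigma> n fs gs R M" "t \<le> 100 * n" for R M t
  proof -
    have "a < s \<and> set (map snd p) \<subseteq> {..<s} \<times> {..<s}" if "(j, a, w, p) \<in> set fs" for j a w p
      using parsed_types[OF parsed_scan[OF \<sigma>(1) _ sc] that] \<sigma>(2) by simp
    moreover have "length (encode_left n 0 gs) + length (encode_right n 0 gs) + (\<Sum>f\<leftarrow>fs. frame_size f) = n"
      using scan_sizes(1)[OF sc] length_encode[of n 0 gs] by simp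
    ultimately have "wp W C (\<lambda>R' M' t'. layout n \<sigma> n [] (gs @ drain fs) R' M' \<and> t' \<le> t + 1 + 33 * n) R M t"
      unfolding C_def using W by (intro wp_drain[OF that(1)]) auto
    then show ?thesis
      by (rule wp_mono) (rule D; use gr that \<sigma>(3) in auto)
  qed
  \<comment> \<open>8 units set up the constants, and 61 is the bound 60 for one letter plus the
    loop test.\<close>
  define I where "I k R M t \<longleftrightarrow> (\<forall>fs gs. scan \<sigma> k = (fs, gs) \<longrightarrow> layout n \<sigma> k fs gs R M) \<and> R 1 = k \<and>
    t \<le> 8 + 61 * k + 20 * R 3" for k R M and t :: nat
  have B: "wp W B (wp W C (wp W D (wp W E (wp W F ?Q)))) R M t" if "I 0 R M t" for R M t
  proof -
    have "wp W B (I n) R M t"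
      unfolding B_def
    proof (rule wp_Repeat_upto[where k = 0])
      fix k R M t
      assume k: "k < n" and i: "I k R M t"
      obtain fs gs where sk: "scan \<sigma> k = (fs, gs)" by force
      have lay: "layout n \<sigma> k fs gs R M" "R 1 = k" using i sk by (auto simp: I_def)
      show "wp W read_letter (\<lambda>R M t. I (Suc k) R M (Suc t) \<and> (R 1 < R 0 \<longleftrightarrow> Suc k < n)) R M t"
      proof (rule wp_mono[OF wp_read_letter[OF \<sigma>(1,2) k sk lay W]])
        fix R' M' t'
        assume a: "(\<forall>fs' gs'. scan \<sigma> (Suc k) = (fs', gs') \<longrightarrow> layout n \<sigma> (Suc k) fs' gs' R' M') \<and>
          R' 1 = Suc k \<and> t' + 20 * R 3 \<le> t + 60 + 20 * R' 3"
        obtain fs' gs' where "scan \<sigma> (Suc k) = (fs', gs')" by force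
        then have "R' 0 = n" using a by (auto simp: layout_def fixed_regs_def)
        then show "I (Suc k) R' M' (Suc t') \<and> (R' 1 < R' 0 \<longleftrightarrow> Suc k < n)"
          using a i by (auto simp: I_def)
      qed
    qed (use that \<sigma>(3) in auto)
    then show ?thesis
    proof (rule wp_mono)
      fix R M t
      assume i: "I n R M t"
      have lay: "layout n \<sigma> n fs gs R M" using i sc by (auto simp: I_def)
      then have "R 3 \<le> n" by (auto simp: layout_def)
      then show "wp W C (wp W D (wp W E (wp W F ?Q))) R M t"
        using i \<sigma>(3) by (intro C[OF lay]) (auto simp: I_def)
    qed
  qed
  have "wp W A (I 0) R0 M0 0"
    using W \<sigma> by (auto simp: A_def R0 M0 I_def layout_def fixed_regs_def)
  then show ?thesis unfolding split by (rule wp_mono) (rule B)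
qed

section \<open>Word sizes and the combined program\<close>

lemma encode_bounds:
  assumes "\<forall>(l, r)\<in>set gs. length r \<le> length l \<and> set l \<subseteq> {..<s} \<and> set r \<subseteq> {..<s}"
    and "g + length (encode_left n g gs) \<le> n"
  shows "set (encode_left n g gs) \<union> set (encode_right n g gs) \<subseteq> {..<2 * s * n}"
  using assms
proof (induction n g gs rule: encode_left.induct)
  case (2 n g l r gs)
  show ?case
  proof (cases "l = []")
    case True
    with 2 show ?thesis by auto
  next
    case False
    with 2(3) have "g < n" by (cases l) auto
    have *: "(2 * a + 1) * n + g < 2 * s * n" if "a < s" for a
    proof -
      have "(2 * a + 2) * n \<le> (2 * s) * n" using that by (intro mult_right_mono) auto
      then show ?thesis using \<open>g < n\<close> by (simp add: algebra_simps)
    qed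
    have "set (encode_left n (g + length l) gs) \<union> set (encode_right n (g + length l) gs) \<subseteq> {..<2 * s * n}"
      using 2 by auto
    moreover have "\<forall>a\<in>set l \<union> set r. a < s" using 2(2) by auto
    ultimately show ?thesis using * by auto
  qed
qed simp

lemma scan_types:
  assumes "\<sigma> \<in> dyck_strings T" "k \<le> length \<sigma>" "scan \<sigma> k = (fs, gs)"
  shows "\<forall>(l, r)\<in>set gs. set l \<subseteq> T \<and> set r \<subseteq> T"
  using assms(2,3)
proof (induction k arbitrary: fs gs)
  case (Suc k)
  obtain fs1 gs1 where s: "scan \<sigma> k = (fs1, gs1)" by force
  have IH: "\<forall>(l, r)\<in>set gs1. set l \<subseteq> T \<and> set r \<subseteq> T" using Suc s by simp
  have in_T: "\<sigma> ! k \<in> Open ` T \<union> Close ` T" using assms(1) Suc.prems(1) by (auto simp: dyck_strings_def)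
  have pt: "parsed T (take k \<sigma>) fs1 (cost gs1)" using assms(1) Suc.prems(1) by (intro parsed_scan[OF _ _ s]) auto
  have grp: "set (fst (path_group p)) \<subseteq> T \<and> set (snd (path_group p)) \<subseteq> T" if "set (map snd p) \<subseteq> T \<times> T" for p :: "'a node list"
    using that by (force simp: path_group_def)
  show ?case
  proof (cases "\<sigma> ! k")
    case (Open a)
    then show ?thesis using IH Suc.prems s by auto
  next
    case c: (Close b)
    have b: "b \<in> T" using in_T c by auto
    show ?thesis
    proof (cases fs1)
      case Nil
      then have "gs = gs1 @ [([b], [])]" using Suc.prems s c by simp
      then show ?thesis using IH b by simp
    next
      case (Cons f fs2)
      obtain j a w p where f: "f = (j, a, w, p)" by (cases f)
      obtain fs' q where at: "attach (if w = 0 \<and> a \<noteq> b then 1 else w) ((j, a, b) # p) fs2 = (fs', q)" by force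
      have gs: "gs = gs1 @ [path_group q]" using Suc.prems s c Cons f at by simp
      have "a \<in> T" "set (map snd p) \<subseteq> T \<times> T" using parsed_types[OF pt, of j a w p] Cons f by auto
      then have n: "set (map snd ((j, a, b) # p)) \<subseteq> T \<times> T" using b by simp
      have "set (map snd q) \<subseteq> T \<times> T"
      proof (cases fs2)
        case Nil
        then show ?thesis using at n by auto
      next
        case (Cons f' fs3)
        obtain j' a' w' p' where f': "f' = (j', a', w', p')" by (cases f')
        have "set (map snd p') \<subseteq> T \<times> T"
          using parsed_types[OF pt, of j' a' w' p'] \<open>fs1 = f # fs2\<close> Cons f' by auto
        moreover have "q = p' \<or> q = (j, a, b) # p" using at Cons f' by (auto split: if_splits)
        ultimately show ?thesis using n by blast
      qed
      from grp[OF this] show ?thesis using IH by (simp add: gs case_prod_beta)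
    qed
  qed
qed simp

lemma drain_types:
  assumes "parsed T \<sigma> fs g"
  shows "\<forall>(l, r)\<in>set (drain fs). set l \<subseteq> T \<and> set r \<subseteq> T"
  using assms
proof induction
  case (push \<sigma> fs g f w p h a i)
  have "set (map snd p) \<subseteq> T \<times> T" by (rule summary_path[OF push(2)])
  then have "set (fst (path_group p)) \<subseteq> T \<and> set (snd (path_group p)) \<subseteq> T" by (force simp: path_group_def)
  then show ?case using push by (auto split: prod.splits)
qed simp

lemma groups_types:
  assumes "\<sigma> \<in> dyck_strings T"
  shows "\<forall>(l, r)\<in>set (groups \<sigma>). set l \<subseteq> T \<and> set r \<subseteq> T"
proof -
  obtain fs gs where s: "scan \<sigma> (length \<sigma>) = (fs, gs)" by force
  show ?thesis
    using scan_types[OF assms order_refl s] drain_types[OF parsed_scan[OF assms order_refl s]]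
    by (auto simp: groups_def s)
qed

definition reduction :: "instr list \<Rightarrow> instr list" where
  "reduction P = compile 0 preprocess @ relocate (length (compile 0 preprocess)) P"

text \<open>With \<open>m = n + s + 2\<close>, the square of \<open>m\<close> exceeds
  \<open>n + 2 * s * n + 2\<close>, so words of the subroutine for alphabet size
  \<open>2 * s * n\<close> are at most \<open>m ^ (2 * c)\<close>; the doubled output needs one more
  factor \<open>m\<close>. The summand 4 in the exponent gives
  \<open>10 * n + 10 \<le> m ^ 4\<close>, even for \<open>c = 0\<close>.\<close>

lemma word_bounds:
  assumes "2 \<le> s" and W: "W = word_bound (2 * c + 4) s n"
  shows "10 * n + 10 \<le> W" "2 * s + 2 \<le> W" "2 * s * n \<le> W"
    "2 * max (word_bound c (2 * s * n) n) (n + 1) \<le> W"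
proof -
  define m where "m = n + s + 2"
  have m: "4 \<le> m" "n + 1 \<le> m" "2 * s + 2 \<le> 2 * m" using assms by (auto simp: m_def)
  have mono: "m ^ i \<le> W" if "i \<le> 2 * c + 4" for i
    unfolding W word_bound_def m_def[symmetric] using m that by (intro power_increasing) auto
  have sq: "n + 2 * s * n + 2 \<le> m ^ 2"
    unfolding m_def power2_eq_square by (simp add: algebra_simps)
  have m2: "2 * m \<le> m ^ 2" using m by (simp add: power2_eq_square)
  have "10 * m \<le> m ^ 4"
  proof -
    have "4 ^ 3 \<le> m ^ 3" using m by (intro power_mono) auto
    then have "64 * m \<le> m ^ 3 * m" by (intro mult_right_mono) auto
    moreover have "m ^ 4 = m ^ 3 * m" by (simp add: eval_nat_numeral ac_simps)
    ultimately show ?thesis by linarith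
  qed
  then show "10 * n + 10 \<le> W" using m mono[of 4] by linarith
  show "2 * s + 2 \<le> W" using m m2 mono[of 2] by simp
  show "2 * s * n \<le> W" using sq mono[of 2] by linarith
  have "2 * (n + 1) \<le> W" using m m2 mono[of 2] by simp
  moreover have "2 * word_bound c (2 * s * n) n \<le> W"
  proof -
    have "(n + 2 * s * n + 2) ^ c \<le> (m ^ 2) ^ c" using sq by (intro power_mono) auto
    then have "2 * word_bound c (2 * s * n) n \<le> m * m ^ (2 * c)"
      unfolding word_bound_def using m by (intro mult_mono) (auto simp: power_mult)
    also have "\<dots> \<le> W" using mono[of "2 * c + 1"] by simp
    finally show ?thesis .
  qed
  ultimately show "2 * max (word_bound c (2 * s * n) n) (n + 1) \<le> W" by (simp add: max_def)
qed

text \<open>Preprocessing reaches a \<open>start\<close> state of the subroutine with certainty, and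
  success with probability 1 means that the whole support of its output is good. Surplus time does
  not matter, as a halted state persists.\<close>

lemma reduction_run:
  assumes alg: "str_edit_algorithm c P \<alpha> \<beta>" and "2 \<le> s"
    and \<sigma>: "\<sigma> \<in> dyck_strings {..<s}" "length \<sigma> = n" "0 < n"
    and T: "200 * n + 2 * \<alpha> n \<le> T"
    and xy: "x = encode_left n 0 (groups \<sigma>)" "y = encode_right n 0 (groups \<sigma>)"
  shows "set_pmf (run_on_parens (2 * c + 4) s (reduction P) T \<sigma>)
    \<subseteq> (\<lambda>e. Halted (2 * e)) ` {e. Halted e \<in> approximations (edit_distance x y) (\<beta> n)}"
proof -
  define W where "W = word_bound (2 * c + 4) s n"
  define W0 where "W0 = word_bound c (2 * s * n) n"
  note W = word_bounds[OF \<open>2 \<le> s\<close> W_def]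
  define R0 :: "nat \<Rightarrow> nat" where "R0 = (\<lambda>i. if i < 1 then [n] ! i else 0)"
  define M0 where "M0 = (\<lambda>i. if i < n then map paren_code \<sigma> ! i else 0)"
  let ?R = "\<lambda>i. if i < 2 then [length x, length y] ! i else 0"
  let ?M = "\<lambda>i. if i < n then (x @ y) ! i else 0"
  let ?E = "{e. Halted e \<in> approximations (edit_distance x y) (\<beta> n)}"
  have lxy: "length x + length y = n" using groups_sizes(1)[of \<sigma>] \<sigma> xy length_encode[of n 0 "groups \<sigma>"] by simp
  obtain t where ex: "exec W preprocess (R0, M0) t (?R, ?M)" and t: "t \<le> 200 * n"
    using wp_preprocess[OF \<sigma> xy R0_def M0_def W(1-3)] unfolding wp_def by auto
  have "words W (R0, M0)"
  proof -
    have "paren_code (\<sigma> ! i) < W" if "i < n" for i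
    proof -
      have "\<sigma> ! i \<in> Open ` {..<s} \<union> Close ` {..<s}" using \<sigma> that by (auto simp: dyck_strings_def)
      then show ?thesis using W(2) by auto
    qed
    then show ?thesis using W(1) \<sigma>(2) by (auto simp: words_def R0_def M0_def)
  qed
  from exec_compile[OF ex this, of "[]" "relocate (length (compile 0 preprocess)) P" "T - t"]
  have "run W (reduction P) (t + (T - t)) (Running 0 R0 M0)
    = run W (reduction P) (T - t) (Running (length (compile 0 preprocess)) ?R ?M)"
    by (simp add: reduction_def)
  then have run: "run_on_parens (2 * c + 4) s (reduction P) T \<sigma>
    = run W (reduction P) (2 * \<alpha> n + (T - t - 2 * \<alpha> n)) (Running (length (compile 0 preprocess)) ?R ?M)"
    using t T \<sigma>(2) by (simp add: run_on_parens_def W_def start_def R0_def M0_def)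
  have "set x \<union> set y \<subseteq> {..<2 * s * n}"
    unfolding xy
  proof (rule encode_bounds)
    show "\<forall>(l, r)\<in>set (groups \<sigma>). length r \<le> length l \<and> set l \<subseteq> {..<s} \<and> set r \<subseteq> {..<s}"
      using groups_sizes(2)[of \<sigma>] groups_types[OF \<sigma>(1)] by fastforce
    show "0 + length (encode_left n 0 (groups \<sigma>)) \<le> n" using lxy xy by simp
  qed
  then have "x \<in> lists {..<2 * s * n}" "y \<in> lists {..<2 * s * n}" by auto
  with alg lxy have "measure_pmf.prob (run_on_pair c (2 * s * n) P (\<alpha> n) x y)
    (approximations (edit_distance x y) (\<beta> n)) = 1" unfolding str_edit_algorithm_def by blast
  then have "AE S in measure_pmf (run_on_pair c (2 * s * n) P (\<alpha> n) x y). S \<in> approximations (edit_distance x y) (\<beta> n)"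
    by (subst (asm) measure_pmf.prob_eq_1) auto
  then have "set_pmf (run_on_pair c (2 * s * n) P (\<alpha> n) x y) \<subseteq> approximations (edit_distance x y) (\<beta> n)"
    by (auto simp: AE_measure_pmf_iff)
  also have "\<dots> \<subseteq> Halted ` ?E" by (auto simp: approximations_def)
  also have "run_on_pair c (2 * s * n) P (\<alpha> n) x y = run W0 P (\<alpha> n) (Running 0 ?R ?M)"
    using lxy by (simp add: run_on_pair_def W0_def start_def numeral_2_eq_2)
  finally have sub: "set_pmf (run W0 P (\<alpha> n) (Running 0 ?R ?M)) \<subseteq> Halted ` ?E" .
  \<comment> \<open>The initial registers hold lengths up to \<open>n\<close>, which can exceed
    \<open>W0\<close>, for example when \<open>c = 0\<close>.\<close>
  have "\<forall>r. ?R r < max W0 (n + 1)" using lxy by (auto simp: less_2_cases_iff)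
  from run_relocate[OF sub _ _ this, of W "compile 0 preprocess"] W(4)
  have halted: "set_pmf (run W (reduction P) (2 * \<alpha> n) (Running (length (compile 0 preprocess)) ?R ?M))
    \<subseteq> (\<lambda>e. Halted (2 * e)) ` ?E"
    by (simp add: reduction_def W0_def)
  show ?thesis unfolding run run_add
  proof
    fix S
    assume "S \<in> set_pmf (run W (reduction P) (2 * \<alpha> n) (Running (length (compile 0 preprocess)) ?R ?M) \<bind>
      run W (reduction P) (T - t - 2 * \<alpha> n))"
    then obtain S' where S': "S' \<in> set_pmf (run W (reduction P) (2 * \<alpha> n) (Running (length (compile 0 preprocess)) ?R ?M))"
      "S \<in> set_pmf (run W (reduction P) (T - t - 2 * \<alpha> n) S')" by (auto simp only: set_bind_pmf)
    from subsetD[OF halted S'(1)] obtain e where "S' = Halted (2 * e)" "e \<in> ?E" by blast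
    with S'(2) show "S \<in> (\<lambda>e. Halted (2 * e)) ` ?E" by (simp add: run_Halted)
  qed
qed

theorem theorem6:
  fixes \<alpha> :: "nat \<Rightarrow> nat" and \<beta> :: "nat \<Rightarrow> real"
  assumes "\<exists>c StrEdit. str_edit_algorithm c StrEdit \<alpha> \<beta>"
  shows "\<exists>(C::real) c. \<forall>s\<ge>2. \<exists>P. \<forall>n\<ge>1. \<forall>\<sigma> \<in> dyck_strings {..<s}. length \<sigma> = n \<longrightarrow>
           (let d = dyck_distance {..<s} \<sigma>;
                z = num_blocks {..<s} \<sigma>;
                time = C * (real n * log 2 (real n) + real (\<alpha> n));
                factor = C * (\<beta> n * sqrt (log 2 (real d)) * (max 1 (log 2 (real z)))\<^sup>2)
            in measure_pmf.prob (run_on_parens c s P (nat \<lfloor>time\<rfloor>) \<sigma>) (approximations d factor)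
                 \<ge> 1 - 1 / real n - 1 / real d)"
proof -
  obtain c StrEdit where alg: "str_edit_algorithm c StrEdit \<alpha> \<beta>" using assms by blast
  show ?thesis
    unfolding Let_def
  \<comment> \<open>200 comes from the preprocessing time; it also exceeds the 2 of the relocated
    code and the factor 20 of the approximation.\<close>
  proof (intro exI[of _ "200::real"] exI[of _ "2 * c + 4"] allI impI exI[of _ "reduction StrEdit"] ballI)
    fix s n :: nat and \<sigma>
    assume s: "2 \<le> s" and n: "1 \<le> n" and \<sigma>: "\<sigma> \<in> dyck_strings {..<s}" "length \<sigma> = n"
    define d where "d = dyck_distance {..<s} \<sigma>"
    define m where "m = max 1 (log 2 (real (num_blocks {..<s} \<sigma>)))"
    define T where "T = nat \<lfloor>200 * (real n * log 2 (real n) + real (\<alpha> n))\<rfloor>"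
    let ?A = "approximations d (200 * (\<beta> n * sqrt (log 2 (real d)) * m\<^sup>2))"
    let ?p = "run_on_parens (2 * c + 4) s (reduction StrEdit) T \<sigma>"
    have "1 - 1 / real n - 1 / real d \<le> measure_pmf.prob ?p ?A"
    \<comment> \<open>For \<open>n = 1\<close> the time bound has no linear term, and for
      \<open>d = 1\<close> the factor is 0; in both cases the claimed probability is at most
      0.\<close>
    proof (cases "n = 1 \<or> d = 1")
      case True
      then have "1 - 1 / real n - 1 / real d \<le> 0" by auto
      then show ?thesis using measure_nonneg order_trans by blast
    next
      case False
      define x where "x = encode_left n 0 (groups \<sigma>)"
      define y where "y = encode_right n 0 (groups \<sigma>)"
      have lxy: "length x + length y = n"
        using groups_sizes(1)[of \<sigma>] \<sigma> length_encode[of n 0 "groups \<sigma>"] by (simp add: x_def y_def)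
      have cost: "indel x y = cost (groups \<sigma>)"
        unfolding x_def y_def using groups_sizes(2)[of \<sigma>] lxy by (intro indel_encode) (auto simp: x_def)
      have upper: "real (indel x y) \<le> 10 * m * real d" and lower: "d \<le> indel x y"
        using groups_cost[OF \<sigma>(1)] by (simp_all add: cost m_def d_def)
      \<comment> \<open>From \<open>n \<ge> 2\<close> the logarithm is at least 1 and pays for the
        linear time.\<close>
      have "200 * real n \<le> 200 * (real n * log 2 (real n))" using n False by (simp add: one_le_log_cancel_iff)
      then have "real (200 * n + 2 * \<alpha> n) \<le> 200 * (real n * log 2 (real n) + real (\<alpha> n))" by simp
      then have T: "200 * n + 2 * \<alpha> n \<le> T" unfolding T_def by (simp only: le_nat_floor)
      have "set_pmf ?p \<subseteq> ?A"
      proof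
        fix S assume "S \<in> set_pmf ?p"
        with reduction_run[OF alg s \<sigma> _ T x_def y_def] n obtain e where S: "S = Halted (2 * e)"
          and "Halted e \<in> approximations (edit_distance x y) (\<beta> n)" by auto
        then have e: "edit_distance x y \<le> e" "real e \<le> \<beta> n * real (edit_distance x y)"
          by (auto simp: approximations_def)
        have "d \<le> 2 * e" using lower indel_le_edit_distance[of x y] e(1) by linarith
        moreover have "real (2 * e) \<le> 200 * (\<beta> n * sqrt (log 2 (real d)) * m\<^sup>2) * real d"
        \<comment> \<open>With \<open>1 / 0 = 0\<close> the case \<open>d = 0\<close> is a real
          claim and asks for the exact answer 0; it holds since the indel distance is then 0 as
          well.\<close>
        proof (cases "d = 0")
          case True
          then have "edit_distance x y = 0" using upper edit_distance_le_indel[of x y] by simp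
          then show ?thesis using e True by simp
        next
          case d0: False
          then have "0 < edit_distance x y" using lower indel_le_edit_distance[of x y] by linarith
          moreover from this e have "0 \<le> \<beta> n * real (edit_distance x y)" by linarith
          \<comment> \<open>A positive distance with a valid answer forces a nonnegative
            factor.\<close>
          ultimately have \<beta>: "0 \<le> \<beta> n" by (simp add: zero_le_mult_iff)
          have "real (edit_distance x y) \<le> 10 * m * real d" using upper edit_distance_le_indel[of x y] by linarith
          then have "\<beta> n * real (edit_distance x y) \<le> \<beta> n * (10 * m * real d)" using \<beta> by (rule mult_left_mono)
          then have "real (2 * e) \<le> 2 * (\<beta> n * (10 * m * real d))" using e(2) by linarith
          also have "\<dots> = 20 * (\<beta> n * (1 * m) * real d)" by simp
          also have "\<dots> \<le> 20 * (\<beta> n * (sqrt (log 2 (real d)) * m\<^sup>2) * real d)"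
          proof -
            \<comment> \<open>Here \<open>d \<ge> 2\<close>, so the square root is at least 1;
              together with \<open>m \<ge> 1\<close> this weakens the linear dependence on
              \<open>m\<close> to the stated factor.\<close>
            have "1 \<le> sqrt (log 2 (real d))" using d0 False by (simp add: one_le_log_cancel_iff)
            moreover have "m \<le> m\<^sup>2" by (rule self_le_power) (simp_all add: m_def)
            ultimately have "1 * m \<le> sqrt (log 2 (real d)) * m\<^sup>2" by (intro mult_mono) (auto simp: m_def)
            then show ?thesis using \<beta> by (intro mult_left_mono mult_right_mono) auto
          qed
          also have "\<dots> \<le> 200 * (\<beta> n * (sqrt (log 2 (real d)) * m\<^sup>2) * real d)"
            using \<beta> d0 by (intro mult_right_mono mult_nonneg_nonneg) (auto simp: zero_le_log_cancel_iff)
          finally show ?thesis by (simp add: mult.assoc)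
        qed
        ultimately show "S \<in> ?A" unfolding S approximations_def by force
      qed
      then have "measure_pmf.prob ?p ?A = 1" by (subst measure_pmf.prob_eq_1) (auto simp: AE_measure_pmf_iff)
      moreover have "0 \<le> 1 / real n" "0 \<le> 1 / real d" by simp_all
      ultimately show ?thesis by linarith
    qed
    then show "1 - 1 / real n - 1 / real (dyck_distance {..<s} \<sigma>)
      \<le> measure_pmf.prob (run_on_parens (2 * c + 4) s (reduction StrEdit)
            (nat \<lfloor>200 * (real n * log 2 (real n) + real (\<alpha> n))\<rfloor>) \<sigma>)
          (approximations (dyck_distance {..<s} \<sigma>)
            (200 * (\<beta> n * sqrt (log 2 (real (dyck_distance {..<s} \<sigma>))) *
              (max 1 (log 2 (real (num_blocks {..<s} \<sigma>))))\<^sup>2)))"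
      unfolding d_def m_def T_def .
  qed
qed

end
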